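(* The map $$\varphi:\mathcal{E}_n(u)\to\mathcal{E}_n(u)',\qquad x\mapsto\bigl(y\mapsto\langle x,y\rangle\bigr)$$ is an isomorphism of left $\mathcal{E}_n(u)$-modules, where $\mathcal{E}_n(u)'$ is the $K$-linear dual of $\mathcal{E}_n(u)$ with the left module structure, and $\langle\cdot,\cdot\rangle$ the bilinear form, given in the context.
   Context: Let $u$ be an indeterminate, $\mathcal{A}=\mathbb{C}[u,u^{-1}]$ and $K=\mathbb{C}(u)$. $\mathcal{E}^{\mathcal{A}}_n(u)$ is the associative unital $\mathcal{A}$-algebra on generators $T_1,\dots,T_{n-1}$, $E_1,\dots,E_{n-1}$ with relations: (E1) $T_iT_j=T_jT_i$ if $|i-j|>1$; (E2) $E_iE_j=E_jE_i$ for all $i,j$; (E3) $E_iT_j=T_jE_i$ if $|i-j|>1$; (E4) $E_i^2=E_i$; (E5) $E_iT_i=T_iE_i$; (E6) $T_iT_jT_i=T_jT_iT_j$ if $|i-j|=1$; (E7) $E_jT_iT_j=T_iT_jE_i$ if $|i-j|=1$; (E8) $E_iE_jT_j=E_iT_jE_i=T_jE_iE_j$ if $|i-j|=1$; (E9) $T_i^2=1+(u-1)E_i(1+T_i)$. Put $\mathcal{E}_n(u)=\mathcal{E}^{\mathcal{A}}_n(u)\otimes_{\mathcal{A}}K$. Each $T_i$ is invertible with $T_i^{-1}=T_i+(u^{-1}-1)E_i(1+T_i)$. For $1\le i<j\le n$ put $E_{ij}=E_i$ if $j=i+1$ and otherwise $E_{ij}=T_iT_{i+1}\cdots T_{j-2}E_{j-1}T_{j-2}^{-1}\cdots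 T_{i+1}^{-1}T_i^{-1}$. For nonempty $I\subset\mathbf{n}:=\{1,\dots,n\}$ put $E_I=\prod_{(i,j)\in I\times I,\ i<j}E_{ij}$ ($E_I=1$ if $|I|=1$); the $E_{ij}$ commute, so the order is irrelevant. $\mathcal{P}_n$ is the set of all set partitions of $\mathbf{n}$; for $A=\{I_1,\dots,I_k\}\in\mathcal{P}_n$ put $E_A=\prod_iE_{I_i}$. $T_w=T_{i_1}\cdots T_{i_r}$ for any reduced expression $w=s_{i_1}\cdots s_{i_r}\in S_n$, $s_i=(i,i+1)$. The set $G=\{E_AT_w\mid A\in\mathcal{P}_n,\,w\in S_n\}=\{T_wE_A\}$ is a $K$-basis of $\mathcal{E}_n(u)$. $\ast$ is the $K$-linear antiautomorphism of $\mathcal{E}_n(u)$ with $T_i^\ast=T_i$, $E_i^\ast=E_i$. The dual $\mathcal{E}_n(u)'$ is a left $\mathcal{E}_n(u)$-module by $(xf)(y)=f(x^\ast y)$ for $x,y\in\mathcal{E}_n(u)$, $f\in\mathcal{E}_n(u)'$. Let $\epsilon:\mathcal{E}_n(u)\to K$ be the linear map sending $x$ to the coefficient of $E_{\mathbf{n}}$ (the basis element with $w=1$ and $A$ the set partition with the single block $\mathbf{n}$) when $x$ is written in the basis $G$. Put $\langle x,y\rangle=\epsilon(x^\ast y)$. *)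

theory Defs
  imports
    "HOL-Computational_Algebra.Polynomial"
    "HOL-Computational_Algebra.Fraction_Field"
    "HOL-Combinatorics.Permutations"
    "HOL-Library.Poly_Mapping"
    "HOL-Library.Disjoint_Sets"
    "HOL-Library.FuncSet"
    "HOL-Algebra.QuotRing"
    "HOL-Algebra.Module"
begin

type_synonym ratfun = "complex poly fract"

definition u :: ratfun where
  "u = Fract [:0, 1:] 1"

text \<open>The Laurent polynomials, as a subring of the field of rational functions.\<close>

definition laurent :: "ratfun set" where
  "laurent = {Fract p 1 / u ^ k | p k. True}"

text \<open>The additive notation for concatenation turns the type of finitely supported functions
  on words, with the convolution product of \<^theory>\<open>HOL-Library.Poly_Mapping\<close>, into the
  free associative unital algebra.\<close>

datatype 'g fword = FWord (letters: "'g list")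

instantiation fword :: (type) monoid_add
begin

definition zero_fword :: "'a fword" where
  "0 = FWord []"

definition plus_fword :: "'a fword \<Rightarrow> 'a fword \<Rightarrow> 'a fword" where
  "v + w = FWord (letters v @ letters w)"

instance
  by standard (simp_all add: zero_fword_def plus_fword_def)

end

definition free_const :: "'k \<Rightarrow> ('g fword \<Rightarrow>\<^sub>0 'k::ring_1)" where
  "free_const c = Poly_Mapping.single 0 c"

definition free_gen :: "'g \<Rightarrow> ('g fword \<Rightarrow>\<^sub>0 'k::ring_1)" where
  "free_gen g = Poly_Mapping.single (FWord [g]) 1"

text \<open>The free algebra over a coefficient subring \<open>A\<close> on a set \<open>X\<close> of generators.\<close>

definition free_algebra :: "'k::ring_1 set \<Rightarrow> 'g set \<Rightarrow> ('g fword \<Rightarrow>\<^sub>0 'k) ring" where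
  "free_algebra A X =
     \<lparr>carrier = {p. (\<forall>w \<in> Poly_Mapping.keys p. set (letters w) \<subseteq> X) \<and>
                    (\<forall>w. Poly_Mapping.lookup p w \<in> A)},
      monoid.mult = (*), one = 1, ring.zero = 0, add = (+)\<rparr>"

text \<open>Let \<open>R\<close> be an algebra over a subring \<open>A\<close> of a commutative ring of type \<open>'k\<close>, with scalar
  multiplication \<open>sm\<close>.  The tensor product of \<open>R\<close> with the type \<open>'k\<close> over \<open>A\<close> is the free
  abelian group on the pairs \<open>(x, k)\<close>, modulo the bilinearity relations.  The free abelian group
  carries the product with \<open>(x, k) (y, l) = (x y, k l)\<close>; the subgroup generated by the
  relations is an ideal for it, so it equals the ideal used below.\<close>

definition pairs_ring ::
  "('m, 'b) ring_scheme \<Rightarrow> (('m \<times> 'k::comm_ring_1) \<Rightarrow>\<^sub>0 int) ring" where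
  "pairs_ring R =
     \<lparr>carrier = {p. Poly_Mapping.keys p \<subseteq> carrier R \<times> UNIV},
      monoid.mult = (\<lambda>p q. \<Sum>a \<in> Poly_Mapping.keys p. \<Sum>b \<in> Poly_Mapping.keys q.
                Poly_Mapping.single (fst a \<otimes>\<^bsub>R\<^esub> fst b, snd a * snd b)
                  (Poly_Mapping.lookup p a * Poly_Mapping.lookup q b)),
      one = Poly_Mapping.single (\<one>\<^bsub>R\<^esub>, 1) 1,
      ring.zero = 0,
      add = (+)\<rparr>"

definition tensor_relations ::
  "('m, 'b) ring_scheme \<Rightarrow> 'k::comm_ring_1 set \<Rightarrow> ('k \<Rightarrow> 'm \<Rightarrow> 'm) \<Rightarrow>
   (('m \<times> 'k) \<Rightarrow>\<^sub>0 int) set" where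
  "tensor_relations R A sm =
     {Poly_Mapping.single (x \<oplus>\<^bsub>R\<^esub> y, k) 1
        - Poly_Mapping.single (x, k) 1 - Poly_Mapping.single (y, k) 1
      | x y k. x \<in> carrier R \<and> y \<in> carrier R} \<union>
     {Poly_Mapping.single (x, k + l) 1
        - Poly_Mapping.single (x, k) 1 - Poly_Mapping.single (x, l) 1
      | x k l. x \<in> carrier R} \<union>
     {Poly_Mapping.single (sm a x, k) 1 - Poly_Mapping.single (x, a * k) 1
      | a x k. a \<in> A \<and> x \<in> carrier R}"

definition tensor_ideal ::
  "('m, 'b) ring_scheme \<Rightarrow> 'k::comm_ring_1 set \<Rightarrow> ('k \<Rightarrow> 'm \<Rightarrow> 'm) \<Rightarrow>
   (('m \<times> 'k) \<Rightarrow>\<^sub>0 int) set" where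
  "tensor_ideal R A sm = Idl\<^bsub>pairs_ring R\<^esub> (tensor_relations R A sm)"

definition base_change ::
  "('m, 'b) ring_scheme \<Rightarrow> 'k::comm_ring_1 set \<Rightarrow> ('k \<Rightarrow> 'm \<Rightarrow> 'm) \<Rightarrow>
   (('m \<times> 'k) \<Rightarrow>\<^sub>0 int) set ring" where
  "base_change R A sm = pairs_ring R Quot tensor_ideal R A sm"

definition pure_tensor ::
  "('m, 'b) ring_scheme \<Rightarrow> 'k::comm_ring_1 set \<Rightarrow> ('k \<Rightarrow> 'm \<Rightarrow> 'm) \<Rightarrow> 'm \<Rightarrow> 'k \<Rightarrow>
   (('m \<times> 'k) \<Rightarrow>\<^sub>0 int) set" where
  "pure_tensor R A sm x k =
     tensor_ideal R A sm +>\<^bsub>pairs_ring R\<^esub> Poly_Mapping.single (x, k) 1"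

datatype bt_letter = LetT nat | LetE nat

type_synonym bt_free = "bt_letter fword \<Rightarrow>\<^sub>0 ratfun"

definition bt_free_algebra :: "nat \<Rightarrow> bt_free ring" where
  "bt_free_algebra n = free_algebra laurent (LetT ` {1..<n} \<union> LetE ` {1..<n})"

abbreviation fT :: "nat \<Rightarrow> bt_free" where "fT i \<equiv> free_gen (LetT i)"
abbreviation fE :: "nat \<Rightarrow> bt_free" where "fE i \<equiv> free_gen (LetE i)"

text \<open>A relation \<open>l = r\<close> is represented by the difference \<open>l - r\<close>.\<close>

definition bt_relations :: "nat \<Rightarrow> bt_free set" where
  "bt_relations n =
     {fT i * fT j - fT j * fT i | i j.
        i \<in> {1..<n} \<and> j \<in> {1..<n} \<and> \<bar>int i - int j\<bar> > 1} \<union>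
     {fE i * fE j - fE j * fE i | i j.
        i \<in> {1..<n} \<and> j \<in> {1..<n}} \<union>
     {fE i * fT j - fT j * fE i | i j.
        i \<in> {1..<n} \<and> j \<in> {1..<n} \<and> \<bar>int i - int j\<bar> > 1} \<union>
     {fE i ^ 2 - fE i | i.
        i \<in> {1..<n}} \<union>
     {fE i * fT i - fT i * fE i | i.
        i \<in> {1..<n}} \<union>
     {fT i * fT j * fT i - fT j * fT i * fT j | i j.
        i \<in> {1..<n} \<and> j \<in> {1..<n} \<and> \<bar>int i - int j\<bar> = 1} \<union>
     {fE j * fT i * fT j - fT i * fT j * fE i | i j.
        i \<in> {1..<n} \<and> j \<in> {1..<n} \<and> \<bar>int i - int j\<bar> = 1} \<union>
     {fE i * fE j * fT j - fE i * fT j * fE i | i j.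
        i \<in> {1..<n} \<and> j \<in> {1..<n} \<and> \<bar>int i - int j\<bar> = 1} \<union>
     {fE i * fT j * fE i - fT j * fE i * fE j | i j.
        i \<in> {1..<n} \<and> j \<in> {1..<n} \<and> \<bar>int i - int j\<bar> = 1} \<union>
     {fT i ^ 2 - (1 + free_const (u - 1) * fE i * (1 + fT i)) | i.
        i \<in> {1..<n}}"

definition bt_ideal :: "nat \<Rightarrow> bt_free set" where
  "bt_ideal n = Idl\<^bsub>bt_free_algebra n\<^esub> (bt_relations n)"

definition bt_laurent_algebra :: "nat \<Rightarrow> bt_free set ring" where
  "bt_laurent_algebra n = bt_free_algebra n Quot bt_ideal n"

definition bt_class :: "nat \<Rightarrow> bt_free \<Rightarrow> bt_free set" where
  "bt_class n p = bt_ideal n +>\<^bsub>bt_free_algebra n\<^esub> p"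

definition bt_laurent_smult :: "nat \<Rightarrow> ratfun \<Rightarrow> bt_free set \<Rightarrow> bt_free set" where
  "bt_laurent_smult n a x = bt_class n (free_const a) \<otimes>\<^bsub>bt_laurent_algebra n\<^esub> x"

type_synonym bt = "((bt_free set \<times> ratfun) \<Rightarrow>\<^sub>0 int) set"

definition bt_algebra :: "nat \<Rightarrow> bt ring" where
  "bt_algebra n = base_change (bt_laurent_algebra n) laurent (bt_laurent_smult n)"

definition bt_pure :: "nat \<Rightarrow> bt_free set \<Rightarrow> ratfun \<Rightarrow> bt" where
  "bt_pure n = pure_tensor (bt_laurent_algebra n) laurent (bt_laurent_smult n)"

definition bt_smult :: "nat \<Rightarrow> ratfun \<Rightarrow> bt \<Rightarrow> bt" where
  "bt_smult n k x = bt_pure n \<one>\<^bsub>bt_laurent_algebra n\<^esub> k \<otimes>\<^bsub>bt_algebra n\<^esub> x"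

definition bt_T :: "nat \<Rightarrow> nat \<Rightarrow> bt" where
  "bt_T n i = bt_pure n (bt_class n (fT i)) 1"

definition bt_E :: "nat \<Rightarrow> nat \<Rightarrow> bt" where
  "bt_E n i = bt_pure n (bt_class n (fE i)) 1"

definition list_prod :: "('a, 'b) monoid_scheme \<Rightarrow> 'a list \<Rightarrow> 'a" where
  "list_prod M xs = foldr (\<otimes>\<^bsub>M\<^esub>) xs \<one>\<^bsub>M\<^esub>"

text \<open>The list \<open>[i..<j-1]\<close> is \<open>i, i+1, \<dots>, j-2\<close>.\<close>

definition bt_E_pair :: "nat \<Rightarrow> nat \<Rightarrow> nat \<Rightarrow> bt" where
  "bt_E_pair n i j =
     (if j = i + 1 then bt_E n i
      else list_prod (bt_algebra n) (map (bt_T n) [i..<j-1])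
             \<otimes>\<^bsub>bt_algebra n\<^esub> bt_E n (j - 1)
             \<otimes>\<^bsub>bt_algebra n\<^esub> list_prod (bt_algebra n)
                   (map (\<lambda>k. inv\<^bsub>bt_algebra n\<^esub> (bt_T n k)) (rev [i..<j-1])))"

text \<open>\<^const>\<open>finprod\<close> is used in a noncommutative ring here; it is well-defined because
  the factors commute pairwise.\<close>

definition bt_E_block :: "nat \<Rightarrow> nat set \<Rightarrow> bt" where
  "bt_E_block n I =
     finprod (bt_algebra n) (\<lambda>(i, j). bt_E_pair n i j) {(i, j) \<in> I \<times> I. i < j}"

definition bt_E_part :: "nat \<Rightarrow> nat set set \<Rightarrow> bt" where
  "bt_E_part n A = finprod (bt_algebra n) (bt_E_block n) A"

definition word_perm :: "nat list \<Rightarrow> nat \<Rightarrow> nat" where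
  "word_perm is = foldr (\<lambda>i w. transpose i (i + 1) \<circ> w) is id"

definition reduced_expression :: "nat \<Rightarrow> (nat \<Rightarrow> nat) \<Rightarrow> nat list \<Rightarrow> bool" where
  "reduced_expression n w is \<longleftrightarrow>
     set is \<subseteq> {1..<n} \<and> word_perm is = w \<and>
     (\<forall>js. set js \<subseteq> {1..<n} \<and> word_perm js = w \<longrightarrow> length is \<le> length js)"

text \<open>By the braid relations the choice of the reduced expression is irrelevant.\<close>

definition bt_T_perm :: "nat \<Rightarrow> (nat \<Rightarrow> nat) \<Rightarrow> bt" where
  "bt_T_perm n w =
     list_prod (bt_algebra n) (map (bt_T n) (SOME is. reduced_expression n w is))"

definition bt_basis :: "nat \<Rightarrow> bt set" where
  "bt_basis n =
     {bt_E_part n A \<otimes>\<^bsub>bt_algebra n\<^esub> bt_T_perm n w | A w.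
        partition_on {1..n} A \<and> w permutes {1..n}}"

definition bt_star :: "nat \<Rightarrow> bt \<Rightarrow> bt" where
  "bt_star n = (THE s.
     s \<in> extensional (carrier (bt_algebra n)) \<and>
     bij_betw s (carrier (bt_algebra n)) (carrier (bt_algebra n)) \<and>
     (\<forall>x \<in> carrier (bt_algebra n). \<forall>y \<in> carrier (bt_algebra n).
        s (x \<oplus>\<^bsub>bt_algebra n\<^esub> y) = s x \<oplus>\<^bsub>bt_algebra n\<^esub> s y) \<and>
     (\<forall>k. \<forall>x \<in> carrier (bt_algebra n). s (bt_smult n k x) = bt_smult n k (s x)) \<and>
     (\<forall>x \<in> carrier (bt_algebra n). \<forall>y \<in> carrier (bt_algebra n).
        s (x \<otimes>\<^bsub>bt_algebra n\<^esub> y) = s y \<otimes>\<^bsub>bt_algebra n\<^esub> s x) \<and>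
     s \<one>\<^bsub>bt_algebra n\<^esub> = \<one>\<^bsub>bt_algebra n\<^esub> \<and>
     (\<forall>i \<in> {1..<n}. s (bt_T n i) = bt_T n i \<and> s (bt_E n i) = bt_E n i))"

definition bt_eps :: "nat \<Rightarrow> bt \<Rightarrow> ratfun" where
  "bt_eps n x = (THE a. \<exists>c.
     x = finsum (bt_algebra n) (\<lambda>g. bt_smult n (c g) g) (bt_basis n) \<and>
     a = c (bt_E_part n {{1..n}}))"

definition bt_form :: "nat \<Rightarrow> bt \<Rightarrow> bt \<Rightarrow> ratfun" where
  "bt_form n x y = bt_eps n (bt_star n x \<otimes>\<^bsub>bt_algebra n\<^esub> y)"

text \<open>The library locale \<^locale>\<open>module\<close> requires a commutative ring of scalars, so only its
  record is reused; the fields \<open>mult\<close> and \<open>one\<close> of a module play no role.\<close>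

definition left_module :: "('a, 'c) ring_scheme \<Rightarrow> ('a, 'b, 'd) module_scheme \<Rightarrow> bool" where
  "left_module R M \<longleftrightarrow>
     ring R \<and> abelian_group M \<and>
     (\<forall>a \<in> carrier R. \<forall>x \<in> carrier M. a \<odot>\<^bsub>M\<^esub> x \<in> carrier M) \<and>
     (\<forall>a \<in> carrier R. \<forall>b \<in> carrier R. \<forall>x \<in> carrier M.
        (a \<oplus>\<^bsub>R\<^esub> b) \<odot>\<^bsub>M\<^esub> x = (a \<odot>\<^bsub>M\<^esub> x) \<oplus>\<^bsub>M\<^esub> (b \<odot>\<^bsub>M\<^esub> x)) \<and>
     (\<forall>a \<in> carrier R. \<forall>x \<in> carrier M. \<forall>y \<in> carrier M.
        a \<odot>\<^bsub>M\<^esub> (x \<oplus>\<^bsub>M\<^esub> y) = (a \<odot>\<^bsub>M\<^esub> x) \<oplus>\<^bsub>M\<^esub> (a \<odot>\<^bsub>M\<^esub> y)) \<and>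
     (\<forall>a \<in> carrier R. \<forall>b \<in> carrier R. \<forall>x \<in> carrier M.
        (a \<otimes>\<^bsub>R\<^esub> b) \<odot>\<^bsub>M\<^esub> x = a \<odot>\<^bsub>M\<^esub> (b \<odot>\<^bsub>M\<^esub> x)) \<and>
     (\<forall>x \<in> carrier M. \<one>\<^bsub>R\<^esub> \<odot>\<^bsub>M\<^esub> x = x)"

definition left_module_iso ::
  "('a, 'c) ring_scheme \<Rightarrow> ('a, 'b, 'd) module_scheme \<Rightarrow> ('a, 'e, 'f) module_scheme \<Rightarrow>
   ('b \<Rightarrow> 'e) \<Rightarrow> bool" where
  "left_module_iso R M N h \<longleftrightarrow>
     left_module R M \<and> left_module R N \<and>
     bij_betw h (carrier M) (carrier N) \<and>
     (\<forall>x \<in> carrier M. \<forall>y \<in> carrier M. h (x \<oplus>\<^bsub>M\<^esub> y) = h x \<oplus>\<^bsub>N\<^esub> h y) \<and>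
     (\<forall>a \<in> carrier R. \<forall>x \<in> carrier M. h (a \<odot>\<^bsub>M\<^esub> x) = a \<odot>\<^bsub>N\<^esub> h x)"

definition bt_regular_module :: "nat \<Rightarrow> (bt, bt) module" where
  "bt_regular_module n =
     ring.extend (bt_algebra n) \<lparr>module.smult = (\<otimes>\<^bsub>bt_algebra n\<^esub>)\<rparr>"

text \<open>Functionals are extensional, so that they are determined by their values on the carrier.\<close>

definition bt_dual :: "nat \<Rightarrow> (bt \<Rightarrow> ratfun) set" where
  "bt_dual n =
     {f \<in> extensional (carrier (bt_algebra n)).
        (\<forall>x \<in> carrier (bt_algebra n). \<forall>y \<in> carrier (bt_algebra n).
           f (x \<oplus>\<^bsub>bt_algebra n\<^esub> y) = f x + f y) \<and>
        (\<forall>k. \<forall>x \<in> carrier (bt_algebra n). f (bt_smult n k x) = k * f x)}"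

definition bt_dual_module :: "nat \<Rightarrow> (bt, bt \<Rightarrow> ratfun) module" where
  "bt_dual_module n =
     \<lparr>carrier = bt_dual n,
      monoid.mult = undefined,
      one = undefined,
      ring.zero = (\<lambda>y \<in> carrier (bt_algebra n). 0),
      add = (\<lambda>f g. \<lambda>y \<in> carrier (bt_algebra n). f y + g y),
      module.smult =
        (\<lambda>x f. \<lambda>y \<in> carrier (bt_algebra n). f (bt_star n x \<otimes>\<^bsub>bt_algebra n\<^esub> y))\<rparr>"

definition bt_phi :: "nat \<Rightarrow> bt \<Rightarrow> bt \<Rightarrow> ratfun" where
  "bt_phi n x = (\<lambda>y \<in> carrier (bt_algebra n). bt_form n x y)"

end

theory Submission
  imports Defs
begin

text \<open>The map \<open>\<phi>\<close> is linear, the algebra has finite dimension, and \<open>(a b)\<^sup>* = b\<^sup>* a\<^sup>*\<close> makes \<open>\<phi>\<close> a module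
map.  So the theorem says that the form \<open>\<langle>x, y\<rangle> = \<epsilon>(x\<^sup>* y)\<close> has no radical.  The proof specializes at
\<open>u = 1\<close>, where the algebra degenerates to a semidirect product of the commutative algebra of the
idempotents \<open>E\<^sub>A\<close>, with \<open>E\<^sub>A E\<^sub>B\<close> given by the join of \<open>A\<close> and \<open>B\<close>, with the symmetric group, and it
reads off nondegeneracy there.

The specialization happens in a faithful representation.  Functions on words, each position of which
carries a colour and a label, are acted on by \<open>E\<^sub>i\<close> as the restriction to words with equal colours
at \<open>i\<close> and \<open>i + 1\<close>, and by \<open>T\<^sub>i\<close> as a place permutation deformed, for equal colours, as in the action of
a Hecke algebra on tensor space.  The universal property turns these operators into an action of the
algebra; it also yields the antiautomorphism, as the map into the opposite ring that fixes the
generators.  At \<open>u = 1\<close>, \<open>E\<^sub>A T\<^sub>w\<close> sends \<open>\<psi>\<close> to the function with the value \<open>\<psi> (f \<circ> w)\<close> at the words \<open>f\<close> whose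
colouring is constant on the blocks of \<open>A\<close>, and \<open>0\<close> at all others; this uses only that \<open>T\<^sub>w\<close> is the product along some word for \<open>w\<close>.
The operators for different \<open>(A, w)\<close> are linearly independent (\<open>index_op_independent\<close>).  A nontrivial
relation between the \<open>E\<^sub>A T\<^sub>w\<close> can be divided by a coefficient with a pole of maximal order, or a zero of
minimal order, at \<open>1\<close>; its value at \<open>1\<close> would be a nontrivial relation between the operators, so
the \<open>E\<^sub>A T\<^sub>w\<close> are independent (\<open>basis_independent\<close>).  By the same scaling, if an element acts
by operators that specialize, so do its coordinates (\<open>specializing_coordinates\<close>).

That the \<open>E\<^sub>A T\<^sub>w\<close> span is a dimension count.  Conjugation by \<open>T\<^sub>k\<close> permutes the \<open>E\<^sub>i\<^sub>j\<close> (\<open>conj_E_pair\<close>), so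
their relations follow from those between the generators; their products are exactly
the \<open>E\<^sub>A\<close> (\<open>edge_monoid_E_part\<close>).  With \<open>v\<close> running over one normal form word for each permutation, the span
of the \<open>E\<^sub>A T\<^sub>v\<close> is closed under right multiplication by generators (\<open>lspan_nf_T\<close>).  So the
dimension is at most the number of pairs \<open>(A, w)\<close>, which is the size of the independent family.

Suppose that \<open>x \<noteq> 0\<close> lies in the radical.  Scale \<open>x\<close> so that its coordinates have values at \<open>1\<close>
that are not all zero, and let \<open>d\<^sub>A\<close> be those at \<open>E\<^sub>A T\<^sub>z\<close>, for a fixed \<open>z\<close> for which they do not all vanish.
Let \<open>F(c)\<close> be the sum of the \<open>d\<^sub>A\<close> over the partitions \<open>A\<close> whose blocks are monochromatic
for the colouring \<open>c\<close>.  For every partition \<open>B\<close>, the specialized coordinates of \<open>x\<^sup>* E\<^sub>B T\<^sub>z\<close> with trivial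
permutation part give, after renaming points by \<open>z\<close>, numbers \<open>e\<^sub>C\<close> whose sum over the \<open>C\<close> with monochromatic
blocks is \<open>F(c)\<close> when the blocks of \<open>B\<close> are monochromatic, and \<open>0\<close> otherwise.  The number at the one-block
partition vanishes, because \<open>\<epsilon>(x\<^sup>* E\<^sub>B T\<^sub>z) = 0\<close>.  Take \<open>B\<close> to be the kernel of a colouring \<open>b\<close> that is as
coarse as possible with \<open>F(b) \<noteq> 0\<close>.  Summation over all colourings with \<open>m\<close> colours gives
\<open>\<Sum>\<^sub>C e\<^sub>C m\<^bsup>|C|\<^esup> = F(b) m (m - 1) \<dots> (m - |B| + 1)\<close>.  The coefficient of \<open>m\<close> on the left is the number at the
one-block partition, hence \<open>0\<close>, and on the right it is a nonzero multiple of \<open>F(b)\<close>: a contradiction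
(\<open>coarsest_colouring\<close>).  So \<open>F\<close> vanishes identically, and with it all \<open>d\<^sub>A\<close>.  The number
\<open>(- 1) (- 2) \<dots> (1 - |B|)\<close> that makes this work is a value of the Moebius function of the partition lattice.\<close>

section \<open>Finitely supported functions and quotients\<close>

lemma poly_mapping_keys_induct [consumes 1, case_names zero single add]:
  fixes p :: "'a \<Rightarrow>\<^sub>0 'c::comm_monoid_add"
  assumes "Poly_Mapping.keys p \<subseteq> C"
    and zero: "P 0"
    and single: "\<And>a c. a \<in> C \<Longrightarrow> P (Poly_Mapping.single a c)"
    and add: "\<And>p q. Poly_Mapping.keys p \<subseteq> C \<Longrightarrow> Poly_Mapping.keys q \<subseteq> C \<Longrightarrow> P p \<Longrightarrow> P q \<Longrightarrow> P (p + q)"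
  shows "P p"
  using assms(1)
proof (induction p rule: Poly_Mapping.update_induct)
  case const
  show ?case by (rule zero)
next
  case (update f a b)
  have eq: "Poly_Mapping.update a b f = f + Poly_Mapping.single a b"
    using update.hyps
    by (intro poly_mapping_eqI)
      (auto simp: lookup_update lookup_add lookup_single when_def in_keys_iff)
  have "a \<in> C" "Poly_Mapping.keys f \<subseteq> C"
    using update.prems update.hyps by (auto simp: keys_update)
  then show ?case
    unfolding eq using update.IH by (intro add single) auto
qed

lemma quotient_lift:
  assumes "ring R" "ring S" and I: "ideal I R" and f: "f \<in> ring_hom R S"
    and zero: "\<And>x. x \<in> I \<Longrightarrow> f x = \<zero>\<^bsub>S\<^esub>"
  obtains g where "g \<in> ring_hom (R Quot I) S"
    "\<And>x. x \<in> carrier R \<Longrightarrow> g (I +>\<^bsub>R\<^esub> x) = f x"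
proof -
  interpret R: ring R by fact
  interpret S: ring S by fact
  interpret I: ideal I R by fact
  interpret f: ring_hom_ring R S f
    by (rule ring_hom_ringI2[OF assms(1,2,4)])
  define g where "g = (\<lambda>X. f (SOME x. x \<in> X))"
  have g: "g (I +>\<^bsub>R\<^esub> x) = f x" if x: "x \<in> carrier R" for x
  proof -
    have "x \<in> I +>\<^bsub>R\<^esub> x" using I.a_rcos_self x by blast
    then have "(SOME y. y \<in> I +>\<^bsub>R\<^esub> x) \<in> I +>\<^bsub>R\<^esub> x" by (rule someI)
    then obtain i where "i \<in> I" "(SOME y. y \<in> I +>\<^bsub>R\<^esub> x) = i \<oplus>\<^bsub>R\<^esub> x"
      by (auto simp: a_r_coset_def')
    then show ?thesis
      using x zero[of i] I.Icarr[of i] by (simp add: g_def)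
  qed
  have car: "\<exists>x \<in> carrier R. X = I +>\<^bsub>R\<^esub> x" if "X \<in> carrier (R Quot I)" for X
    using that by (auto simp: FactRing_def A_RCOSETS_def')
  have \<pi>: "(+>\<^bsub>R\<^esub>) I \<in> ring_hom R (R Quot I)" by (rule I.rcos_ring_hom)
  have "g \<in> ring_hom (R Quot I) S"
  proof (rule ring_hom_memI)
    fix X assume "X \<in> carrier (R Quot I)"
    then show "g X \<in> carrier S" using car[of X] g by auto
  next
    fix X Y assume "X \<in> carrier (R Quot I)" "Y \<in> carrier (R Quot I)"
    then obtain x y where xy: "x \<in> carrier R" "X = I +>\<^bsub>R\<^esub> x" "y \<in> carrier R" "Y = I +>\<^bsub>R\<^esub> y"
      by (auto dest!: car)
    show "g (X \<otimes>\<^bsub>R Quot I\<^esub> Y) = g X \<otimes>\<^bsub>S\<^esub> g Y"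
      using xy g ring_hom_mult[OF \<pi>, of x y, symmetric] by simp
    show "g (X \<oplus>\<^bsub>R Quot I\<^esub> Y) = g X \<oplus>\<^bsub>S\<^esub> g Y"
      using xy g ring_hom_add[OF \<pi>, of x y, symmetric] by simp
  next
    show "g \<one>\<^bsub>R Quot I\<^esub> = \<one>\<^bsub>S\<^esub>"
      using g[of "\<one>\<^bsub>R\<^esub>"] ring_hom_one[OF \<pi>] by simp
  qed
  then show thesis using g that by blast
qed

lemma hom_vanishes_on_genideal:
  assumes "ring R" "ring S" and f: "f \<in> ring_hom R S" and X: "X \<subseteq> carrier R"
    and zero: "\<And>x. x \<in> X \<Longrightarrow> f x = \<zero>\<^bsub>S\<^esub>" and x: "x \<in> Idl\<^bsub>R\<^esub> X"
  shows "f x = \<zero>\<^bsub>S\<^esub>"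
proof -
  interpret R: ring R by fact
  interpret f: ring_hom_ring R S f
    by (rule ring_hom_ringI2[OF assms(1-3)])
  have "X \<subseteq> a_kernel R S f"
    using X zero unfolding a_kernel_def' by blast
  then have "Idl\<^bsub>R\<^esub> X \<subseteq> a_kernel R S f"
    by (rule R.genideal_minimal[OF f.kernel_is_ideal])
  then show ?thesis using x unfolding a_kernel_def' by blast
qed

section \<open>Algebras over a field\<close>

locale kalgebra = ring R for R (structure) +
  fixes sm :: "'k::field \<Rightarrow> 'a \<Rightarrow> 'a"
  assumes sm_closed [simp, intro]: "x \<in> carrier R \<Longrightarrow> sm k x \<in> carrier R"
    and sm_add_left: "x \<in> carrier R \<Longrightarrow> sm (k + l) x = sm k x \<oplus> sm l x"
    and sm_add_right: "x \<in> carrier R \<Longrightarrow> y \<in> carrier R \<Longrightarrow> sm k (x \<oplus> y) = sm k x \<oplus> sm k y"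
    and sm_sm: "x \<in> carrier R \<Longrightarrow> sm k (sm l x) = sm (k * l) x"
    and sm_one [simp]: "x \<in> carrier R \<Longrightarrow> sm 1 x = x"
    and sm_mult_left: "x \<in> carrier R \<Longrightarrow> y \<in> carrier R \<Longrightarrow> sm k x \<otimes> y = sm k (x \<otimes> y)"
    and sm_mult_right: "x \<in> carrier R \<Longrightarrow> y \<in> carrier R \<Longrightarrow> x \<otimes> sm k y = sm k (x \<otimes> y)"
begin

lemma sm_zero_left [simp]: "x \<in> carrier R \<Longrightarrow> sm 0 x = \<zero>"
  using sm_add_left[of x 0 0] by (metis add.l_cancel_one' add_0 sm_closed)

lemma sm_zero_right [simp]: "sm k \<zero> = \<zero>"
  using sm_add_right[of \<zero> \<zero> k] by (metis add.l_cancel_one' l_zero sm_closed zero_closed)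

lemma sm_uminus: "x \<in> carrier R \<Longrightarrow> sm (- k) x = \<ominus> sm k x"
  using sm_add_left[of x "- k" k] by (simp add: minus_equality)

lemma sm_minus_one: "x \<in> carrier R \<Longrightarrow> sm (- 1) x = \<ominus> x"
  by (simp add: sm_uminus)

lemma sm_finsum:
  assumes "finite S" "f \<in> S \<rightarrow> carrier R"
  shows "sm k (finsum R f S) = finsum R (\<lambda>i. sm k (f i)) S"
  using assms by (induction S) (auto simp: finsum_insert sm_add_right Pi_def)

lemma finsum_sm_sum:
  assumes "finite S" "x \<in> carrier R"
  shows "finsum R (\<lambda>i. sm (c i) x) S = sm (\<Sum>i\<in>S. c i) x"
  using assms by (induction S) (auto simp: sm_add_left)

lemma finsum_swap_sum:
  assumes "finite S" "finite S'" "\<And>i j. i \<in> S \<Longrightarrow> j \<in> S' \<Longrightarrow> f i j \<in> carrier R"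
  shows "finsum R (\<lambda>i. finsum R (f i) S') S = finsum R (\<lambda>j. finsum R (\<lambda>i. f i j) S) S'"
  using assms
proof (induction S)
  case empty
  then show ?case by simp
next
  case (insert a S)
  have "finsum R (\<lambda>i. finsum R (f i) S') (insert a S)
      = finsum R (f a) S' \<oplus> finsum R (\<lambda>i. finsum R (f i) S') S"
    using insert by (subst finsum_insert) (auto intro!: finsum_closed)
  also have "\<dots> = finsum R (f a) S' \<oplus> finsum R (\<lambda>j. finsum R (\<lambda>i. f i j) S) S'"
    using insert by simp
  also have "\<dots> = finsum R (\<lambda>j. f a j \<oplus> finsum R (\<lambda>i. f i j) S) S'"
    using insert by (subst finsum_addf) (auto intro!: finsum_closed)
  also have "\<dots> = finsum R (\<lambda>j. finsum R (\<lambda>i. f i j) (insert a S)) S'"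
    using insert by (intro finsum_cong') (auto simp: finsum_insert Pi_def intro!: finsum_closed)
  finally show ?case .
qed

text \<open>The linear extension of a map given on a basis.  The map \<open>\<kappa>\<close> turns coefficients into scalars: it is the
identity for the free algebra and the inclusion of the integers for formal pairs.\<close>

definition lin_ext :: "('c::zero \<Rightarrow> 'k) \<Rightarrow> ('g \<Rightarrow> 'a) \<Rightarrow> ('g \<Rightarrow>\<^sub>0 'c) \<Rightarrow> 'a" where
  "lin_ext \<kappa> \<phi> p = finsum R (\<lambda>g. sm (\<kappa> (Poly_Mapping.lookup p g)) (\<phi> g)) (Poly_Mapping.keys p)"

lemma lin_ext_closed [simp]: "range \<phi> \<subseteq> carrier R \<Longrightarrow> lin_ext \<kappa> \<phi> p \<in> carrier R"
  by (auto simp: lin_ext_def intro!: finsum_closed)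

lemma lin_ext_superset:
  assumes "range \<phi> \<subseteq> carrier R" "\<kappa> 0 = 0" "finite S" "Poly_Mapping.keys p \<subseteq> S"
  shows "lin_ext \<kappa> \<phi> p = finsum R (\<lambda>g. sm (\<kappa> (Poly_Mapping.lookup p g)) (\<phi> g)) S"
  unfolding lin_ext_def
proof (rule add.finprod_mono_neutral_cong_left)
  show "finite S" "Poly_Mapping.keys p \<subseteq> S" by fact+
  show "(\<lambda>g. sm (\<kappa> (Poly_Mapping.lookup p g)) (\<phi> g)) \<in> S \<rightarrow> carrier R"
    using assms by auto
  show "\<And>i. i \<in> S - Poly_Mapping.keys p \<Longrightarrow> sm (\<kappa> (Poly_Mapping.lookup p i)) (\<phi> i) = \<zero>"
    using assms by (auto simp: in_keys_iff image_subset_iff)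
qed auto

lemma lin_ext_zero [simp]: "lin_ext \<kappa> \<phi> 0 = \<zero>"
  by (simp add: lin_ext_def)

lemma lin_ext_single:
  assumes "range \<phi> \<subseteq> carrier R" "\<kappa> 0 = 0"
  shows "lin_ext \<kappa> \<phi> (Poly_Mapping.single g c) = sm (\<kappa> c) (\<phi> g)"
  using assms lin_ext_superset[of \<phi> \<kappa> "{g}" "Poly_Mapping.single g c"]
  by (auto simp: finsum_singleton image_subset_iff)

lemma lin_ext_add:
  fixes p q :: "'g \<Rightarrow>\<^sub>0 'c::comm_monoid_add"
  assumes \<phi>: "range \<phi> \<subseteq> carrier R" and "\<kappa> 0 = 0" and \<kappa>: "\<And>a b. \<kappa> (a + b) = \<kappa> a + \<kappa> b"
  shows "lin_ext \<kappa> \<phi> (p + q) = lin_ext \<kappa> \<phi> p \<oplus> lin_ext \<kappa> \<phi> q"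
proof -
  let ?S = "Poly_Mapping.keys p \<union> Poly_Mapping.keys q"
  have *: "lin_ext \<kappa> \<phi> r = finsum R (\<lambda>g. sm (\<kappa> (Poly_Mapping.lookup r g)) (\<phi> g)) ?S"
    if "Poly_Mapping.keys r \<subseteq> ?S" for r
    using that assms by (intro lin_ext_superset) auto
  have "lin_ext \<kappa> \<phi> (p + q) = finsum R (\<lambda>g. sm (\<kappa> (Poly_Mapping.lookup p g)) (\<phi> g)
      \<oplus> sm (\<kappa> (Poly_Mapping.lookup q g)) (\<phi> g)) ?S"
    using \<phi> Poly_Mapping.keys_add[of p q] by (subst *) (auto simp: lookup_add \<kappa> sm_add_left
        image_subset_iff intro!: finsum_cong')
  also have "\<dots> = lin_ext \<kappa> \<phi> p \<oplus> lin_ext \<kappa> \<phi> q"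
    using \<phi> by (subst finsum_addf) (auto simp: * image_subset_iff)
  finally show ?thesis .
qed

end

lemma ring_carrierI:
  assumes "abelian_group R" "monoid R"
  and "\<And>x y z. x \<in> carrier R \<Longrightarrow> y \<in> carrier R \<Longrightarrow> z \<in> carrier R \<Longrightarrow> (x \<oplus>\<^bsub>R\<^esub> y) \<otimes>\<^bsub>R\<^esub> z = x \<otimes>\<^bsub>R\<^esub> z \<oplus>\<^bsub>R\<^esub> y \<otimes>\<^bsub>R\<^esub> z"
  and "\<And>x y z. x \<in> carrier R \<Longrightarrow> y \<in> carrier R \<Longrightarrow> z \<in> carrier R \<Longrightarrow> z \<otimes>\<^bsub>R\<^esub> (x \<oplus>\<^bsub>R\<^esub> y) = z \<otimes>\<^bsub>R\<^esub> x \<oplus>\<^bsub>R\<^esub> z \<otimes>\<^bsub>R\<^esub> y"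
  shows "ring R"
  using assms by (intro ringI) auto

section \<open>The ring of formal pairs\<close>

text \<open>The bilinear extension of a binary operation to formal integral combinations.  Associativity and the
unit laws then need to be checked on basis elements only, and only inside the carrier.\<close>

definition conv :: "('x \<Rightarrow> 'x \<Rightarrow> 'x) \<Rightarrow> ('x \<Rightarrow>\<^sub>0 int) \<Rightarrow> ('x \<Rightarrow>\<^sub>0 int) \<Rightarrow> ('x \<Rightarrow>\<^sub>0 int)" where
  "conv m p q = (\<Sum>a \<in> Poly_Mapping.keys p. \<Sum>b \<in> Poly_Mapping.keys q.
     Poly_Mapping.single (m a b) (Poly_Mapping.lookup p a * Poly_Mapping.lookup q b))"

lemma conv_superset:
  assumes "finite S" "finite T" "Poly_Mapping.keys p \<subseteq> S" "Poly_Mapping.keys q \<subseteq> T"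
  shows "conv m p q = (\<Sum>a \<in> S. \<Sum>b \<in> T.
     Poly_Mapping.single (m a b) (Poly_Mapping.lookup p a * Poly_Mapping.lookup q b))"
proof -
  have "(\<Sum>b \<in> Poly_Mapping.keys q.
      Poly_Mapping.single (m a b) (Poly_Mapping.lookup p a * Poly_Mapping.lookup q b)) =
    (\<Sum>b \<in> T. Poly_Mapping.single (m a b) (Poly_Mapping.lookup p a * Poly_Mapping.lookup q b))" for a
    using assms by (intro sum.mono_neutral_left) (auto simp: in_keys_iff)
  then show ?thesis
    unfolding conv_def using assms
    by (simp only:) (intro sum.mono_neutral_left, auto simp: in_keys_iff)
qed

lemma conv_add_left: "conv m (p + p') q = conv m p q + conv m p' q"
proof -
  let ?S = "Poly_Mapping.keys p \<union> Poly_Mapping.keys p'"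
  have "conv m r q = (\<Sum>a \<in> ?S. \<Sum>b \<in> Poly_Mapping.keys q.
     Poly_Mapping.single (m a b) (Poly_Mapping.lookup r a * Poly_Mapping.lookup q b))"
    if "Poly_Mapping.keys r \<subseteq> ?S" for r
    using that by (intro conv_superset) auto
  from this[of p] this[of p'] this[of "p + p'"] show ?thesis
    using Poly_Mapping.keys_add[of p p']
    by (simp add: lookup_add distrib_right single_add sum.distrib)
qed

lemma conv_add_right: "conv m q (p + p') = conv m q p + conv m q p'"
proof -
  let ?S = "Poly_Mapping.keys p \<union> Poly_Mapping.keys p'"
  have "conv m q r = (\<Sum>a \<in> Poly_Mapping.keys q. \<Sum>b \<in> ?S.
     Poly_Mapping.single (m a b) (Poly_Mapping.lookup q a * Poly_Mapping.lookup r b))"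
    if "Poly_Mapping.keys r \<subseteq> ?S" for r
    using that by (intro conv_superset) auto
  from this[of p] this[of p'] this[of "p + p'"] show ?thesis
    using Poly_Mapping.keys_add[of p p']
    by (simp add: lookup_add distrib_left single_add sum.distrib)
qed

lemma conv_zero [simp]: "conv m 0 q = 0" "conv m q 0 = 0"
  by (simp_all add: conv_def)

lemma conv_single:
  "conv m (Poly_Mapping.single a c) (Poly_Mapping.single b d) = Poly_Mapping.single (m a b) (c * d)"
  by (subst conv_superset[of "{a}" "{b}"]) auto

lemma conv_assoc:
  assumes p: "Poly_Mapping.keys p \<subseteq> C" and q: "Poly_Mapping.keys q \<subseteq> C"
    and r: "Poly_Mapping.keys r \<subseteq> C"
    and m: "\<And>a b c. a \<in> C \<Longrightarrow> b \<in> C \<Longrightarrow> c \<in> C \<Longrightarrow> m (m a b) c = m a (m b c)"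
  shows "conv m (conv m p q) r = conv m p (conv m q r)"
  using p
proof (induction p rule: poly_mapping_keys_induct)
  case (single a x)
  show ?case using q
  proof (induction q rule: poly_mapping_keys_induct)
    case (single b y)
    show ?case using r
    proof (induction r rule: poly_mapping_keys_induct)
      case (single c z)
      then show ?case using \<open>a \<in> C\<close> \<open>b \<in> C\<close> m by (simp add: conv_single mult.assoc)
    qed (simp_all add: conv_add_right)
  qed (simp_all add: conv_add_right conv_add_left)
qed (simp_all add: conv_add_left)

lemma conv_one_left:
  assumes p: "Poly_Mapping.keys p \<subseteq> C" and m: "\<And>a. a \<in> C \<Longrightarrow> m e a = a"
  shows "conv m (Poly_Mapping.single e 1) p = p"
  using p by (induction p rule: poly_mapping_keys_induct) (simp_all add: conv_add_right conv_single m)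

lemma conv_one_right:
  assumes p: "Poly_Mapping.keys p \<subseteq> C" and m: "\<And>a. a \<in> C \<Longrightarrow> m a e = a"
  shows "conv m p (Poly_Mapping.single e 1) = p"
  using p by (induction p rule: poly_mapping_keys_induct) (simp_all add: conv_add_left conv_single m)

lemma keys_conv:
  assumes p: "Poly_Mapping.keys p \<subseteq> C" and q: "Poly_Mapping.keys q \<subseteq> C"
    and m: "\<And>a b. a \<in> C \<Longrightarrow> b \<in> C \<Longrightarrow> m a b \<in> C"
  shows "Poly_Mapping.keys (conv m p q) \<subseteq> C"
  using p
proof (induction p rule: poly_mapping_keys_induct)
  case (single a x)
  show ?case using q
  proof (induction q rule: poly_mapping_keys_induct)
    case (single b y)
    then show ?case using \<open>a \<in> C\<close> m by (simp add: conv_single)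
  next
    case (add p q) then show ?case
      using Poly_Mapping.keys_add[of "conv m (Poly_Mapping.single a x) p" "conv m (Poly_Mapping.single a x) q"]
      by (auto simp: conv_add_right)
  qed simp_all
next
  case (add p p') then show ?case
    using Poly_Mapping.keys_add[of "conv m p q" "conv m p' q"]
    by (auto simp: conv_add_left)
qed simp_all

abbreviation pair_mult :: "('m, 'b) ring_scheme \<Rightarrow> 'm \<times> 'k::comm_ring_1 \<Rightarrow> 'm \<times> 'k \<Rightarrow> 'm \<times> 'k" where
  "pair_mult R a b \<equiv> (fst a \<otimes>\<^bsub>R\<^esub> fst b, snd a * snd b)"

lemma pairs_ring_simps:
  "carrier (pairs_ring R) = {p. Poly_Mapping.keys p \<subseteq> carrier R \<times> UNIV}"
  "p \<otimes>\<^bsub>pairs_ring R\<^esub> q = conv (pair_mult R) p q"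
  "\<one>\<^bsub>pairs_ring R\<^esub> = Poly_Mapping.single (\<one>\<^bsub>R\<^esub>, 1) 1"
  "\<zero>\<^bsub>pairs_ring R\<^esub> = 0"
  "p \<oplus>\<^bsub>pairs_ring R\<^esub> q = p + q"
  by (simp_all add: pairs_ring_def conv_def)

lemma ring_pairs_ring:
  assumes "ring R"
  shows "ring (pairs_ring R :: (('m \<times> 'k::comm_ring_1) \<Rightarrow>\<^sub>0 int) ring)"
proof -
  interpret ring R by fact
  let ?P = "pairs_ring R :: (('m \<times> 'k) \<Rightarrow>\<^sub>0 int) ring"
  have "abelian_group ?P"
  proof (rule abelian_groupI)
    fix x assume x: "x \<in> carrier ?P"
    then show "\<exists>y\<in>carrier ?P. y \<oplus>\<^bsub>?P\<^esub> x = \<zero>\<^bsub>?P\<^esub>"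
      by (intro bexI[of _ "- x"]) (auto simp: pairs_ring_simps)
  next
    fix x y assume "x \<in> carrier ?P" "y \<in> carrier ?P"
    then show "x \<oplus>\<^bsub>?P\<^esub> y \<in> carrier ?P"
      using Poly_Mapping.keys_add[of x y] unfolding pairs_ring_simps mem_Collect_eq by blast
  qed (auto simp: pairs_ring_simps add.assoc add.commute)
  moreover have "monoid ?P"
  proof (rule monoidI)
    fix x y assume "x \<in> carrier ?P" "y \<in> carrier ?P"
    then show "x \<otimes>\<^bsub>?P\<^esub> y \<in> carrier ?P"
      unfolding pairs_ring_simps mem_Collect_eq by (intro keys_conv) auto
  next
    fix x y z assume "x \<in> carrier ?P" "y \<in> carrier ?P" "z \<in> carrier ?P"
    then show "x \<otimes>\<^bsub>?P\<^esub> y \<otimes>\<^bsub>?P\<^esub> z = x \<otimes>\<^bsub>?P\<^esub> (y \<otimes>\<^bsub>?P\<^esub> z)"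
      unfolding pairs_ring_simps mem_Collect_eq by (intro conv_assoc) (auto simp: m_assoc mult.assoc)
  next
    fix x assume "x \<in> carrier ?P"
    then show "\<one>\<^bsub>?P\<^esub> \<otimes>\<^bsub>?P\<^esub> x = x" "x \<otimes>\<^bsub>?P\<^esub> \<one>\<^bsub>?P\<^esub> = x"
      unfolding pairs_ring_simps mem_Collect_eq
      by - (rule conv_one_left conv_one_right, assumption, auto)+
  qed (auto simp: pairs_ring_simps)
  ultimately show ?thesis
    by (rule ring_carrierI) (simp_all add: pairs_ring_simps conv_add_left conv_add_right)
qed

section \<open>The free algebra\<close>

lemma free_algebra_simps:
  "carrier (free_algebra A X) =
     {p. (\<forall>w \<in> Poly_Mapping.keys p. set (letters w) \<subseteq> X) \<and> (\<forall>w. Poly_Mapping.lookup p w \<in> A)}"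
  "p \<otimes>\<^bsub>free_algebra A X\<^esub> q = p * q"
  "\<one>\<^bsub>free_algebra A X\<^esub> = 1"
  "\<zero>\<^bsub>free_algebra A X\<^esub> = 0"
  "p \<oplus>\<^bsub>free_algebra A X\<^esub> q = p + q"
  by (simp_all add: free_algebra_def)

locale subring_set =
  fixes A :: "'k::comm_ring_1 set"
  assumes zero: "0 \<in> A" and one: "1 \<in> A" and add: "a \<in> A \<Longrightarrow> b \<in> A \<Longrightarrow> a + b \<in> A"
    and mult: "a \<in> A \<Longrightarrow> b \<in> A \<Longrightarrow> a * b \<in> A" and uminus: "a \<in> A \<Longrightarrow> - a \<in> A"
begin

lemma free_carrier_single:
  "a \<in> A \<Longrightarrow> set (letters w) \<subseteq> X \<Longrightarrow> Poly_Mapping.single w a \<in> carrier (free_algebra A X)"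
  by (auto simp: free_algebra_simps lookup_single when_def zero)

lemma free_carrier_add:
  "p \<in> carrier (free_algebra A X) \<Longrightarrow> q \<in> carrier (free_algebra A X) \<Longrightarrow> p + q \<in> carrier (free_algebra A X)"
  using Poly_Mapping.keys_add[of p q] by (fastforce simp: free_algebra_simps lookup_add add)

lemma free_carrier_uminus:
  "p \<in> carrier (free_algebra A X) \<Longrightarrow> - p \<in> carrier (free_algebra A X)"
  by (auto simp: free_algebra_simps uminus in_keys_iff)

lemma free_carrier_zero: "0 \<in> carrier (free_algebra A X)"
  by (auto simp: free_algebra_simps zero)

lemma free_carrier_one: "1 \<in> carrier (free_algebra A X)"
proof -
  have "Poly_Mapping.single 0 1 \<in> carrier (free_algebra A X)"
    by (rule free_carrier_single) (simp_all add: one zero_fword_def)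
  then show ?thesis by simp
qed

lemma free_carrier_induct [consumes 1, case_names zero single add]:
  assumes p: "p \<in> carrier (free_algebra A X)"
    and zero': "P 0"
    and single: "\<And>w a. a \<in> A \<Longrightarrow> set (letters w) \<subseteq> X \<Longrightarrow> P (Poly_Mapping.single w a)"
    and add': "\<And>p q. p \<in> carrier (free_algebra A X) \<Longrightarrow> q \<in> carrier (free_algebra A X) \<Longrightarrow>
       P p \<Longrightarrow> P q \<Longrightarrow> P (p + q)"
  shows "P p"
proof -
  have *: "(\<Sum>w\<in>S. Poly_Mapping.single w (Poly_Mapping.lookup p w)) \<in> carrier (free_algebra A X)
     \<and> P (\<Sum>w\<in>S. Poly_Mapping.single w (Poly_Mapping.lookup p w))" 
    if "finite S" "S \<subseteq> Poly_Mapping.keys p" for S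
    using that
  proof (induction S rule: finite_induct)
    case (insert w S)
    have "Poly_Mapping.lookup p w \<in> A" "set (letters w) \<subseteq> X"
      using p insert.prems by (auto simp: free_algebra_simps)
    then show ?case using insert
      by (auto intro!: free_carrier_add add' free_carrier_single single)
  qed (auto intro: zero' free_carrier_zero)
  have "p = (\<Sum>w\<in>Poly_Mapping.keys p. Poly_Mapping.single w (Poly_Mapping.lookup p w))"
    by (intro poly_mapping_eqI) (auto simp: lookup_sum lookup_single when_def in_keys_iff)
  then show ?thesis using *[of "Poly_Mapping.keys p"] by simp
qed

lemma free_carrier_mult:
  assumes "p \<in> carrier (free_algebra A X)" "q \<in> carrier (free_algebra A X)"
  shows "p * q \<in> carrier (free_algebra A X)"
  using assms(1)
proof (induction p rule: free_carrier_induct)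
  case (single w a)
  show ?case using assms(2)
  proof (induction q rule: free_carrier_induct)
    case (single v b)
    then show ?case using \<open>a \<in> A\<close> \<open>set (letters w) \<subseteq> X\<close>
      by (auto simp: mult_single plus_fword_def intro!: free_carrier_single mult)
  qed (auto simp: distrib_left intro: free_carrier_add free_carrier_zero)
qed (auto simp: distrib_right intro: free_carrier_add free_carrier_zero)

lemma ring_free_algebra: "ring (free_algebra A X)"
proof (rule ring_carrierI)
  show "abelian_group (free_algebra A X)"
  proof (rule abelian_groupI)
    fix x assume "x \<in> carrier (free_algebra A X)"
    then show "\<exists>y\<in>carrier (free_algebra A X). y \<oplus>\<^bsub>free_algebra A X\<^esub> x = \<zero>\<^bsub>free_algebra A X\<^esub>"
      by (intro bexI[of _ "- x"]) (auto simp: free_algebra_simps(2-) intro: free_carrier_uminus)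
  qed (auto simp: free_algebra_simps(2-) add.assoc add.commute free_carrier_add free_carrier_zero)
  show "monoid (free_algebra A X)"
    by (rule monoidI)
      (auto simp: free_algebra_simps(2-) mult.assoc free_carrier_mult free_carrier_one)
qed (auto simp: free_algebra_simps(2-) distrib_left distrib_right)

lemma free_algebra_minus:
  assumes "p \<in> carrier (free_algebra A X)" "q \<in> carrier (free_algebra A X)"
  shows "p \<ominus>\<^bsub>free_algebra A X\<^esub> q = p - q"
proof -
  interpret ring "free_algebra A X" by (rule ring_free_algebra)
  have "\<ominus>\<^bsub>free_algebra A X\<^esub> q = - q"
    using assms by (intro minus_equality) (auto simp: free_algebra_simps(2-) intro: free_carrier_uminus)
  then show ?thesis by (simp add: a_minus_def free_algebra_simps(2-))
qed

end

section \<open>Extension of scalars\<close>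

locale base_change_setup = ring R for R :: "'m ring" (structure) +
  fixes A :: "'k::comm_ring_1 set" and sA :: "'k \<Rightarrow> 'm \<Rightarrow> 'm"
  assumes sA_closed: "a \<in> A \<Longrightarrow> x \<in> carrier R \<Longrightarrow> sA a x \<in> carrier R"
begin

abbreviation "PP \<equiv> pairs_ring R :: (('m \<times> 'k) \<Rightarrow>\<^sub>0 int) ring"
abbreviation "TI \<equiv> tensor_ideal R A sA"
abbreviation "BC \<equiv> base_change R A sA"
abbreviation "pt \<equiv> pure_tensor R A sA"

sublocale PP: ring PP by (rule ring_pairs_ring) (rule ring_axioms)

lemma PP_uminus: "x \<in> carrier PP \<Longrightarrow> \<ominus>\<^bsub>PP\<^esub> x = - x"
  by (rule PP.minus_equality) (auto simp: pairs_ring_simps)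

lemma PP_minus: "x \<in> carrier PP \<Longrightarrow> y \<in> carrier PP \<Longrightarrow> x \<ominus>\<^bsub>PP\<^esub> y = x - y"
  by (simp add: a_minus_def PP_uminus pairs_ring_simps(5))

lemma PP_diff: "x \<in> carrier PP \<Longrightarrow> y \<in> carrier PP \<Longrightarrow> x - y \<in> carrier PP"
  using PP.minus_closed[of x y] by (simp add: PP_minus)

lemma single_PP: "x \<in> carrier R \<Longrightarrow> Poly_Mapping.single (x, k) c \<in> carrier PP"
  by (auto simp: pairs_ring_simps)

lemma tensor_relations_subset: "tensor_relations R A sA \<subseteq> carrier PP"
  unfolding tensor_relations_def
  by (auto intro!: PP_diff single_PP sA_closed)

lemma TI_ideal: "ideal TI PP"
  unfolding tensor_ideal_def by (rule PP.genideal_ideal) (rule tensor_relations_subset)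

sublocale BC: ring BC
  unfolding base_change_def by (rule ideal.quotient_is_ring[OF TI_ideal])

lemma coset_eqI:
  assumes "x \<in> carrier PP" "y \<in> carrier PP" "x - y \<in> TI"
  shows "TI +>\<^bsub>PP\<^esub> x = TI +>\<^bsub>PP\<^esub> y"
  using PP.quotient_eq_iff_same_a_r_cos[OF TI_ideal assms(1,2)] assms by (simp add: PP_minus)

lemma relation_in_TI: "x \<in> tensor_relations R A sA \<Longrightarrow> x \<in> TI"
  unfolding tensor_ideal_def using PP.genideal_self[OF tensor_relations_subset] by auto

lemma proj_hom: "(+>\<^bsub>PP\<^esub>) TI \<in> ring_hom PP BC"
  unfolding base_change_def by (rule ideal.rcos_ring_hom[OF TI_ideal])

lemma pt_closed [simp]: "x \<in> carrier R \<Longrightarrow> pt x k \<in> carrier BC"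
  unfolding pure_tensor_def using ring_hom_closed[OF proj_hom] single_PP by blast

lemma pt_mult: "x \<in> carrier R \<Longrightarrow> y \<in> carrier R \<Longrightarrow> pt x k \<otimes>\<^bsub>BC\<^esub> pt y l = pt (x \<otimes> y) (k * l)"
  unfolding pure_tensor_def
  by (subst ring_hom_mult[OF proj_hom, symmetric])
    (auto intro: single_PP simp: pairs_ring_simps(2) conv_single)

lemma pt_one: "pt \<one> 1 = \<one>\<^bsub>BC\<^esub>"
  unfolding pure_tensor_def
  using ring_hom_one[OF proj_hom] by (simp add: pairs_ring_simps)

lemma pt_add_left:
  assumes "x \<in> carrier R" "y \<in> carrier R"
  shows "pt (x \<oplus> y) k = pt x k \<oplus>\<^bsub>BC\<^esub> pt y k"
proof -
  have "pt x k \<oplus>\<^bsub>BC\<^esub> pt y k = TI +>\<^bsub>PP\<^esub> (Poly_Mapping.single (x, k) 1 + Poly_Mapping.single (y, k) 1)"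
    unfolding pure_tensor_def using assms
    by (subst ring_hom_add[OF proj_hom, symmetric]) (auto intro: single_PP simp: pairs_ring_simps(5))
  also have "\<dots> = pt (x \<oplus> y) k"
    unfolding pure_tensor_def
  proof (rule coset_eqI[symmetric])
    show "Poly_Mapping.single (x, k) 1 + Poly_Mapping.single (y, k) 1 \<in> carrier PP"
      using assms PP.a_closed by (auto simp: pairs_ring_simps(5) single_PP)
    have "Poly_Mapping.single (x \<oplus> y, k) 1 - Poly_Mapping.single (x, k) 1 - Poly_Mapping.single (y, k) 1 \<in> TI"
      using assms by (intro relation_in_TI, unfold tensor_relations_def) blast
    then show "Poly_Mapping.single (x \<oplus> y, k) 1
      - (Poly_Mapping.single (x, k) 1 + Poly_Mapping.single (y, k) 1) \<in> TI"
      by (simp add: diff_diff_eq)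
  qed (use assms single_PP in auto)
  finally show ?thesis ..
qed

lemma pt_add_right:
  assumes "x \<in> carrier R"
  shows "pt x (k + l) = pt x k \<oplus>\<^bsub>BC\<^esub> pt x l"
proof -
  have "pt x k \<oplus>\<^bsub>BC\<^esub> pt x l = TI +>\<^bsub>PP\<^esub> (Poly_Mapping.single (x, k) 1 + Poly_Mapping.single (x, l) 1)"
    unfolding pure_tensor_def using assms
    by (subst ring_hom_add[OF proj_hom, symmetric]) (auto intro: single_PP simp: pairs_ring_simps(5))
  also have "\<dots> = pt x (k + l)"
    unfolding pure_tensor_def
  proof (rule coset_eqI[symmetric])
    show "Poly_Mapping.single (x, k) 1 + Poly_Mapping.single (x, l) 1 \<in> carrier PP"
      using assms PP.a_closed by (auto simp: pairs_ring_simps(5) single_PP)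
    have "Poly_Mapping.single (x, k + l) 1 - Poly_Mapping.single (x, k) 1 - Poly_Mapping.single (x, l) 1 \<in> TI"
      using assms by (intro relation_in_TI, unfold tensor_relations_def) blast
    then show "Poly_Mapping.single (x, k + l) 1
      - (Poly_Mapping.single (x, k) 1 + Poly_Mapping.single (x, l) 1) \<in> TI"
      by (simp add: diff_diff_eq)
  qed (use assms single_PP in auto)
  finally show ?thesis ..
qed

lemma pt_sA:
  assumes "x \<in> carrier R" "a \<in> A"
  shows "pt (sA a x) k = pt x (a * k)"
  unfolding pure_tensor_def
proof (intro coset_eqI relation_in_TI)
  show "Poly_Mapping.single (sA a x, k) 1 - Poly_Mapping.single (x, a * k) 1 \<in> tensor_relations R A sA"
    using assms unfolding tensor_relations_def by blast
qed (use assms single_PP sA_closed in auto)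

lemma pt_zero: "x \<in> carrier R \<Longrightarrow> pt x 0 = \<zero>\<^bsub>BC\<^esub>"
  using pt_add_right[of x 0 0] by (metis BC.add.l_cancel_one' add_0 pt_closed)

lemma proj_single:
  assumes "x \<in> carrier R"
  shows "TI +>\<^bsub>PP\<^esub> Poly_Mapping.single (x, k) c = pt x (of_int c * k)"
proof -
  have nat: "TI +>\<^bsub>PP\<^esub> Poly_Mapping.single (x, k) (int m) = pt x (of_nat m * k)" for m
  proof (induction m)
    case 0
    then show ?case using assms ring_hom_zero[OF proj_hom PP.ring_axioms BC.ring_axioms]
      by (simp add: pt_zero pairs_ring_simps)
  next
    case (Suc m)
    have "Poly_Mapping.single (x, k) (int (Suc m))
      = Poly_Mapping.single (x, k) 1 \<oplus>\<^bsub>PP\<^esub> Poly_Mapping.single (x, k) (int m)"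
      by (simp add: pairs_ring_simps(5) flip: single_add)
    then have "TI +>\<^bsub>PP\<^esub> Poly_Mapping.single (x, k) (int (Suc m)) = pt x k \<oplus>\<^bsub>BC\<^esub> pt x (of_nat m * k)"
      using ring_hom_add[OF proj_hom] Suc assms single_PP by (simp add: pure_tensor_def)
    then show ?case using assms by (simp add: distrib_right pt_add_right)
  qed
  show ?thesis
  proof (cases "c \<ge> 0")
    case True
    then show ?thesis using nat[of "nat c"] by simp
  next
    case False
    have "Poly_Mapping.single (x, k) c \<oplus>\<^bsub>PP\<^esub> Poly_Mapping.single (x, k) (int (nat (- c))) = \<zero>\<^bsub>PP\<^esub>"
      using False by (simp add: pairs_ring_simps(4,5) flip: single_add)
    then have "(TI +>\<^bsub>PP\<^esub> Poly_Mapping.single (x, k) c) \<oplus>\<^bsub>BC\<^esub> pt x (of_nat (nat (- c)) * k) = \<zero>\<^bsub>BC\<^esub>"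
      unfolding nat[symmetric] using ring_hom_add[OF proj_hom, symmetric] assms single_PP
        ring_hom_zero[OF proj_hom PP.ring_axioms BC.ring_axioms] by simp
    moreover have "pt x (of_int c * k) \<oplus>\<^bsub>BC\<^esub> pt x (of_nat (nat (- c)) * k) = \<zero>\<^bsub>BC\<^esub>"
      using False assms by (simp add: pt_zero flip: pt_add_right distrib_right)
    moreover have "(TI +>\<^bsub>PP\<^esub> Poly_Mapping.single (x, k) c) \<in> carrier BC"
      using assms single_PP ring_hom_closed[OF proj_hom] by blast
    ultimately show ?thesis
      using assms by (metis BC.add.inv_equality pt_closed BC.add.inv_inv)
  qed
qed

text \<open>Pure tensors suffice, without integral multiples, because an integral coefficient can be absorbed into the
scalar component.\<close>

lemma BC_induct [consumes 1, case_names pure add]: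
  assumes x: "x \<in> carrier BC"
    and pure: "\<And>y k. y \<in> carrier R \<Longrightarrow> P (pt y k)"
    and add': "\<And>x y. x \<in> carrier BC \<Longrightarrow> y \<in> carrier BC \<Longrightarrow> P x \<Longrightarrow> P y \<Longrightarrow> P (x \<oplus>\<^bsub>BC\<^esub> y)"
  shows "P x"
proof -
  obtain p where p: "p \<in> carrier PP" "x = TI +>\<^bsub>PP\<^esub> p"
    using x by (auto simp: base_change_def FactRing_def A_RCOSETS_def')
  from p(1) have "Poly_Mapping.keys p \<subseteq> carrier R \<times> UNIV" by (simp add: pairs_ring_simps)
  then have "P (TI +>\<^bsub>PP\<^esub> p)"
  proof (induction p rule: poly_mapping_keys_induct)
    case zero
    have "TI +>\<^bsub>PP\<^esub> 0 = pt \<zero> 0"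
      using proj_single[of \<zero> 0 0] by simp
    then show ?case using pure[of \<zero> 0] by simp
  next
    case (single a c)
    then show ?case using proj_single pure by (cases a) auto
  next
    case (add p q)
    then have "p \<in> carrier PP" "q \<in> carrier PP" by (auto simp: pairs_ring_simps)
    then show ?case using add add' ring_hom_add[OF proj_hom, of p q] ring_hom_closed[OF proj_hom]
      by (simp add: pairs_ring_simps(5))
  qed
  then show ?thesis by (simp add: p)
qed

end

section \<open>Laurent polynomials\<close>

lemma u_pow: "u ^ k = Fract ([:0, 1:] ^ k) 1"
  by (induction k) (simp_all add: u_def fract_collapse)

lemma u_nonzero [simp]: "u \<noteq> 0"
  using eq_fract(1)[of 1 1 "[:0, 1 :: complex:]" 0] by (simp add: u_def fract_collapse)

lemma laurentI: "Fract p 1 / u ^ k \<in> laurent"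
  by (auto simp: laurent_def)

lemma laurent_add:
  assumes "a \<in> laurent" "b \<in> laurent" shows "a + b \<in> laurent"
proof -
  obtain p k q l where "a = Fract p 1 / u ^ k" "b = Fract q 1 / u ^ l"
    using assms by (auto simp: laurent_def)
  then have "a + b = (Fract p 1 * u ^ l + Fract q 1 * u ^ k) / u ^ (k + l)"
    by (simp add: add_frac_eq power_add)
  also have "\<dots> = Fract (p * [:0, 1:] ^ l + q * [:0, 1:] ^ k) 1 / u ^ (k + l)"
    by (simp add: u_pow)
  finally show ?thesis by (simp only: laurentI)
qed

lemma laurent_mult:
  assumes "a \<in> laurent" "b \<in> laurent" shows "a * b \<in> laurent"
proof -
  obtain p k q l where "a = Fract p 1 / u ^ k" "b = Fract q 1 / u ^ l"
    using assms by (auto simp: laurent_def)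
  then have "a * b = Fract (p * q) 1 / u ^ (k + l)"
    by (simp add: power_add)
  then show ?thesis by (simp only: laurentI)
qed

lemma laurent_poly: "Fract p 1 \<in> laurent"
  using laurentI[of p 0] by simp

lemma laurent_uminus: "a \<in> laurent \<Longrightarrow> - a \<in> laurent"
  using laurent_mult[OF laurent_poly[of "-1"], of a] by (simp add: fract_collapse flip: minus_fract)

interpretation laurent: subring_set laurent
proof
  show "0 \<in> laurent" "1 \<in> laurent"
    using laurent_poly[of 0] laurent_poly[of 1] by (simp_all add: fract_collapse)
qed (fact laurent_add laurent_mult laurent_uminus)+

lemma laurent_u: "u \<in> laurent" "u - 1 \<in> laurent"
proof -
  show "u \<in> laurent" by (simp add: u_def laurent_poly)
  then show "u - 1 \<in> laurent"
    using laurent.add[of u "-1"] laurent.uminus laurent.one by simp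
qed

section \<open>Algebras satisfying the defining relations\<close>

locale bt_rels = kalgebra R sm for R (structure) and sm :: "ratfun \<Rightarrow> 'a \<Rightarrow> 'a" +
  fixes n :: nat and T E :: "nat \<Rightarrow> 'a"
  assumes T_closed [simp]: "i \<in> {1..<n} \<Longrightarrow> T i \<in> carrier R"
    and E_closed [simp]: "i \<in> {1..<n} \<Longrightarrow> E i \<in> carrier R"
    and TT_far: "i \<in> {1..<n} \<Longrightarrow> j \<in> {1..<n} \<Longrightarrow> \<bar>int i - int j\<bar> > 1 \<Longrightarrow> T i \<otimes> T j = T j \<otimes> T i"
    and EE_comm: "i \<in> {1..<n} \<Longrightarrow> j \<in> {1..<n} \<Longrightarrow> E i \<otimes> E j = E j \<otimes> E i"
    and ET_far: "i \<in> {1..<n} \<Longrightarrow> j \<in> {1..<n} \<Longrightarrow> \<bar>int i - int j\<bar> > 1 \<Longrightarrow> E i \<otimes> T j = T j \<otimes> E i"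
    and E_idem: "i \<in> {1..<n} \<Longrightarrow> E i \<otimes> E i = E i"
    and ET_comm: "i \<in> {1..<n} \<Longrightarrow> E i \<otimes> T i = T i \<otimes> E i"
    and braid: "i \<in> {1..<n} \<Longrightarrow> j \<in> {1..<n} \<Longrightarrow> \<bar>int i - int j\<bar> = 1 \<Longrightarrow>
      T i \<otimes> T j \<otimes> T i = T j \<otimes> T i \<otimes> T j"
    and ETT: "i \<in> {1..<n} \<Longrightarrow> j \<in> {1..<n} \<Longrightarrow> \<bar>int i - int j\<bar> = 1 \<Longrightarrow>
      E j \<otimes> T i \<otimes> T j = T i \<otimes> T j \<otimes> E i"
    and EET: "i \<in> {1..<n} \<Longrightarrow> j \<in> {1..<n} \<Longrightarrow> \<bar>int i - int j\<bar> = 1 \<Longrightarrow>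
      E i \<otimes> E j \<otimes> T j = E i \<otimes> T j \<otimes> E i"
    and ETE: "i \<in> {1..<n} \<Longrightarrow> j \<in> {1..<n} \<Longrightarrow> \<bar>int i - int j\<bar> = 1 \<Longrightarrow>
      E i \<otimes> T j \<otimes> E i = T j \<otimes> E i \<otimes> E j"
    and quad: "i \<in> {1..<n} \<Longrightarrow> T i \<otimes> T i = \<one> \<oplus> sm (u - 1) (E i \<otimes> (\<one> \<oplus> T i))"

context bt_rels begin

text \<open>Letters outside the range of generators have the value zero, so that every word has a value
in the carrier and no side conditions arise in the multiplicativity of \<open>free_val\<close>.\<close>

definition letter_val :: "bt_letter \<Rightarrow> 'a" where
  "letter_val x = (case x of LetT i \<Rightarrow> if i \<in> {1..<n} then T i else \<zero>
                           | LetE i \<Rightarrow> if i \<in> {1..<n} then E i else \<zero>)"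

lemma letter_val_closed [simp]: "letter_val x \<in> carrier R"
  by (auto simp: letter_val_def split: bt_letter.split)

definition word_val :: "bt_letter fword \<Rightarrow> 'a" where
  "word_val w = list_prod R (map letter_val (letters w))"

lemma list_prod_simps [simp]:
  "list_prod R [] = \<one>" "list_prod R (x # xs) = x \<otimes> list_prod R xs"
  by (simp_all add: list_prod_def)

lemma list_prod_closed [simp]: "set xs \<subseteq> carrier R \<Longrightarrow> list_prod R xs \<in> carrier R"
  by (induction xs) auto

lemma list_prod_append [simp]:
  "set xs \<subseteq> carrier R \<Longrightarrow> set ys \<subseteq> carrier R \<Longrightarrow> list_prod R (xs @ ys) = list_prod R xs \<otimes> list_prod R ys"
  by (induction xs) (auto simp: m_assoc)

lemma word_val_closed [simp]: "word_val w \<in> carrier R"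
  by (auto simp: word_val_def intro!: list_prod_closed)

lemma word_val_zero [simp]: "word_val 0 = \<one>"
  by (simp add: word_val_def zero_fword_def)

lemma word_val_add: "word_val (v + w) = word_val v \<otimes> word_val w"
  by (auto simp: word_val_def plus_fword_def intro!: list_prod_append)

definition free_val :: "bt_free \<Rightarrow> 'a" where
  "free_val = lin_ext (\<lambda>c. c) word_val"

lemma free_val_closed [simp]: "free_val p \<in> carrier R"
  unfolding free_val_def by (rule lin_ext_closed) auto

lemma free_val_add: "free_val (p + q) = free_val p \<oplus> free_val q"
  unfolding free_val_def by (intro lin_ext_add) auto

lemma free_val_single: "free_val (Poly_Mapping.single w c) = sm c (word_val w)"
  unfolding free_val_def by (intro lin_ext_single) auto

lemma free_val_zero [simp]: "free_val 0 = \<zero>"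
  by (simp add: free_val_def)

lemma free_val_mult: "free_val (p * q) = free_val p \<otimes> free_val q"
  using subset_UNIV[of "Poly_Mapping.keys p"]
proof (induction p rule: poly_mapping_keys_induct)
  case (single v a)
  show ?case using subset_UNIV[of "Poly_Mapping.keys q"]
  proof (induction q rule: poly_mapping_keys_induct)
    case (single w b)
    show ?case
      by (simp add: mult_single free_val_single word_val_add sm_mult_left sm_mult_right sm_sm mult.commute)
  qed (simp_all add: distrib_left free_val_add r_distr)
qed (simp_all add: distrib_right free_val_add l_distr)

lemma free_val_const: "free_val (free_const c) = sm c \<one>"
  by (simp add: free_const_def free_val_single)

lemma free_val_one [simp]: "free_val 1 = \<one>"
  using free_val_const[of 1] by (simp add: free_const_def)

lemma free_val_diff_eq_zero: "free_val p = free_val q \<Longrightarrow> free_val (p - q) = \<zero>"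
  using free_val_add[of "p - q" q] add.r_cancel_one'[of "free_val q" "free_val (p - q)"] by simp

lemma free_val_gen: "i \<in> {1..<n} \<Longrightarrow> free_val (fT i) = T i" "i \<in> {1..<n} \<Longrightarrow> free_val (fE i) = E i"
  by (simp_all add: free_gen_def free_val_single word_val_def letter_val_def)

lemma free_val_hom: "free_val \<in> ring_hom (bt_free_algebra n) R"
  by (rule ring_hom_memI) (simp_all add: bt_free_algebra_def free_algebra_simps(2-) free_val_mult free_val_add)

lemma free_val_relation:
  assumes "x \<in> bt_relations n"
  shows "free_val x = \<zero>"
proof -
  note ev = free_val_mult free_val_gen power2_eq_square
  have r0: "free_val (fT i * fT j - fT j * fT i) = \<zero>"
    if "i \<in> {1..<n}" "j \<in> {1..<n}" "\<bar>int i - int j\<bar> > 1" for i j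
    using TT_far[OF that] that by (intro free_val_diff_eq_zero) (simp only: ev)
  have r1: "free_val (fE i * fE j - fE j * fE i) = \<zero>"
    if "i \<in> {1..<n}" "j \<in> {1..<n}" for i j
    using EE_comm[OF that] that by (intro free_val_diff_eq_zero) (simp only: ev)
  have r2: "free_val (fE i * fT j - fT j * fE i) = \<zero>"
    if "i \<in> {1..<n}" "j \<in> {1..<n}" "\<bar>int i - int j\<bar> > 1" for i j
    using ET_far[OF that] that by (intro free_val_diff_eq_zero) (simp only: ev)
  have r3: "free_val (fE i ^ 2 - fE i) = \<zero>"
    if "i \<in> {1..<n}" for i
    using E_idem[OF that] that by (intro free_val_diff_eq_zero) (simp only: ev)
  have r4: "free_val (fE i * fT i - fT i * fE i) = \<zero>"
    if "i \<in> {1..<n}" for i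
    using ET_comm[OF that] that by (intro free_val_diff_eq_zero) (simp only: ev)
  have r5: "free_val (fT i * fT j * fT i - fT j * fT i * fT j) = \<zero>"
    if "i \<in> {1..<n}" "j \<in> {1..<n}" "\<bar>int i - int j\<bar> = 1" for i j
    using braid[OF that] that by (intro free_val_diff_eq_zero) (simp only: ev)
  have r6: "free_val (fE j * fT i * fT j - fT i * fT j * fE i) = \<zero>"
    if "i \<in> {1..<n}" "j \<in> {1..<n}" "\<bar>int i - int j\<bar> = 1" for i j
    using ETT[OF that] that by (intro free_val_diff_eq_zero) (simp only: ev)
  have r7: "free_val (fE i * fE j * fT j - fE i * fT j * fE i) = \<zero>"
    if "i \<in> {1..<n}" "j \<in> {1..<n}" "\<bar>int i - int j\<bar> = 1" for i j
    using EET[OF that] that by (intro free_val_diff_eq_zero) (simp only: ev)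
  have r8: "free_val (fE i * fT j * fE i - fT j * fE i * fE j) = \<zero>"
    if "i \<in> {1..<n}" "j \<in> {1..<n}" "\<bar>int i - int j\<bar> = 1" for i j
    using ETE[OF that] that by (intro free_val_diff_eq_zero) (simp only: ev)
  have r9: "free_val (fT i ^ 2 - (1 + free_const (u - 1) * fE i * (1 + fT i))) = \<zero>"
    if "i \<in> {1..<n}" for i
    using quad[OF that] that
    by (intro free_val_diff_eq_zero) (simp add: ev free_val_add free_val_const sm_mult_left)
  show ?thesis
    using assms unfolding bt_relations_def
    by (elim UnE CollectE exE conjE) (simp_all only: r0 r1 r2 r3 r4 r5 r6 r7 r8 r9)
qed

end

section \<open>Conjugation by the generators\<close>

context bt_rels begin

definition T_inv :: "nat \<Rightarrow> 'a" where
  "T_inv i = T i \<oplus> sm (inverse u - 1) (E i \<otimes> (\<one> \<oplus> T i))"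

lemma T_inv_closed [simp]: "i \<in> {1..<n} \<Longrightarrow> T_inv i \<in> carrier R"
  unfolding T_inv_def by (intro a_closed sm_closed m_closed one_closed T_closed E_closed)

text \<open>With \<open>X = E\<^sub>i (1 + T\<^sub>i)\<close>, the quadratic relation gives \<open>T\<^sub>i X = u X\<close>.  Hence \<open>T\<^sub>i (T\<^sub>i + (u\<^sup>-\<^sup>1 - 1) X)\<close> is
\<open>1 + (u - 1) X + (1 - u) X\<close>.\<close>

lemma T_T_inv:
  assumes i: "i \<in> {1..<n}"
  shows "T i \<otimes> T_inv i = \<one>" "T_inv i \<otimes> T i = \<one>"
proof -
  define X where "X = E i \<otimes> (\<one> \<oplus> T i)"
  have [simp]: "T i \<in> carrier R" "E i \<in> carrier R" using i T_closed E_closed by blast+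
  have [simp]: "X \<in> carrier R" by (simp add: X_def)
  have EX: "E i \<otimes> X = X" by (simp add: X_def E_idem[OF i] flip: m_assoc)
  have XT: "X \<otimes> T i = T i \<otimes> X"
    by (simp add: X_def r_distr l_distr m_assoc ET_comm[OF i])
  have "T i \<otimes> X = E i \<otimes> (T i \<oplus> T i \<otimes> T i)"
    by (simp add: X_def r_distr flip: m_assoc ET_comm[OF i])
  also have "\<dots> = E i \<otimes> T i \<oplus> (E i \<oplus> sm (u - 1) X)"
    by (simp add: quad[OF i] r_distr sm_mult_right EX flip: X_def)
  also have "\<dots> = X \<oplus> sm (u - 1) X"
    by (simp add: X_def r_distr a_ac)
  also have "\<dots> = sm u X"
    using sm_add_left[of X 1 "u - 1"] by simp
  finally have TX: "T i \<otimes> X = sm u X" .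
  have "T i \<otimes> T_inv i = T i \<otimes> T i \<oplus> sm ((inverse u - 1) * u) X"
    by (simp add: T_inv_def r_distr sm_mult_right TX sm_sm flip: X_def)
  also have "\<dots> = \<one> \<oplus> (sm (u - 1) X \<oplus> sm ((inverse u - 1) * u) X)"
    by (simp add: quad[OF i] a_assoc flip: X_def)
  also have "sm (u - 1) X \<oplus> sm ((inverse u - 1) * u) X = \<zero>"
    by (simp add: left_diff_distrib flip: sm_add_left)
  finally show T: "T i \<otimes> T_inv i = \<one>" by simp
  have "T_inv i \<otimes> T i = T i \<otimes> T_inv i"
    by (simp add: T_inv_def r_distr l_distr sm_mult_right sm_mult_left XT flip: X_def)
  then show "T_inv i \<otimes> T i = \<one>" using T by simp
qed

lemma inv_T: "i \<in> {1..<n} \<Longrightarrow> inv (T i) = T_inv i"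
  using T_T_inv by (intro inv_char) auto

text \<open>Everything about the \<open>E\<^sub>i\<^sub>j\<close> is expressed through conjugation by the generators.  Where its value on an
element is wanted, the inverse never appears: an identity is multiplied by generators on the right and
these are cancelled again.\<close>

definition conj :: "nat \<Rightarrow> 'a \<Rightarrow> 'a" where
  "conj k a = T k \<otimes> a \<otimes> T_inv k"

lemma conj_closed [simp]: "k \<in> {1..<n} \<Longrightarrow> a \<in> carrier R \<Longrightarrow> conj k a \<in> carrier R"
  unfolding conj_def by (intro m_closed T_closed T_inv_closed)

lemma T_conj: "k \<in> {1..<n} \<Longrightarrow> a \<in> carrier R \<Longrightarrow> T k \<otimes> a = conj k a \<otimes> T k"
  using T_T_inv[of k] T_closed[of k] T_inv_closed[of k] by (simp add: conj_def m_assoc)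

lemma T_right_cancel:
  assumes k: "k \<in> {1..<n}" and ab: "a \<in> carrier R" "b \<in> carrier R" and eq: "a \<otimes> T k = b \<otimes> T k"
  shows "a = b"
proof -
  have "a \<otimes> T k \<otimes> T_inv k = b \<otimes> T k \<otimes> T_inv k" using eq by simp
  then show ?thesis using ab T_T_inv[OF k] T_closed[OF k] T_inv_closed[OF k] by (simp add: m_assoc)
qed

lemma conj_eqI:
  "k \<in> {1..<n} \<Longrightarrow> a \<in> carrier R \<Longrightarrow> b \<in> carrier R \<Longrightarrow> T k \<otimes> a = b \<otimes> T k \<Longrightarrow> conj k a = b"
  by (rule T_right_cancel[of k]) (simp_all only: conj_closed flip: T_conj)

lemma conj_mult:
  assumes k: "k \<in> {1..<n}" and ab: "a \<in> carrier R" "b \<in> carrier R"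
  shows "conj k (a \<otimes> b) = conj k a \<otimes> conj k b"
proof (rule conj_eqI[OF k])
  have "T k \<otimes> (a \<otimes> b) = T k \<otimes> a \<otimes> b" using k ab T_closed by (simp only: m_assoc)
  also have "\<dots> = conj k a \<otimes> (T k \<otimes> b)"
    using k ab T_closed conj_closed by (simp only: T_conj m_assoc)
  also have "\<dots> = conj k a \<otimes> conj k b \<otimes> T k"
    using k ab T_closed conj_closed by (simp only: T_conj m_assoc)
  finally show "T k \<otimes> (a \<otimes> b) = conj k a \<otimes> conj k b \<otimes> T k" .
qed (use k ab conj_closed in \<open>auto intro!: m_closed\<close>)

lemma conj_inject:
  assumes k: "k \<in> {1..<n}" and ab: "a \<in> carrier R" "b \<in> carrier R" and eq: "conj k a = conj k b"
  shows "a = b"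
proof -
  have "T k \<otimes> a = T k \<otimes> b" using T_conj[OF k ab(1)] T_conj[OF k ab(2)] eq by simp
  then have "T_inv k \<otimes> T k \<otimes> a = T_inv k \<otimes> T k \<otimes> b"
    using ab T_closed[OF k] T_inv_closed[OF k] by (simp add: m_assoc)
  then show ?thesis using ab T_T_inv[OF k] by simp
qed

lemma conj_far:
  assumes k: "k \<in> {1..<n}" and l: "l \<in> {1..<n}" and far: "\<bar>int k - int l\<bar> > 1" and a: "a \<in> carrier R"
  shows "conj k (conj l a) = conj l (conj k a)"
proof (rule T_right_cancel[OF l], simp_all only: conj_closed k l a, rule T_right_cancel[OF k])
  note c = T_closed[OF k] T_closed[OF l] conj_closed[OF k] conj_closed[OF l] a m_closed
  show "conj k (conj l a) \<otimes> T l \<in> carrier R" "conj l (conj k a) \<otimes> T l \<in> carrier R"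
    by (intro c)+
  have "conj k (conj l a) \<otimes> T k \<otimes> T l = T k \<otimes> T l \<otimes> a"
    using c by (simp only: m_assoc flip: T_conj[OF k] T_conj[OF l])
  moreover have "conj l (conj k a) \<otimes> T l \<otimes> T k = T l \<otimes> T k \<otimes> a"
    using c by (simp only: m_assoc flip: T_conj[OF k] T_conj[OF l])
  ultimately show "conj k (conj l a) \<otimes> T l \<otimes> T k = conj l (conj k a) \<otimes> T l \<otimes> T k"
    using TT_far[OF k l far] c by (simp only: m_assoc)
qed

lemma conj_conj_T:
  assumes k: "k \<in> {1..<n}" and l: "l \<in> {1..<n}" and a: "a \<in> carrier R"
  shows "T k \<otimes> T l \<otimes> a = conj k (conj l a) \<otimes> (T k \<otimes> T l)"
proof -
  note c = T_closed[OF k] T_closed[OF l] conj_closed[OF k] conj_closed[OF l] a m_closed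
  have "T k \<otimes> T l \<otimes> a = T k \<otimes> conj l a \<otimes> T l"
    using c by (simp only: m_assoc T_conj[OF l])
  also have "\<dots> = conj k (conj l a) \<otimes> (T k \<otimes> T l)"
    using c by (simp only: T_conj[OF k] m_assoc)
  finally show ?thesis .
qed

lemma conj_conj_eqI:
  assumes k: "k \<in> {1..<n}" and l: "l \<in> {1..<n}" and a: "a \<in> carrier R" and b: "b \<in> carrier R"
    and eq: "T k \<otimes> T l \<otimes> a = b \<otimes> T k \<otimes> T l"
  shows "conj k (conj l a) = b"
proof (rule T_right_cancel[OF k], simp_all only: conj_closed k l a b, rule T_right_cancel[OF l])
  note c = T_closed[OF k] T_closed[OF l] conj_closed[OF k] conj_closed[OF l] a b m_closed
  show "conj k (conj l a) \<otimes> T k \<in> carrier R" "b \<otimes> T k \<in> carrier R"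
    by (intro c)+
  show "conj k (conj l a) \<otimes> T k \<otimes> T l = b \<otimes> T k \<otimes> T l"
    using eq conj_conj_T[OF k l a] c by (simp only: m_assoc)
qed

lemma conj_braid:
  assumes k: "k \<in> {1..<n}" and l: "l \<in> {1..<n}" and adj: "\<bar>int k - int l\<bar> = 1" and a: "a \<in> carrier R"
  shows "conj k (conj l (conj k a)) = conj l (conj k (conj l a))"
proof -
  note c = T_closed[OF k] T_closed[OF l] conj_closed[OF k] conj_closed[OF l] a m_closed
  have W: "T k \<otimes> (T l \<otimes> T k) = T l \<otimes> (T k \<otimes> T l)"
    using braid[OF k l adj] c by (simp only: m_assoc)
  have 1: "T k \<otimes> (T l \<otimes> T k) \<otimes> a = conj k (conj l (conj k a)) \<otimes> (T k \<otimes> (T l \<otimes> T k))"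
  proof -
    have "T k \<otimes> (T l \<otimes> T k) \<otimes> a = T k \<otimes> (conj l (conj k a) \<otimes> (T l \<otimes> T k))"
      using c by (simp only: m_assoc conj_conj_T[OF l k a, symmetric])
    also have "\<dots> = T k \<otimes> conj l (conj k a) \<otimes> (T l \<otimes> T k)"
      using c by (simp only: m_assoc)
    also have "\<dots> = conj k (conj l (conj k a)) \<otimes> (T k \<otimes> (T l \<otimes> T k))"
      using c by (simp only: T_conj[OF k] m_assoc)
    finally show ?thesis .
  qed
  have 2: "T l \<otimes> (T k \<otimes> T l) \<otimes> a = conj l (conj k (conj l a)) \<otimes> (T l \<otimes> (T k \<otimes> T l))"
  proof -
    have "T l \<otimes> (T k \<otimes> T l) \<otimes> a = T l \<otimes> (conj k (conj l a) \<otimes> (T k \<otimes> T l))"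
      using c by (simp only: m_assoc conj_conj_T[OF k l a, symmetric])
    also have "\<dots> = T l \<otimes> conj k (conj l a) \<otimes> (T k \<otimes> T l)"
      using c by (simp only: m_assoc)
    also have "\<dots> = conj l (conj k (conj l a)) \<otimes> (T l \<otimes> (T k \<otimes> T l))"
      using c by (simp only: T_conj[OF l] m_assoc)
    finally show ?thesis .
  qed
  have eq: "conj k (conj l (conj k a)) \<otimes> T k \<otimes> T l \<otimes> T k = conj l (conj k (conj l a)) \<otimes> T k \<otimes> T l \<otimes> T k"
    using 1 2 W c by (simp only: m_assoc)
  show ?thesis
    by (rule T_right_cancel[OF k _ _ T_right_cancel[OF l _ _ T_right_cancel[OF k _ _ eq]]]) (intro c)+
qed

definition E_pair :: "nat \<Rightarrow> nat \<Rightarrow> 'a" where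
  "E_pair i j =
     (if j = i + 1 then E i
      else list_prod R (map T [i..<j-1]) \<otimes> E (j - 1) \<otimes> list_prod R (map (\<lambda>k. inv (T k)) (rev [i..<j-1])))"

lemma E_pair_Suc [simp]: "E_pair i (Suc i) = E i"
  by (simp add: E_pair_def)

lemma E_pair_rec:
  assumes "1 \<le> i" "Suc i < j" "j \<le> n"
  shows "E_pair i j = conj i (E_pair (Suc i) j) \<and> E_pair i j \<in> carrier R"
  using assms
proof (induction "j - i" arbitrary: i rule: less_induct)
  case less
  have i: "i \<in> {1..<n}" "j - 1 \<in> {1..<n}" using less.prems by auto
  have up: "[i..<j-1] = i # [Suc i..<j-1]" using less.prems by (simp add: upt_conv_Cons)
  have cl: "set (map T [i'..<j-1]) \<subseteq> carrier R" "set (map (\<lambda>k. inv (T k)) (rev [i'..<j-1])) \<subseteq> carrier R"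
    if "i \<le> i'" for i' using that less.prems by (auto simp: inv_T)
  note c = list_prod_closed[OF cl(1)[OF order_refl]] list_prod_closed[OF cl(2)[OF order_refl]]
    list_prod_closed[OF cl(1)[of "Suc i"]] list_prod_closed[OF cl(2)[of "Suc i"]] T_closed[OF i(1)]
    E_closed[OF i(2)] T_inv_closed[OF i(1)]
  have snoc: "list_prod R (map (\<lambda>k. inv (T k)) (rev [i..<j-1]))
      = list_prod R (map (\<lambda>k. inv (T k)) (rev [Suc i..<j-1])) \<otimes> T_inv i"
    unfolding up using cl(2)[of "Suc i"] c by (simp add: inv_T[OF i(1)])
  have up_prod: "list_prod R (map T [i..<j-1]) = T i \<otimes> list_prod R (map T [Suc i..<j-1])"
    by (simp only: up list.map list_prod_simps)
  have rec: "E_pair i j = T i \<otimes> (list_prod R (map T [Suc i..<j-1]) \<otimes> E (j - 1) \<otimes>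
       list_prod R (map (\<lambda>k. inv (T k)) (rev [Suc i..<j-1]))) \<otimes> T_inv i"
    using less.prems c unfolding E_pair_def snoc up_prod by (simp add: m_assoc)
  show ?case
  proof (cases "j = Suc (Suc i)")
    case True
    then show ?thesis using rec c by (auto simp: conj_def)
  next
    case False
    then have "E_pair (Suc i) j = list_prod R (map T [Suc i..<j-1]) \<otimes> E (j - 1) \<otimes>
       list_prod R (map (\<lambda>k. inv (T k)) (rev [Suc i..<j-1]))"
      by (simp add: E_pair_def)
    then show ?thesis using rec c by (simp add: conj_def)
  qed
qed

lemma E_pair_closed [simp]: "1 \<le> i \<Longrightarrow> i < j \<Longrightarrow> j \<le> n \<Longrightarrow> E_pair i j \<in> carrier R"
  using E_pair_rec[of i j] by (cases "j = Suc i") auto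

text \<open>The reason why conjugation acts on the \<open>E\<^sub>i\<^sub>j\<close> through the symmetric group although \<open>T\<^sub>i\<^sup>2 \<noteq> 1\<close>: the
square differs from \<open>1\<close> by a multiple of \<open>E\<^sub>i (1 + T\<^sub>i)\<close>, and this commutes with the neighbouring
idempotent, because \<open>E\<^sub>i\<^sub>+\<^sub>1 E\<^sub>i T\<^sub>i = T\<^sub>i E\<^sub>i\<^sub>+\<^sub>1 E\<^sub>i\<close>.\<close>

lemma conj_T_square:
  assumes i: "i \<in> {1..<n}" "Suc i \<in> {1..<n}"
  shows "conj i (conj i (E (Suc i))) = E (Suc i)"
proof (rule conj_conj_eqI[OF i(1) i(1)])
  have adj: "\<bar>int (Suc i) - int i\<bar> = 1" by simp
  have [simp]: "T i \<in> carrier R" "E i \<in> carrier R" "E (Suc i) \<in> carrier R" using i T_closed E_closed by blast+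
  have a: "E (Suc i) \<otimes> (E i \<otimes> T i) = E i \<otimes> T i \<otimes> E (Suc i)"
  proof -
    have "E (Suc i) \<otimes> (E i \<otimes> T i) = T i \<otimes> (E (Suc i) \<otimes> E i)"
      using EET[OF i(2) i(1) adj] ETE[OF i(2) i(1) adj] by (simp add: m_assoc)
    also have "\<dots> = T i \<otimes> E i \<otimes> E (Suc i)"
      by (simp add: EE_comm[OF i(2) i(1)] m_assoc)
    finally show ?thesis by (simp add: ET_comm[OF i(1)])
  qed
  have "E (Suc i) \<otimes> (E i \<otimes> (\<one> \<oplus> T i)) = E i \<otimes> (\<one> \<oplus> T i) \<otimes> E (Suc i)"
    using EE_comm[OF i(2) i(1)] by (simp add: r_distr l_distr a)
  then have "T i \<otimes> T i \<otimes> E (Suc i) = E (Suc i) \<otimes> (T i \<otimes> T i)"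
    by (simp add: quad[OF i(1)] r_distr l_distr sm_mult_left sm_mult_right)
  then show "T i \<otimes> T i \<otimes> E (Suc i) = E (Suc i) \<otimes> T i \<otimes> T i"
    by (simp add: m_assoc)
qed (use i in auto)

text \<open>Conjugation by \<open>T\<^sub>k\<close> acts on the \<open>E\<^sub>i\<^sub>j\<close> through the transposition of \<open>k\<close> and \<open>k + 1\<close>.  The induction on
\<open>j - i\<close> writes \<open>E\<^sub>i\<^sub>j\<close> as the conjugate of \<open>E\<^sub>i\<^sub>+\<^sub>1\<^sub>,\<^sub>j\<close> by \<open>T\<^sub>i\<close>; a conjugation by a distant \<open>T\<^sub>k\<close> is pulled
through, one by \<open>T\<^sub>i\<^sub>+\<^sub>1\<close> is handled by the braid relation, and one by \<open>T\<^sub>i\<close> undoes the last step, since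
the square of \<open>T\<^sub>i\<close> commutes with \<open>E\<^sub>i\<^sub>+\<^sub>1\<^sub>,\<^sub>j\<close>.\<close>

lemma conj_E_pair:
  assumes "1 \<le> i" "i < j" "j \<le> n" "k \<in> {1..<n}"
  shows "conj k (E_pair i j) = (if k = i \<and> j = Suc i then E_pair i j else if k = i then E_pair (Suc i) j
     else if Suc k = i then E_pair k j else if k = j then E_pair i (Suc j)
     else if Suc k = j then E_pair i k else E_pair i j)"
  using assms
proof (induction "j - i" arbitrary: i j k rule: less_induct)
  case less
  have k: "k \<in> {1..<n}" by fact
  have i: "i \<in> {1..<n}" using less.prems by auto
  have c: "E_pair i' j' \<in> carrier R" if "i \<le> i'" "i' < j'" "j' \<le> n" for i' j'
    using that less.prems by auto
  show ?case
  proof (cases "j = Suc i")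
    case True
    consider "k = i" | "Suc k = i" | "k = Suc i" | "k \<noteq> i" "\<bar>int k - int i\<bar> > 1" by linarith
    then show ?thesis
    proof cases
      case 1
      then show ?thesis using True i ET_comm[OF i] by (auto intro!: conj_eqI)
    next
      case 2
      then show ?thesis using True less.prems E_pair_rec[of k j] by auto
    next
      case 3
      then have si: "Suc i \<in> {1..<n}" using k by simp
      \<comment> \<open>Both sides of the claim have the same conjugate by \<open>T\<^sub>i\<close>: one by the relation between \<open>E\<close> and two \<open>T\<close>,
the other because \<open>T\<^sub>i\<^sup>2\<close> commutes with \<open>E\<^sub>i\<^sub>+\<^sub>1\<close>.\<close>
      have "conj i (conj (Suc i) (E i)) = E (Suc i)"
        using ETT[OF i si] by (intro conj_conj_eqI i si E_closed) auto
      also have "\<dots> = conj i (conj i (E (Suc i)))" using conj_T_square[OF i si] by simp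
      finally have "conj (Suc i) (E i) = conj i (E (Suc i))"
        by (rule conj_inject[OF i, rotated -1]) (use i si in auto)
      also have "\<dots> = E_pair i (Suc (Suc i))" using E_pair_rec[of i "Suc (Suc i)"] i si by auto
      finally show ?thesis using 3 True by simp
    next
      case 4
      then show ?thesis using True i k ET_far[OF i k] by (auto intro!: conj_eqI)
    qed
  next
    case False
    then have ij: "Suc i < j" using less.prems by simp
    have rec: "E_pair i j = conj i (E_pair (Suc i) j)" using E_pair_rec[of i j] ij less.prems by simp
    have IH: "conj k' (E_pair i' j') = (if k' = i' \<and> j' = Suc i' then E_pair i' j' else if k' = i' then E_pair (Suc i') j'
       else if Suc k' = i' then E_pair k' j' else if k' = j' then E_pair i' (Suc j')
       else if Suc k' = j' then E_pair i' k' else E_pair i' j')"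
      if "j' - i' < j - i" "i \<le> i'" "i' < j'" "j' \<le> n" "k' \<in> {1..<n}" for i' j' k'
      using less.hyps[of j' i' k'] that less.prems by auto
    consider "Suc k < i \<or> k > j" | "Suc k = i" | "k = i" | "k = Suc i" "Suc (Suc i) < j" | "k > Suc i" "Suc k < j"
      | "Suc k = j" "j = Suc (Suc i)" | "Suc k = j" "j > Suc (Suc i)" | "k = j" using False less.prems by linarith
    then show ?thesis
    proof cases
      case 1
      have "conj k (E_pair i j) = conj i (conj k (E_pair (Suc i) j))"
        unfolding rec using 1 ij less.prems by (intro conj_far i k c) auto
      also have "conj k (E_pair (Suc i) j) = E_pair (Suc i) j"
        using 1 IH[of j "Suc i" k] less.prems ij by auto
      finally show ?thesis using 1 less.prems by (auto simp flip: rec)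
    next
      case 2
      then show ?thesis using E_pair_rec[of k j] less.prems by auto
    next
      case 3
      have "conj i (conj i (E_pair (Suc i) j)) = E_pair (Suc i) j"
      proof (cases "j = Suc (Suc i)")
        case True
        then show ?thesis using less.prems conj_T_square[of i] i by auto
      next
        case False
        then obtain l where l: "j = Suc l" "Suc (Suc i) \<le> l" using ij by (cases j) auto
        have lk: "l \<in> {1..<n}" using l less.prems by auto
        have e: "E_pair (Suc i) j = conj l (E_pair (Suc i) l)"
          using IH[of l "Suc i" l] l less.prems lk by auto
        have "conj i (conj i (E_pair (Suc i) l)) = E_pair (Suc i) l"
          using E_pair_rec[of i l] IH[of l i i] l less.prems i by auto
        moreover have "conj i (conj i (E_pair (Suc i) j)) = conj l (conj i (conj i (E_pair (Suc i) l)))"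
          unfolding e using l less.prems by (simp add: conj_far[of i l] i lk c)
        ultimately show ?thesis using e by simp
      qed
      then show ?thesis using 3 False ij by (simp add: rec)
    next
      case 4
      have rec2: "E_pair (Suc i) j = conj (Suc i) (E_pair (Suc (Suc i)) j)"
        using E_pair_rec[of "Suc i" j] 4 less.prems by auto
      have "conj (Suc i) (conj i (conj (Suc i) (E_pair (Suc (Suc i)) j)))
        = conj i (conj (Suc i) (conj i (E_pair (Suc (Suc i)) j)))"
        using 4 less.prems k i by (intro conj_braid c) auto
      also have "conj i (E_pair (Suc (Suc i)) j) = E_pair (Suc (Suc i)) j"
        using 4 IH[of j "Suc (Suc i)" i] less.prems i by auto
      finally have "conj (Suc i) (E_pair i j) = E_pair i j"
        unfolding rec rec2 .
      then show ?thesis using 4 by simp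
    next
      case 5
      have "conj k (E_pair i j) = conj i (conj k (E_pair (Suc i) j))"
        unfolding rec using 5 ij less.prems by (intro conj_far i k c) auto
      also have "conj k (E_pair (Suc i) j) = E_pair (Suc i) j"
        using 5 IH[of j "Suc i" k] less.prems ij k by auto
      finally show ?thesis using 5 less.prems by (auto simp flip: rec)
    next
      case 6
      then have k': "k = Suc i" by simp
      have "conj (Suc i) (conj i (E (Suc i))) = E i"
        using ETT[OF k[unfolded k'] i] i k k' by (intro conj_conj_eqI) auto
      then show ?thesis using 6 k' rec by simp
    next
      case 7
      have "conj k (E_pair i j) = conj i (conj k (E_pair (Suc i) j))"
        unfolding rec using 7 ij less.prems by (intro conj_far i k c) auto
      also have "conj k (E_pair (Suc i) j) = E_pair (Suc i) k"
        using 7 IH[of j "Suc i" k] less.prems ij k by auto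
      also have "conj i (E_pair (Suc i) k) = E_pair i k"
        using 7 E_pair_rec[of i k] less.prems by auto
      finally show ?thesis using 7 less.prems by auto
    next
      case 8
      have "conj k (E_pair i j) = conj i (conj k (E_pair (Suc i) j))"
        unfolding rec using 8 ij less.prems by (intro conj_far i k c) auto
      also have "conj k (E_pair (Suc i) j) = E_pair (Suc i) (Suc j)"
        using 8 IH[of j "Suc i" k] less.prems ij k by auto
      also have "conj i (E_pair (Suc i) (Suc j)) = E_pair i (Suc j)"
        using 8 E_pair_rec[of i "Suc j"] less.prems by auto
      finally show ?thesis using 8 less.prems by auto
    qed
  qed
qed

end

section \<open>Words in the simple transpositions\<close>

lemma word_perm_simps [simp]:
  "word_perm [] = id" "word_perm (i # is) = transpose i (Suc i) \<circ> word_perm is"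
  by (simp_all add: word_perm_def)

lemma word_perm_append: "word_perm (v @ w) = word_perm v \<circ> word_perm w"
  by (induction v) (simp_all add: o_assoc)

lemma word_perm_permutes: "set w \<subseteq> {1..<n} \<Longrightarrow> word_perm w permutes {1..n}"
proof (induction w)
  case (Cons i w)
  have "transpose i (Suc i) permutes {1..n}" using Cons.prems by (intro permutes_swap_id) auto
  moreover have "word_perm w permutes {1..n}" using Cons by simp
  ultimately show ?case unfolding word_perm_simps by (intro permutes_compose)
qed (simp add: permutes_id)

text \<open>The descending word \<open>m + 1, m, \<dots>, k\<close> moves \<open>k\<close> to \<open>m + 2\<close>.  These words, for \<open>1 \<le> k \<le> m + 2\<close>, represent the
cosets of the permutations of \<open>m + 1\<close> points among those of \<open>m + 2\<close> points, so the words
here represent each permutation of \<open>m + 1\<close> points once.\<close>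

fun nf_words :: "nat \<Rightarrow> nat list set" where
  "nf_words 0 = {[]}"
| "nf_words (Suc m) = (\<lambda>(v, k). v @ rev [k..<m + 2]) ` (nf_words m \<times> {1..m + 2})"

lemma nf_words_letters: "v \<in> nf_words m \<Longrightarrow> set v \<subseteq> {1..<m + 1}"
  by (induction m arbitrary: v) (force+)

lemma finite_nf_words: "finite (nf_words m)"
  by (induction m) auto

lemma card_nf_words: "card (nf_words m) \<le> fact (Suc m)"
proof (induction m)
  case (Suc m)
  have "card (nf_words (Suc m)) \<le> card (nf_words m \<times> {1..m + 2})"
    unfolding nf_words.simps by (rule card_image_le) (simp add: finite_nf_words)
  also have "\<dots> \<le> fact (Suc m) * (m + 2)"
    unfolding card_cartesian_product card_atLeastAtMost using Suc by (intro mult_le_mono) auto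
  also have "\<dots> = fact (Suc (Suc m))" by simp
  finally show ?case .
qed simp

lemma word_perm_descending: "k \<le> m \<Longrightarrow> word_perm (rev [k..<m]) k = m"
proof (induction "m - k" arbitrary: k)
  case (Suc d)
  then have "[k..<m] = k # [Suc k..<m]" by (simp add: upt_conv_Cons)
  then show ?case using Suc by (simp add: word_perm_append)
qed simp

text \<open>The last descending run is determined by the point that is sent to \<open>m + 2\<close>; what remains fixes \<open>m + 2\<close>.\<close>

lemma nf_words_surj:
  "w permutes {1..Suc m} \<Longrightarrow> \<exists>v \<in> nf_words m. word_perm v = w"
proof (induction m arbitrary: w)
  case 0
  then show ?case by simp
next
  case (Suc m)
  define k where "k = Hilbert_Choice.inv w (m + 2)"
  have wk: "w k = m + 2" unfolding k_def using Suc.prems by (simp add: permutes_inverses)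
  then have k: "k \<in> {1..m + 2}"
    using permutes_in_image[OF Suc.prems, of k] by auto
  let ?c = "word_perm (rev [k..<m + 2])"
  have c: "?c permutes {1..Suc (Suc m)}" by (intro word_perm_permutes) (use k in auto)
  have ck: "?c k = m + 2" using k by (intro word_perm_descending) auto
  define w' where "w' = w \<circ> Hilbert_Choice.inv ?c"
  have w': "w' permutes {1..Suc (Suc m)}"
    unfolding w'_def by (intro permutes_compose permutes_inv c Suc.prems)
  have "w' (m + 2) = m + 2"
    using wk ck c by (metis comp_apply permutes_inverses(2) w'_def)
  then have "w' permutes {1..Suc m}"
    using w' by (intro permutes_superset[OF w']) (auto simp: le_Suc_eq)
  then obtain v where v: "v \<in> nf_words m" "word_perm v = w'"
    using Suc.IH by blast
  have "w' \<circ> ?c = w"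
    unfolding w'_def using permutes_inv_o(2)[OF c] by (simp add: comp_assoc)
  then have "word_perm (v @ rev [k..<m + 2]) = w" using v by (simp add: word_perm_append)
  moreover have "v @ rev [k..<m + 2] \<in> nf_words (Suc m)"
    unfolding nf_words.simps using v(1) k by (intro image_eqI[where x = "(v, k)"]) auto
  ultimately show ?case by blast
qed

lemma word_perm_surj:
  assumes "w permutes {1..n}"
  obtains v where "set v \<subseteq> {1..<n}" "word_perm v = w"
proof (cases n)
  case 0
  then show thesis using that[of "[]"] assms by simp
next
  case (Suc m)
  then obtain v where "v \<in> nf_words m" "word_perm v = w"
    using nf_words_surj[of w m] assms by auto
  then show thesis using that[of v] nf_words_letters[of v m] Suc by simp
qed

text \<open>Used to move up to four distinct points to the points \<open>1, 2, 3, 4\<close> by a permutation.\<close>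

lemma permutes_extend:
  assumes U: "finite U" and S: "S \<subseteq> U" "f ` S \<subseteq> U" and inj: "inj_on f S"
  obtains w where "w permutes U" "\<And>x. x \<in> S \<Longrightarrow> w x = f x"
proof -
  have fin: "finite S" using S U finite_subset by blast
  have "card (U - S) = card (U - f ` S)"
    using assms fin by (simp add: card_Diff_subset card_image)
  then obtain g where g: "bij_betw g (U - S) (U - f ` S)"
    using U finite_same_card_bij by blast
  define w where "w x = (if x \<in> S then f x else if x \<in> U then g x else x)" for x
  have "bij_betw w (S \<union> (U - S)) (f ` S \<union> (U - f ` S))"
    by (rule bij_betw_combine)
      (use inj g in \<open>auto simp: bij_betw_def w_def inj_on_def image_def\<close>)
  then have "bij_betw w U U" using S by (simp add: Un_absorb1)
  then have "w permutes U" by (rule bij_imp_permutes) (use S in \<open>auto simp: w_def\<close>)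
  then show thesis using that[of w] by (simp add: w_def)
qed

context bt_rels begin

definition T_word :: "nat list \<Rightarrow> 'a" where
  "T_word ws = list_prod R (map T ws)"

lemma T_word_closed [simp]: "set ws \<subseteq> {1..<n} \<Longrightarrow> T_word ws \<in> carrier R"
  unfolding T_word_def by (intro list_prod_closed) auto

lemma T_word_Nil [simp]: "T_word [] = \<one>"
  by (simp add: T_word_def)

lemma T_word_Cons: "T_word (i # ws) = T i \<otimes> T_word ws"
  by (simp add: T_word_def)

lemma T_word_single: "i \<in> {1..<n} \<Longrightarrow> T_word [i] = T i"
  by (simp add: T_word_def)

lemma T_word_append: "set v \<subseteq> {1..<n} \<Longrightarrow> set w \<subseteq> {1..<n} \<Longrightarrow> T_word (v @ w) = T_word v \<otimes> T_word w"
  unfolding T_word_def map_append by (intro list_prod_append) auto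

lemma T_word_commute:
  assumes "set ws \<subseteq> {1..<n}" "a \<in> carrier R" "\<And>i. i \<in> set ws \<Longrightarrow> T i \<otimes> a = a \<otimes> T i"
  shows "T_word ws \<otimes> a = a \<otimes> T_word ws"
  using assms
proof (induction ws)
  case (Cons i ws)
  have c: "T i \<in> carrier R" "T_word ws \<in> carrier R" "T_word (i # ws) = T i \<otimes> T_word ws"
    using Cons.prems by (auto simp: T_word_Cons)
  have IH: "T_word ws \<otimes> a = a \<otimes> T_word ws"
    by (rule Cons.IH) (use Cons.prems in auto)
  have "T_word (i # ws) \<otimes> a = T i \<otimes> a \<otimes> T_word ws"
    using c Cons.prems(2) by (simp add: m_assoc IH)
  also have "T i \<otimes> a = a \<otimes> T i" using Cons.prems(3)[of i] by simp
  also have "a \<otimes> T i \<otimes> T_word ws = a \<otimes> T_word (i # ws)" using c Cons.prems by (simp add: m_assoc)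
  finally show ?case .
qed simp

section \<open>The idempotents attached to pairs of points\<close>

definition E_edge :: "nat \<Rightarrow> nat \<Rightarrow> 'a" where
  "E_edge x y = E_pair (min x y) (max x y)"

abbreviation "points \<equiv> {1..n}"

lemma E_edge_sym: "E_edge x y = E_edge y x"
  by (simp add: E_edge_def min.commute max.commute)

lemma E_edge_less: "x < y \<Longrightarrow> E_edge x y = E_pair x y"
  by (simp add: E_edge_def)

lemma E_edge_closed [simp]: "x \<in> points \<Longrightarrow> y \<in> points \<Longrightarrow> x \<noteq> y \<Longrightarrow> E_edge x y \<in> carrier R"
  unfolding E_edge_def by (intro E_pair_closed) (auto simp: min_def max_def)

lemma conj_E_edge:
  assumes k: "k \<in> {1..<n}" and xy: "x \<in> points" "y \<in> points" "x \<noteq> y"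
  shows "conj k (E_edge x y) = E_edge (transpose k (Suc k) x) (transpose k (Suc k) y)"
proof -
  have less: "conj k (E_edge x y) = E_edge (transpose k (Suc k) x) (transpose k (Suc k) y)"
    if xy: "x \<in> points" "y \<in> points" "x < y" for x y
  proof -
    have c: "conj k (E_pair x y) = (if k = x \<and> y = Suc x then E_pair x y else if k = x then E_pair (Suc x) y
       else if Suc k = x then E_pair k y else if k = y then E_pair x (Suc y)
       else if Suc k = y then E_pair x k else E_pair x y)"
      using conj_E_pair[of x y k] k xy by simp
    consider "k = x" "y = Suc x" | "k = x" "y > Suc x" | "Suc k = x" | "k = y" | "Suc k = y" "k > x"
      | "k \<noteq> x" "Suc k \<noteq> x" "k \<noteq> y" "Suc k \<noteq> y" using xy(3) by linarith
    then show ?thesis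
      unfolding E_edge_less[OF xy(3)] c using xy(3)
      by cases (simp_all add: E_edge_def transpose_def min_def max_def)
  qed
  consider "x < y" | "y < x" using xy by linarith
  then show ?thesis
  proof cases
    case 1
    show ?thesis by (rule less[OF xy(1,2) 1])
  next
    case 2
    show ?thesis
      by (subst (1 2) E_edge_sym) (rule less[OF xy(2,1) 2])
  qed
qed

definition conj_word :: "nat list \<Rightarrow> 'a \<Rightarrow> 'a" where
  "conj_word ws a = foldr conj ws a"

lemma conj_word_simps [simp]: "conj_word [] a = a" "conj_word (i # ws) a = conj i (conj_word ws a)"
  by (simp_all add: conj_word_def)

lemma conj_word_closed [simp]: "set ws \<subseteq> {1..<n} \<Longrightarrow> a \<in> carrier R \<Longrightarrow> conj_word ws a \<in> carrier R"
  by (induction ws) auto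

lemma conj_word_mult:
  "set ws \<subseteq> {1..<n} \<Longrightarrow> a \<in> carrier R \<Longrightarrow> b \<in> carrier R \<Longrightarrow>
    conj_word ws (a \<otimes> b) = conj_word ws a \<otimes> conj_word ws b"
  by (induction ws) (auto simp: conj_mult)

lemma conj_word_E_edge:
  assumes "set ws \<subseteq> {1..<n}" "x \<in> points" "y \<in> points" "x \<noteq> y"
  shows "conj_word ws (E_edge x y) = E_edge (word_perm ws x) (word_perm ws y)"
  using assms(1)
proof (induction ws)
  case (Cons i ws)
  then have ws: "word_perm ws permutes points" by (intro word_perm_permutes) auto
  have "word_perm ws x \<in> points" "word_perm ws y \<in> points" "word_perm ws x \<noteq> word_perm ws y"
    using permutes_in_image[OF ws] permutes_inj[OF ws] assms(2-) by (auto dest: injD)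
  then show ?case using Cons by (simp add: conj_E_edge)
qed simp

text \<open>Conjugation by a word acts on the pairs of points through the permutation of the word,
although the product along the word depends on more than its permutation.\<close>

lemma T_word_E_edge:
  assumes "set ws \<subseteq> {1..<n}" "x \<in> points" "y \<in> points" "x \<noteq> y"
  shows "T_word ws \<otimes> E_edge x y = E_edge (word_perm ws x) (word_perm ws y) \<otimes> T_word ws"
proof -
  have "T_word ws \<otimes> a = conj_word ws a \<otimes> T_word ws" if "a \<in> carrier R" for a
    using assms(1)
  proof (induction ws)
    case (Cons i ws)
    have c: "T i \<in> carrier R" "T_word ws \<in> carrier R" "T_word (i # ws) = T i \<otimes> T_word ws"
      "conj_word ws a \<in> carrier R" "i \<in> {1..<n}"
      using Cons.prems that by (auto simp: T_word_Cons)
    have "T_word (i # ws) \<otimes> a = T i \<otimes> conj_word ws a \<otimes> T_word ws"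
      using c Cons that by (simp add: m_assoc)
    also have "\<dots> = conj_word (i # ws) a \<otimes> T_word (i # ws)"
      unfolding T_conj[OF c(5,4)] conj_word_simps c(3) using c(1,2) conj_closed[OF c(5,4)] by (simp add: m_assoc)
    finally show ?case .
  qed (use that in simp)
  then show ?thesis using assms by (simp add: conj_word_E_edge)
qed

text \<open>Some word conjugates the idempotents at the first points into those at given distinct points.
Relations between at most four points need to be checked only at \<open>1, 2, 3, 4\<close>.\<close>

lemma E_edge_transport:
  assumes "xs \<noteq> []" "length xs \<le> n" "distinct xs" "set xs \<subseteq> points"
  obtains ws where "set ws \<subseteq> {1..<n}" "\<And>i. i < length xs \<Longrightarrow> word_perm ws (Suc i) = xs ! i"
proof -
  let ?S = "{1..length xs}"
  let ?f = "\<lambda>i. xs ! (i - 1)"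
  have inj: "inj_on ?f ?S"
  proof (rule inj_onI)
    fix i j assume i: "i \<in> ?S" and j: "j \<in> ?S" and eq: "xs ! (i - 1) = xs ! (j - 1)"
    have "i - 1 < length xs" "j - 1 < length xs" using i j by auto
    then have "i - 1 = j - 1" using nth_eq_iff_index_eq[OF assms(3)] eq by blast
    then show "i = j" using i j by auto
  qed
  have image: "?f ` ?S \<subseteq> points"
  proof (rule image_subsetI)
    fix i assume "i \<in> ?S"
    then have "xs ! (i - 1) \<in> set xs" by (intro nth_mem) auto
    then show "xs ! (i - 1) \<in> points" using assms(4) by blast
  qed
  have sub: "?S \<subseteq> points" using assms(2) by auto
  obtain w where w: "w permutes points" "\<And>i. i \<in> ?S \<Longrightarrow> w i = ?f i"
    by (rule permutes_extend[OF finite_atLeastAtMost sub image inj]) (rule that)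
  obtain ws where ws: "set ws \<subseteq> {1..<n}" "word_perm ws = w"
    using word_perm_surj[OF w(1)] .
  show thesis
  proof (rule that[OF ws(1)])
    fix i assume "i < length xs"
    then show "word_perm ws (Suc i) = xs ! i" unfolding ws(2) using w(2)[of "Suc i"] by simp
  qed
qed

lemma length_le_points: "distinct xs \<Longrightarrow> set xs \<subseteq> points \<Longrightarrow> length xs \<le> n"
  using card_mono[of points "set xs"] by (simp add: distinct_card)

lemma E_edge_idem:
  assumes "x \<in> points" "y \<in> points" "x \<noteq> y"
  shows "E_edge x y \<otimes> E_edge x y = E_edge x y"
proof -
  have len: "length [x, y] \<le> n" using assms by (intro length_le_points) auto
  obtain ws where ws: "set ws \<subseteq> {1..<n}" "\<And>i. i < length [x, y] \<Longrightarrow> word_perm ws (Suc i) = [x, y] ! i"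
    by (rule E_edge_transport[of "[x, y]"]) (use assms len in auto)
  have i: "Suc 0 \<in> {1..<n}" using len by auto
  have p: "word_perm ws (Suc 0) = x" "word_perm ws (Suc (Suc 0)) = y"
    using ws(2)[of 0] ws(2)[of "Suc 0"] by simp_all
  have e: "E_edge x y = conj_word ws (E (Suc 0))"
    using conj_word_E_edge[OF ws(1), of "Suc 0" "Suc (Suc 0)"] len
    by (simp add: E_edge_less p)
  show ?thesis
    unfolding e conj_word_mult[OF ws(1) E_closed[OF i] E_closed[OF i], symmetric] E_idem[OF i] ..
qed

text \<open>The relation \<open>E\<^sub>x\<^sub>y E\<^sub>y\<^sub>z E\<^sub>x\<^sub>z = E\<^sub>x\<^sub>y E\<^sub>y\<^sub>z\<close> is what makes products of the idempotents depend only on the connected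
components of the graph with edges the given pairs.  At the points \<open>1, 2, 3\<close> it follows from
\<open>E\<^sub>2 T\<^sub>1 E\<^sub>2 = E\<^sub>2 E\<^sub>1 T\<^sub>1\<close>.\<close>

lemma E_edge_triangle:
  assumes "x \<in> points" "y \<in> points" "z \<in> points" "x \<noteq> y" "y \<noteq> z" "x \<noteq> z"
  shows "E_edge x y \<otimes> E_edge y z \<otimes> E_edge x z = E_edge x y \<otimes> E_edge y z"
    and "E_edge x y \<otimes> E_edge y z = E_edge y z \<otimes> E_edge x y"
proof -
  let ?a = "Suc 0" and ?b = "Suc (Suc 0)" and ?c = "Suc (Suc (Suc 0))"
  have len: "length [x, y, z] \<le> n" using assms by (intro length_le_points) auto
  then have i: "?a \<in> {1..<n}" "?b \<in> {1..<n}" by auto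
  obtain ws where ws: "set ws \<subseteq> {1..<n}" "\<And>i. i < length [x, y, z] \<Longrightarrow> word_perm ws (Suc i) = [x, y, z] ! i"
    by (rule E_edge_transport[of "[x, y, z]"]) (use assms len in auto)
  have p: "word_perm ws ?a = x" "word_perm ws ?b = y" "word_perm ws ?c = z"
    using ws(2)[of 0] ws(2)[of ?a] ws(2)[of ?b] by simp_all
  have e: "E_edge x y = conj_word ws (E ?a)" "E_edge y z = conj_word ws (E ?b)"
    "E_edge x z = conj_word ws (E_pair ?a ?c)"
    using conj_word_E_edge[OF ws(1), of ?a ?b] conj_word_E_edge[OF ws(1), of ?b ?c]
      conj_word_E_edge[OF ws(1), of ?a ?c] len
    by (simp_all add: p E_edge_less)
  have c: "E ?a \<in> carrier R" "E ?b \<in> carrier R" "T ?a \<in> carrier R" "T_inv ?a \<in> carrier R" "E_pair ?a ?c \<in> carrier R"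
    using E_closed[OF i(1)] E_closed[OF i(2)] T_closed[OF i(1)] T_inv_closed[OF i(1)] len by auto
  have adj: "\<bar>int ?b - int ?a\<bar> = 1" by simp
  have "E_pair ?a ?c = T ?a \<otimes> E ?b \<otimes> T_inv ?a"
    using E_pair_rec[of ?a ?c] len by (simp add: conj_def)
  then have "E ?a \<otimes> E ?b \<otimes> E_pair ?a ?c = E ?a \<otimes> (E ?b \<otimes> T ?a \<otimes> E ?b) \<otimes> T_inv ?a"
    using c by (simp only: m_assoc m_closed)
  also have "\<dots> = E ?a \<otimes> (E ?b \<otimes> E ?a \<otimes> T ?a) \<otimes> T_inv ?a"
    by (simp only: EET[OF i(2,1) adj])
  also have "\<dots> = E ?a \<otimes> (E ?b \<otimes> E ?a) \<otimes> (T ?a \<otimes> T_inv ?a)"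
    using c by (simp only: m_assoc m_closed)
  also have "\<dots> = E ?a \<otimes> E ?a \<otimes> E ?b"
    unfolding EE_comm[OF i(2,1)] T_T_inv[OF i(1)] using c by (simp only: m_assoc m_closed r_one)
  also have "\<dots> = E ?a \<otimes> E ?b" by (simp only: E_idem[OF i(1)])
  finally have *: "E ?a \<otimes> E ?b \<otimes> E_pair ?a ?c = E ?a \<otimes> E ?b" .
  note m = conj_word_mult[OF ws(1), symmetric]
  show "E_edge x y \<otimes> E_edge y z \<otimes> E_edge x z = E_edge x y \<otimes> E_edge y z"
    unfolding e using c by (simp only: m * m_closed)
  show "E_edge x y \<otimes> E_edge y z = E_edge y z \<otimes> E_edge x y"
    unfolding e using c EE_comm[OF i] by (simp only: m)
qed

text \<open>Two pairs are equal, share one point, or are disjoint.  The last two cases are transported to the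
commutation of \<open>E\<^sub>1\<close> with \<open>E\<^sub>2\<close> and of \<open>E\<^sub>1\<close> with \<open>E\<^sub>3\<close>.\<close>

lemma E_edge_comm:
  assumes xy: "x \<in> points" "y \<in> points" "x \<noteq> y" and zt: "z \<in> points" "t \<in> points" "z \<noteq> t"
  shows "E_edge x y \<otimes> E_edge z t = E_edge z t \<otimes> E_edge x y"
proof -
  have "x = z \<and> y = t \<or> x = t \<and> y = z \<or> x = z \<and> y \<noteq> t \<or> x = t \<and> y \<noteq> z \<or> y = z \<and> x \<noteq> t
      \<or> y = t \<and> x \<noteq> z \<or> x \<noteq> z \<and> x \<noteq> t \<and> y \<noteq> z \<and> y \<noteq> t"
    by blast
  then show ?thesis
  proof (elim disjE conjE)
    assume "x = z" "y = t"
    then show ?thesis by simp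
  next
    assume 2: "x = t" "y = z"
    show ?thesis unfolding 2 by (simp only: E_edge_sym[of t z])
  next
    assume 3: "x = z" "y \<noteq> t"
    show ?thesis
      using E_edge_triangle(2)[of y z t] assms 3(2) unfolding 3(1) by (simp only: E_edge_sym[of z y] simp_thms)
  next
    assume 4: "x = t" "y \<noteq> z"
    show ?thesis
      using E_edge_triangle(2)[of y t z] assms 4(2) unfolding 4(1)
      by (simp only: E_edge_sym[of t y] E_edge_sym[of z t] simp_thms)
  next
    assume 5: "y = z" "x \<noteq> t"
    show ?thesis
      using E_edge_triangle(2)[of x z t] assms 5(2) unfolding 5(1) by (simp only: simp_thms)
  next
    assume 6: "y = t" "x \<noteq> z"
    show ?thesis
      using E_edge_triangle(2)[of x t z] assms 6(2) unfolding 6(1) by (simp only: E_edge_sym[of z t] simp_thms)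
  next
    assume 7: "x \<noteq> z" "x \<noteq> t" "y \<noteq> z" "y \<noteq> t"
    have len: "length [x, y, z, t] \<le> n" using assms 7 by (intro length_le_points) auto
    let ?a = "Suc 0" and ?b = "Suc (Suc 0)" and ?c = "Suc (Suc (Suc 0))" and ?d = "Suc (Suc (Suc (Suc 0)))"
    have i: "?a \<in> {1..<n}" "?c \<in> {1..<n}" using len by auto
    obtain ws where ws: "set ws \<subseteq> {1..<n}" "\<And>i. i < length [x, y, z, t] \<Longrightarrow> word_perm ws (Suc i) = [x, y, z, t] ! i"
      by (rule E_edge_transport[of "[x, y, z, t]"]) (use assms len 7 in auto)
    have p: "word_perm ws ?a = x" "word_perm ws ?b = y" "word_perm ws ?c = z" "word_perm ws ?d = t"
      using ws(2)[of 0] ws(2)[of ?a] ws(2)[of ?b] ws(2)[of ?c] by simp_all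
    have e: "E_edge x y = conj_word ws (E ?a)" "E_edge z t = conj_word ws (E ?c)"
      using conj_word_E_edge[OF ws(1), of ?a ?b] conj_word_E_edge[OF ws(1), of ?c ?d] len
      by (simp_all add: p E_edge_less)
    show ?thesis
      unfolding e using E_closed[OF i(1)] E_closed[OF i(2)] EE_comm[OF i]
      by (simp only: conj_word_mult[OF ws(1), symmetric])
  qed
qed

end

section \<open>Products in a commutative submonoid\<close>

lemma foldSetD_mono:
  assumes "(A, x) \<in> foldSetD D f e" "D \<subseteq> D'"
  shows "(A, x) \<in> foldSetD D' f e"
  using assms(1) by (induction) (use assms(2) in \<open>auto intro: foldSetD.intros\<close>)

lemma foldSetD_restrict:
  assumes "(A, x) \<in> foldSetD D f e" "e \<in> D'" "\<And>a y. a \<in> A \<Longrightarrow> y \<in> D' \<Longrightarrow> f a y \<in> D'"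
  shows "(A, x) \<in> foldSetD D' f e"
  using assms
proof (induction)
  case emptyI
  show ?case using emptyI.prems(1) by (rule foldSetD.emptyI)
next
  case (insertI a A y)
  then have "(A, y) \<in> foldSetD D' f e" by blast
  moreover from this have "y \<in> D'" by (rule foldSetD_closed)
  ultimately show ?case using insertI by (intro foldSetD.insertI) auto
qed

text \<open>A \<open>finprod\<close> in the multiplicative monoid of a noncommutative ring obeys no useful laws in general.  Its
fold multiplies only values of the family, so it may be computed in any submonoid that contains
these; for commuting values the laws of commutative monoids become available.\<close>

lemma finprod_restrict_carrier:
  assumes "Q \<subseteq> carrier G" "\<one>\<^bsub>G\<^esub> \<in> Q" "\<And>x y. x \<in> Q \<Longrightarrow> y \<in> Q \<Longrightarrow> x \<otimes>\<^bsub>G\<^esub> y \<in> Q"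
    and f: "f \<in> A \<rightarrow> Q"
  shows "finprod G f A = finprod (G\<lparr>carrier := Q\<rparr>) f A"
proof -
  have "(A, x) \<in> foldSetD (carrier G) ((\<otimes>\<^bsub>G\<^esub>) \<circ> f) \<one>\<^bsub>G\<^esub> \<longleftrightarrow> (A, x) \<in> foldSetD Q ((\<otimes>\<^bsub>G\<^esub>) \<circ> f) \<one>\<^bsub>G\<^esub>" for x
    using foldSetD_mono[of A x Q _ _ "carrier G"] foldSetD_restrict[of A x "carrier G" "(\<otimes>\<^bsub>G\<^esub>) \<circ> f" "\<one>\<^bsub>G\<^esub>" Q] assms
    by (auto simp: Pi_iff)
  then show ?thesis by (simp add: finprod_def foldD_def)
qed

section \<open>Linear spans\<close>

context kalgebra begin

inductive_set lspan :: "'a set \<Rightarrow> 'a set" for G where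
  zero: "\<zero> \<in> lspan G"
| step: "x \<in> lspan G \<Longrightarrow> g \<in> G \<Longrightarrow> x \<oplus> sm k g \<in> lspan G"

lemma lspan_closed:
  assumes "G \<subseteq> carrier R" "x \<in> lspan G"
  shows "x \<in> carrier R"
  using assms(2) by induction (use assms(1) in auto)

lemma lspan_base:
  assumes "G \<subseteq> carrier R" "g \<in> G"
  shows "g \<in> lspan G"
proof -
  have "g \<in> carrier R" using assms by blast
  then show ?thesis using lspan.step[OF lspan.zero assms(2), of 1] by simp
qed

lemma lspan_add:
  assumes G: "G \<subseteq> carrier R" and x: "x \<in> lspan G" and y: "y \<in> lspan G"
  shows "x \<oplus> y \<in> lspan G"
  using y
proof (induction)
  case zero
  then show ?case using x lspan_closed[OF G x] by simp
next
  case (step y g k)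
  have "y \<in> carrier R" "g \<in> carrier R" "x \<in> carrier R"
    using lspan_closed[OF G] step x G by auto
  then have "x \<oplus> (y \<oplus> sm k g) = x \<oplus> y \<oplus> sm k g" by (simp add: a_assoc)
  then show ?case using step.IH step.hyps(2) by (simp only: lspan.step)
qed

lemma lspan_linear_image:
  assumes G: "G \<subseteq> carrier R" and G': "G' \<subseteq> carrier R" and x: "x \<in> lspan G"
    and h0: "h \<zero> = \<zero>"
    and h: "\<And>x g k. x \<in> carrier R \<Longrightarrow> g \<in> carrier R \<Longrightarrow> h (x \<oplus> sm k g) = h x \<oplus> sm k (h g)"
    and hG: "\<And>g. g \<in> G \<Longrightarrow> h g \<in> lspan G'"
  shows "h x \<in> lspan G'"
  using x
proof (induction)
  case zero
  then show ?case by (simp add: h0 lspan.zero)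
next
  case (step x g k)
  have sm: "sm k y \<in> lspan G'" if "y \<in> lspan G'" for y
    using that
  proof (induction)
    case (step y g' l)
    have "y \<in> carrier R" "g' \<in> carrier R" using lspan_closed[OF G'] step G' by auto
    then have "sm k (y \<oplus> sm l g') = sm k y \<oplus> sm (k * l) g'" by (simp add: sm_add_right sm_sm)
    then show ?case using step.IH step.hyps(2) by (simp only: lspan.step)
  qed (simp add: lspan.zero)
  have "x \<in> carrier R" "g \<in> carrier R" using lspan_closed[OF G] step G by auto
  then show ?case using lspan_add[OF G' step.IH sm[OF hG[OF step.hyps(2)]]] by (simp add: h)
qed

lemma lspan_smult:
  assumes G: "G \<subseteq> carrier R" and x: "x \<in> lspan G"
  shows "sm k x \<in> lspan G"
proof (rule lspan_linear_image[OF G G x, of "sm k"])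
  fix g assume g: "g \<in> G"
  then have "g \<in> carrier R" using G by blast
  then show "sm k g \<in> lspan G" using lspan.step[OF lspan.zero g, of k] by simp
qed (simp_all add: sm_add_right sm_sm mult.commute)

lemma lspan_mult_right:
  assumes "G \<subseteq> carrier R" "G' \<subseteq> carrier R" "x \<in> lspan G" "y \<in> carrier R"
    and "\<And>g. g \<in> G \<Longrightarrow> g \<otimes> y \<in> lspan G'"
  shows "x \<otimes> y \<in> lspan G'"
  by (rule lspan_linear_image[of G G' x "\<lambda>x. x \<otimes> y"]) (use assms in \<open>auto simp: l_distr sm_mult_left\<close>)

lemma lspan_mult_left:
  assumes "G \<subseteq> carrier R" "G' \<subseteq> carrier R" "x \<in> lspan G" "y \<in> carrier R"
    and "\<And>g. g \<in> G \<Longrightarrow> y \<otimes> g \<in> lspan G'"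
  shows "y \<otimes> x \<in> lspan G'"
  by (rule lspan_linear_image[of G G' x "\<lambda>x. y \<otimes> x"]) (use assms in \<open>auto simp: r_distr sm_mult_right\<close>)

lemma lspan_finsum:
  assumes "finite I" "g \<in> I \<rightarrow> carrier R" "x \<in> lspan (g ` I)"
  obtains c where "x = finsum R (\<lambda>i. sm (c i) (g i)) I"
proof -
  have "\<exists>c. x = finsum R (\<lambda>i. sm (c i) (g i)) I"
    using assms(3)
  proof (induction)
    case zero
    have "finsum R (\<lambda>i. sm 0 (g i)) I = \<zero>" using assms by (intro add.finprod_one_eqI) (auto simp: Pi_iff)
    then show ?case by (intro exI[of _ "\<lambda>_. 0"]) (rule sym)
  next
    case (step x y k)
    then obtain c i where c: "x = finsum R (\<lambda>i. sm (c i) (g i)) I" and i: "i \<in> I" "y = g i" by blast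
    have gi: "g i \<in> carrier R" using i assms by auto
    have "(\<lambda>_. sm k (g i)) \<in> I \<rightarrow> carrier R" using gi by simp
    from finsum_singleton[OF i(1) assms(1) this]
    have "sm k y = finsum R (\<lambda>j. if i = j then sm k (g i) else \<zero>) I"
      unfolding i(2) ..
    then have "x \<oplus> sm k y = finsum R (\<lambda>j. sm (c j) (g j) \<oplus> (if i = j then sm k (g i) else \<zero>)) I"
      unfolding c using assms gi by (subst finsum_addf) (auto simp: Pi_iff)
    also have "\<dots> = finsum R (\<lambda>j. sm ((c(i := c i + k)) j) (g j)) I"
      using assms gi by (intro finsum_cong') (auto simp: Pi_iff sm_add_left)
    finally show ?case by blast
  qed
  then show thesis using that by blast
qed

end

section \<open>The idempotents attached to set partitions\<close>

context bt_rels begin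

inductive_set edge_monoid :: "'a set" where
  one: "\<one> \<in> edge_monoid"
| step: "q \<in> edge_monoid \<Longrightarrow> x \<in> points \<Longrightarrow> y \<in> points \<Longrightarrow> x \<noteq> y \<Longrightarrow> q \<otimes> E_edge x y \<in> edge_monoid"

lemma edge_monoid_carrier: "q \<in> edge_monoid \<Longrightarrow> q \<in> carrier R"
  by (induction rule: edge_monoid.induct) (auto intro: E_edge_closed)

lemma edge_monoid_edge:
  assumes "x \<in> points" "y \<in> points" "x \<noteq> y"
  shows "E_edge x y \<in> edge_monoid"
  using edge_monoid.step[OF edge_monoid.one assms] E_edge_closed[OF assms] by simp

lemma edge_monoid_edge_comm:
  assumes "q \<in> edge_monoid" and xy: "x \<in> points" "y \<in> points" "x \<noteq> y"
  shows "q \<otimes> E_edge x y = E_edge x y \<otimes> q"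
  using assms(1)
proof (induction)
  case one
  then show ?case using E_edge_closed[OF xy] by simp
next
  case (step q z t)
  note c = edge_monoid_carrier[OF step.hyps(1)] E_edge_closed[OF xy] E_edge_closed[OF step.hyps(2-4)]
  have "q \<otimes> E_edge z t \<otimes> E_edge x y = q \<otimes> E_edge x y \<otimes> E_edge z t"
    using c E_edge_comm[OF xy step.hyps(2-4)] by (simp only: m_assoc)
  also have "\<dots> = E_edge x y \<otimes> (q \<otimes> E_edge z t)"
    unfolding step.IH using c by (simp only: m_assoc)
  finally show ?case .
qed

lemma edge_monoid_comm:
  assumes p: "p \<in> edge_monoid" and q: "q \<in> edge_monoid"
  shows "p \<otimes> q = q \<otimes> p"
  using q
proof (induction)
  case one
  then show ?case using edge_monoid_carrier[OF p] by simp
next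
  case (step q z t)
  note c = edge_monoid_carrier[OF step.hyps(1)] edge_monoid_carrier[OF p] E_edge_closed[OF step.hyps(2-4)]
  have "p \<otimes> (q \<otimes> E_edge z t) = q \<otimes> p \<otimes> E_edge z t"
    using c by (simp only: step.IH flip: m_assoc)
  also have "\<dots> = q \<otimes> E_edge z t \<otimes> p"
    using c edge_monoid_edge_comm[OF p step.hyps(2-4)] by (simp only: m_assoc)
  finally show ?case .
qed

lemma edge_monoid_mult:
  assumes p: "p \<in> edge_monoid" and q: "q \<in> edge_monoid"
  shows "p \<otimes> q \<in> edge_monoid"
  using q
proof (induction)
  case one
  then show ?case using p edge_monoid_carrier[OF p] by simp
next
  case (step q z t)
  note c = edge_monoid_carrier[OF step.hyps(1)] edge_monoid_carrier[OF p] E_edge_closed[OF step.hyps(2-4)]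
  have "p \<otimes> (q \<otimes> E_edge z t) = p \<otimes> q \<otimes> E_edge z t" using c by (simp only: m_assoc)
  then show ?case using edge_monoid.step[OF step.IH step.hyps(2-4)] by simp
qed

lemma edge_comm_monoid: "comm_monoid (R\<lparr>carrier := edge_monoid\<rparr>)"
  by (rule comm_monoidI)
    (auto simp: edge_monoid_mult edge_monoid.one m_assoc edge_monoid_carrier intro: edge_monoid_comm)

lemma finprod_edge_monoid:
  assumes "finite A" "f \<in> A \<rightarrow> edge_monoid"
  shows finprod_edge_closed: "finprod R f A \<in> edge_monoid"
    and finprod_edge_insert: "a \<notin> A \<Longrightarrow> f a \<in> edge_monoid \<Longrightarrow>
      finprod R f (insert a A) = f a \<otimes> finprod R f A"
proof -
  interpret M: comm_monoid "R\<lparr>carrier := edge_monoid\<rparr>" by (rule edge_comm_monoid)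
  have eq: "finprod R f B = finprod (R\<lparr>carrier := edge_monoid\<rparr>) f B" if "f \<in> B \<rightarrow> edge_monoid" for B
    using that by (intro finprod_restrict_carrier edge_monoid_mult edge_monoid.one subsetI edge_monoid_carrier)
  show "finprod R f A \<in> edge_monoid"
    using M.finprod_closed[of f A] assms by (simp add: eq)
  show "finprod R f (insert a A) = f a \<otimes> finprod R f A" if "a \<notin> A" "f a \<in> edge_monoid"
    using M.finprod_insert[OF assms(1) that(1), of f] assms that by (simp add: eq)
qed

lemma finprod_edge_empty [simp]: "finprod R f {} = \<one>"
  using finprod_restrict_carrier[of edge_monoid R f "{}"] comm_monoid.finprod_empty[OF edge_comm_monoid, of f]
  by (simp add: edge_monoid_mult edge_monoid.one subsetI edge_monoid_carrier)

lemma finprod_edge_induct: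
  assumes "finite A" "f \<in> A \<rightarrow> edge_monoid"
    and one: "P \<one>" and step: "\<And>a q. a \<in> A \<Longrightarrow> q \<in> edge_monoid \<Longrightarrow> P q \<Longrightarrow> P (f a \<otimes> q)"
  shows "P (finprod R f A)"
  using assms(1,2) step
proof (induction A rule: finite_induct)
  case empty
  then show ?case using one by simp
next
  case (insert a A)
  then show ?case
    using finprod_edge_closed[of A f] by (subst finprod_edge_insert) auto
qed

lemma finprod_edge_absorb:
  assumes "finite A" "f \<in> A \<rightarrow> edge_monoid" "z \<in> carrier R" "\<And>a. a \<in> A \<Longrightarrow> z \<otimes> f a = z"
  shows "z \<otimes> finprod R f A = z"
proof (rule finprod_edge_induct[OF assms(1,2)])
  fix a q assume a: "a \<in> A" "q \<in> edge_monoid" "z \<otimes> q = z"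
  then have "z \<otimes> (f a \<otimes> q) = z \<otimes> f a \<otimes> q"
    using assms(2,3) edge_monoid_carrier by (intro m_assoc[symmetric]) auto
  then show "z \<otimes> (f a \<otimes> q) = z" using a assms(4) by simp
qed (use assms(3) in simp)

text \<open>One absorbing factor suffices because all factors commute.\<close>

lemma finprod_edge_absorbs:
  assumes "finite A" "f \<in> A \<rightarrow> edge_monoid" "a \<in> A" "y \<in> edge_monoid" "f a \<otimes> y = f a"
  shows "finprod R f A \<otimes> y = finprod R f A"
proof -
  have fa: "f a \<in> edge_monoid" and f': "f \<in> A - {a} \<rightarrow> edge_monoid" using assms by auto
  let ?P = "finprod R f (A - {a})"
  have P: "?P \<in> edge_monoid" using assms(1) f' by (intro finprod_edge_closed) auto
  have "finprod R f (insert a (A - {a})) = f a \<otimes> ?P"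
    by (rule finprod_edge_insert) (use assms f' fa in auto)
  then have eq: "finprod R f A = f a \<otimes> ?P" using assms(3) by (simp add: insert_absorb)
  note c = edge_monoid_carrier[OF P] edge_monoid_carrier[OF fa] edge_monoid_carrier[OF assms(4)]
  have "f a \<otimes> ?P \<otimes> y = f a \<otimes> y \<otimes> ?P"
    using c edge_monoid_comm[OF P assms(4)] by (simp only: m_assoc)
  then show ?thesis unfolding eq assms(5) .
qed

definition E_block :: "nat set \<Rightarrow> 'a" where
  "E_block I = finprod R (\<lambda>(i, j). E_pair i j) {(i, j) \<in> I \<times> I. i < j}"

definition E_part :: "nat set set \<Rightarrow> 'a" where
  "E_part A = finprod R E_block A"

lemma block_pairs:
  assumes "I \<subseteq> points"
  shows "finite {(i, j) \<in> I \<times> I. i < j}"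
    and "(\<lambda>(i, j). E_pair i j) \<in> {(i, j) \<in> I \<times> I. i < j} \<rightarrow> edge_monoid"
proof -
  have "finite I" using assms finite_subset by blast
  then show "finite {(i, j) \<in> I \<times> I. i < j}" by (auto intro: finite_subset[of _ "I \<times> I"])
  have "E_pair i j \<in> edge_monoid" if "i \<in> I" "j \<in> I" "i < j" for i j
  proof -
    have "i \<in> points" "j \<in> points" "i \<noteq> j" using that assms by auto
    from edge_monoid_edge[OF this] show ?thesis by (simp add: E_edge_less that)
  qed
  then show "(\<lambda>(i, j). E_pair i j) \<in> {(i, j) \<in> I \<times> I. i < j} \<rightarrow> edge_monoid" by auto
qed

lemma E_block_edge_monoid: "I \<subseteq> points \<Longrightarrow> E_block I \<in> edge_monoid"
  unfolding E_block_def by (intro finprod_edge_closed block_pairs)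

lemma E_block_absorbs:
  assumes I: "I \<subseteq> points" and xy: "x \<in> I" "y \<in> I" "x \<noteq> y"
  shows "E_block I \<otimes> E_edge x y = E_block I"
proof -
  have less: "E_block I \<otimes> E_edge x y = E_block I" if "x \<in> I" "y \<in> I" "x < y" for x y
    unfolding E_block_def
  proof (rule finprod_edge_absorbs[OF block_pairs[OF I], of "(x, y)"])
    have xy: "x \<in> points" "y \<in> points" "x \<noteq> y" using that I by auto
    show "E_edge x y \<in> edge_monoid" by (rule edge_monoid_edge[OF xy])
    show "(case (x, y) of (i, j) \<Rightarrow> E_pair i j) \<otimes> E_edge x y = (case (x, y) of (i, j) \<Rightarrow> E_pair i j)"
      using E_edge_idem[OF xy] that by (simp add: E_edge_less)
  qed (use that in auto)
  show ?thesis
  proof (cases "x < y")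
    case False
    then show ?thesis using less[of y x] xy by (simp add: E_edge_sym[of x y])
  qed (use less xy in blast)
qed

lemma E_block_absorb:
  assumes "I \<subseteq> points" "z \<in> carrier R" "\<And>x y. x \<in> I \<Longrightarrow> y \<in> I \<Longrightarrow> x \<noteq> y \<Longrightarrow> z \<otimes> E_edge x y = z"
  shows "z \<otimes> E_block I = z"
  unfolding E_block_def
proof (rule finprod_edge_absorb[OF block_pairs[OF assms(1)] assms(2)])
  fix a assume "a \<in> {(i, j) \<in> I \<times> I. i < j}"
  then show "z \<otimes> (case a of (i, j) \<Rightarrow> E_pair i j) = z"
    using assms(3)[of "fst a" "snd a"] by (auto simp: E_edge_less)
qed

lemma partition_on_points:
  assumes "partition_on points A"
  shows "finite A" "E_block \<in> A \<rightarrow> edge_monoid" "\<And>I. I \<in> A \<Longrightarrow> I \<subseteq> points"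
proof -
  show sub: "\<And>I. I \<in> A \<Longrightarrow> I \<subseteq> points" using assms by (auto simp: partition_on_def)
  show "finite A" using assms finite_elements by blast
  show "E_block \<in> A \<rightarrow> edge_monoid" using sub E_block_edge_monoid by blast
qed

lemma E_part_edge_monoid: "partition_on points A \<Longrightarrow> E_part A \<in> edge_monoid"
  unfolding E_part_def by (intro finprod_edge_closed partition_on_points)

lemma E_part_absorbs:
  assumes A: "partition_on points A" and xy: "I \<in> A" "x \<in> I" "y \<in> I" "x \<noteq> y"
  shows "E_part A \<otimes> E_edge x y = E_part A"
  unfolding E_part_def
  by (rule finprod_edge_absorbs[OF partition_on_points(1,2)[OF A] xy(1)])
    (use partition_on_points(3)[OF A xy(1)] xy in \<open>auto intro!: edge_monoid_edge E_block_absorbs\<close>)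

lemma E_part_absorb:
  assumes A: "partition_on points A" and z: "z \<in> carrier R"
    and "\<And>I x y. I \<in> A \<Longrightarrow> x \<in> I \<Longrightarrow> y \<in> I \<Longrightarrow> x \<noteq> y \<Longrightarrow> z \<otimes> E_edge x y = z"
  shows "z \<otimes> E_part A = z"
  unfolding E_part_def
  by (rule finprod_edge_absorb[OF partition_on_points(1,2)[OF A] z], rule E_block_absorb)
    (use partition_on_points(3)[OF A] z assms(3) in auto)

lemma E_part_discrete:
  "E_part ((\<lambda>x. {x}) ` points) = \<one>"
proof -
  have A: "partition_on points ((\<lambda>x. {x}) ` points)"
    by (rule partition_onI) (auto simp: disjnt_def)
  have "\<one> \<otimes> E_part ((\<lambda>x. {x}) ` points) = \<one>"
    by (rule E_part_absorb[OF A]) auto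
  then show ?thesis using edge_monoid_carrier[OF E_part_edge_monoid[OF A]] by simp
qed

text \<open>Both sides absorb each other.  The product on the left absorbs \<open>E\<^sub>a\<^sub>b\<close> for \<open>a\<close> in the block of \<open>x\<close> and \<open>b\<close> in the
block of \<open>y\<close> by the triangle relation along \<open>a, x, y, b\<close>, hence absorbs \<open>E\<^sub>B\<close>; and \<open>E\<^sub>B\<close> absorbs
each of its factors.\<close>

lemma E_part_merge:
  assumes A: "partition_on points A" and I: "I \<in> A" "x \<in> I" and J: "J \<in> A" "y \<in> J" and xy: "x \<noteq> y"
  defines "B \<equiv> insert (I \<union> J) (A - {I, J})"
  shows "partition_on points B" "E_part A \<otimes> E_edge x y = E_part B"
proof -
  have disj: "\<And>K L. K \<in> A \<Longrightarrow> L \<in> A \<Longrightarrow> K \<noteq> L \<Longrightarrow> K \<inter> L = {}"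
    using A by (auto simp: partition_on_def disjoint_def)
  show B: "partition_on points B"
    unfolding partition_on_def
  proof (intro conjI)
    show "\<Union> B = points" using A I J by (auto simp: B_def partition_on_def)
    show "{} \<notin> B" using A I by (auto simp: B_def partition_on_def)
    show "disjoint B"
    proof (rule disjointI)
      fix p q assume "p \<in> B" "q \<in> B" "p \<noteq> q"
      then show "p \<inter> q = {}" using disj I J unfolding B_def by blast
    qed
  qed
  have pts: "x \<in> points" "y \<in> points"
    using partition_on_points(3)[OF A I(1)] partition_on_points(3)[OF A J(1)] I J by auto
  note xy' = pts xy
  define z where "z = E_part A \<otimes> E_edge x y"
  have zQ: "z \<in> edge_monoid"
    unfolding z_def by (intro edge_monoid.step E_part_edge_monoid A xy')
  have zc: "z \<in> carrier R" by (rule edge_monoid_carrier[OF zQ])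
  have Ac: "E_part A \<in> carrier R" by (rule edge_monoid_carrier[OF E_part_edge_monoid[OF A]])
  have Bc: "E_part B \<in> carrier R" by (rule edge_monoid_carrier[OF E_part_edge_monoid[OF B]])
  have absA: "z \<otimes> E_edge a b = z" if "K \<in> A" "a \<in> K" "b \<in> K" "a \<noteq> b" for K a b
  proof -
    have ab: "a \<in> points" "b \<in> points" "a \<noteq> b" using partition_on_points(3)[OF A that(1)] that by auto
    have "z \<otimes> E_edge a b = E_part A \<otimes> E_edge a b \<otimes> E_edge x y"
      unfolding z_def using Ac E_edge_closed[OF ab] E_edge_closed[OF xy'] E_edge_comm[OF xy' ab]
      by (simp only: m_assoc)
    then show ?thesis using E_part_absorbs[OF A that] by (simp add: z_def)
  qed
  have absxy: "z \<otimes> E_edge x y = z"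
    unfolding z_def using Ac E_edge_closed[OF xy'] E_edge_idem[OF xy'] by (simp only: m_assoc)
  \<comment> \<open>Absorption is transitive along paths: this is the triangle relation.\<close>
  have tri: "z \<otimes> E_edge a c = z"
    if "a = b \<or> z \<otimes> E_edge a b = z" "b = c \<or> z \<otimes> E_edge b c = z"
      "a \<in> points" "b \<in> points" "c \<in> points" "a \<noteq> c" for a b c
  proof (cases "a = b \<or> b = c")
    case False
    then have ab: "a \<noteq> b" "b \<noteq> c" "z \<otimes> E_edge a b = z" "z \<otimes> E_edge b c = z" using that by auto
    note c = zc E_edge_closed[OF that(3,4) ab(1)] E_edge_closed[OF that(4,5) ab(2)] E_edge_closed[OF that(3,5,6)]
    have "z \<otimes> (E_edge a b \<otimes> E_edge b c) = z" using c ab(3,4) by (simp flip: m_assoc)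
    moreover have "z \<otimes> (E_edge a b \<otimes> E_edge b c \<otimes> E_edge a c) = z \<otimes> (E_edge a b \<otimes> E_edge b c) \<otimes> E_edge a c"
      using c by (simp only: m_assoc m_closed)
    ultimately show ?thesis
      using E_edge_triangle(1)[OF that(3-5) ab(1,2) that(6)] by simp
  qed (use that in auto)
  have absIJ: "z \<otimes> E_edge a b = z" if "a \<in> I" "b \<in> J" "a \<noteq> b" for a b
  proof -
    have p: "a \<in> points" "b \<in> points"
      using that partition_on_points(3)[OF A I(1)] partition_on_points(3)[OF A J(1)] by auto
    have "a = y \<or> z \<otimes> E_edge a y = z"
    proof (cases "a = y")
      case False
      then show ?thesis
        using tri[of a x y] absA[OF I(1) that(1) I(2)] absxy p pts by auto
    qed simp
    moreover have "y = b \<or> z \<otimes> E_edge y b = z" using absA[OF J(1) J(2) that(2)] by auto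
    ultimately show ?thesis using tri[of a y b] p pts that(3) by auto
  qed
  have zB: "z \<otimes> E_part B = z"
  proof (rule E_part_absorb[OF B zc])
    fix K a b assume K: "K \<in> B" "a \<in> K" "b \<in> K" "a \<noteq> b"
    show "z \<otimes> E_edge a b = z"
    proof (cases "K \<in> A")
      case True
      then show ?thesis using absA K by blast
    next
      case False
      then have "a \<in> I \<union> J" "b \<in> I \<union> J" using K by (auto simp: B_def)
      then consider "a \<in> I" "b \<in> I" | "a \<in> J" "b \<in> J" | "a \<in> I" "b \<in> J" | "a \<in> J" "b \<in> I" by blast
      then show ?thesis
      proof cases
        case 1 then show ?thesis using absA[OF I(1)] K(4) by blast
      next
        case 2 then show ?thesis using absA[OF J(1)] K(4) by blast
      next
        case 3 then show ?thesis using absIJ K(4) by blast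
      next
        case 4 then show ?thesis using absIJ[of b a] K(4) E_edge_sym[of a b] by simp
      qed
    qed
  qed
  have BA: "E_part B \<otimes> E_part A = E_part B"
  proof (rule E_part_absorb[OF A Bc])
    fix K a b assume K: "K \<in> A" "a \<in> K" "b \<in> K" "a \<noteq> b"
    then obtain L where "L \<in> B" "K \<subseteq> L" unfolding B_def by blast
    then show "E_part B \<otimes> E_edge a b = E_part B" using E_part_absorbs[OF B, of L a b] K by blast
  qed
  have Bxy: "E_part B \<otimes> E_edge x y = E_part B"
    by (rule E_part_absorbs[OF B, of "I \<union> J"]) (use I J xy in \<open>auto simp: B_def\<close>)
  have "E_part B \<otimes> z = E_part B"
    unfolding z_def using Bc Ac E_edge_closed[OF xy'] BA Bxy by (simp flip: m_assoc)
  then show "E_part A \<otimes> E_edge x y = E_part B"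
    using zB edge_monoid_comm[OF zQ E_part_edge_monoid[OF B]] by (simp add: z_def)
qed

lemma edge_monoid_E_part:
  assumes "q \<in> edge_monoid"
  shows "\<exists>A. partition_on points A \<and> q = E_part A"
  using assms
proof (induction)
  case one
  have "partition_on points ((\<lambda>x. {x}) ` points)"
    by (rule partition_onI) (auto simp: disjnt_def)
  then show ?case using E_part_discrete[symmetric] by blast
next
  case (step q x y)
  then obtain A where A: "partition_on points A" "q = E_part A" by blast
  then obtain I J where "I \<in> A" "x \<in> I" "J \<in> A" "y \<in> J"
    using step.hyps(2,3) unfolding partition_on_def by blast
  from E_part_merge[OF A(1) this step.hyps(4)] show ?case unfolding A(2) by blast
qed

section \<open>Normal forms span\<close>

definition nf_set :: "nat \<Rightarrow> 'a set" where
  "nf_set m = {q \<otimes> T_word v | q v. q \<in> edge_monoid \<and> v \<in> nf_words m}"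

lemma nf_letters: "m < n \<Longrightarrow> v \<in> nf_words m \<Longrightarrow> set v \<subseteq> {1..<n}"
  using nf_words_letters[of v m] by fastforce

lemma nf_set_carrier: "m < n \<Longrightarrow> nf_set m \<subseteq> carrier R"
  unfolding nf_set_def
  by (clarify, intro m_closed edge_monoid_carrier T_word_closed nf_letters; assumption)

lemma nf_setI: "q \<in> edge_monoid \<Longrightarrow> v \<in> nf_words m \<Longrightarrow> q \<otimes> T_word v \<in> nf_set m"
  unfolding nf_set_def by blast

lemma lspan_nf_left:
  assumes m: "m < n" and q: "q \<in> edge_monoid" and x: "x \<in> lspan (nf_set m)"
  shows "q \<otimes> x \<in> lspan (nf_set m)"
proof (rule lspan_mult_left[OF nf_set_carrier[OF m] nf_set_carrier[OF m] x edge_monoid_carrier[OF q]])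
  fix g assume "g \<in> nf_set m"
  then obtain p v where g: "p \<in> edge_monoid" "v \<in> nf_words m" "g = p \<otimes> T_word v" by (auto simp: nf_set_def)
  have "q \<otimes> g = q \<otimes> p \<otimes> T_word v"
    using edge_monoid_carrier[OF q] edge_monoid_carrier[OF g(1)] T_word_closed[OF nf_letters[OF m g(2)]]
    by (simp add: g(3) m_assoc)
  then show "q \<otimes> g \<in> lspan (nf_set m)"
    using lspan_base[OF nf_set_carrier[OF m] nf_setI[OF edge_monoid_mult[OF q g(1)] g(2)]] by simp
qed

lemma lspan_nf_edge:
  assumes m: "m < n" and xy: "x \<in> points" "y \<in> points" "x \<noteq> y" and a: "a \<in> lspan (nf_set m)"
  shows "a \<otimes> E_edge x y \<in> lspan (nf_set m)"
proof (rule lspan_mult_right[OF nf_set_carrier[OF m] nf_set_carrier[OF m] a E_edge_closed[OF xy]])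
  fix g assume "g \<in> nf_set m"
  then obtain p v where g: "p \<in> edge_monoid" "v \<in> nf_words m" "g = p \<otimes> T_word v" by (auto simp: nf_set_def)
  have v: "set v \<subseteq> {1..<n}" by (rule nf_letters[OF m g(2)])
  have w: "word_perm v permutes points" by (rule word_perm_permutes[OF v])
  have xy': "word_perm v x \<in> points" "word_perm v y \<in> points" "word_perm v x \<noteq> word_perm v y"
    using permutes_in_image[OF w] permutes_inj[OF w] xy by (auto dest: injD)
  have "g \<otimes> E_edge x y = p \<otimes> E_edge (word_perm v x) (word_perm v y) \<otimes> T_word v"
    using edge_monoid_carrier[OF g(1)] T_word_closed[OF v] E_edge_closed[OF xy] E_edge_closed[OF xy']
      T_word_E_edge[OF v xy] by (simp only: g(3) m_assoc)
  then show "g \<otimes> E_edge x y \<in> lspan (nf_set m)"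
    using lspan_base[OF nf_set_carrier[OF m] nf_setI[OF edge_monoid.step[OF g(1) xy'] g(2)]] by simp
qed

lemma nf_words_SucI: "v \<in> nf_words m \<Longrightarrow> k \<in> {1..m + 2} \<Longrightarrow> v @ rev [k..<m + 2] \<in> nf_words (Suc m)"
  unfolding nf_words.simps by (rule image_eqI[where x = "(v, k)"]) auto

lemma lspan_nf_Suc:
  assumes m: "Suc m < n" and k: "k \<in> {1..m + 2}" and x: "x \<in> lspan (nf_set m)"
  shows "x \<otimes> T_word (rev [k..<m + 2]) \<in> lspan (nf_set (Suc m))"
proof -
  have m': "m < n" using m by simp
  have r: "set (rev [k..<m + 2]) \<subseteq> {1..<n}" using k m by auto
  show ?thesis
  proof (rule lspan_mult_right[OF nf_set_carrier[OF m'] nf_set_carrier[OF m] x T_word_closed[OF r]])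
    fix g assume "g \<in> nf_set m"
    then obtain p v where g: "p \<in> edge_monoid" "v \<in> nf_words m" "g = p \<otimes> T_word v" by (auto simp: nf_set_def)
    have v: "set v \<subseteq> {1..<n}" by (rule nf_letters[OF m' g(2)])
    have "g \<otimes> T_word (rev [k..<m + 2]) = p \<otimes> T_word (v @ rev [k..<m + 2])"
      unfolding T_word_append[OF v r] g(3)
      using edge_monoid_carrier[OF g(1)] T_word_closed[OF v] T_word_closed[OF r] by (simp only: m_assoc)
    then show "g \<otimes> T_word (rev [k..<m + 2]) \<in> lspan (nf_set (Suc m))"
      using lspan_base[OF nf_set_carrier[OF m] nf_setI[OF g(1) nf_words_SucI[OF g(2) k]]] by simp
  qed
qed

text \<open>By the braid relation at \<open>i - 1, i\<close>, and by commutation elsewhere, \<open>T\<^sub>i\<close> passes through a descending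
run that contains \<open>i\<close> and \<open>i - 1\<close>, with its index lowered by one.\<close>

lemma descending_shift:
  assumes m: "Suc m < n" and k: "1 \<le> k" "k < i" "i \<le> Suc m"
  shows "T_word (rev [k..<m + 2]) \<otimes> T i = T (i - 1) \<otimes> T_word (rev [k..<m + 2])"
proof -
  define j where "j = i - 1"
  have ij: "i = Suc j" using k by (simp add: j_def)
  have split: "rev [k..<m + 2] = rev [Suc i..<m + 2] @ [i, j] @ rev [k..<j]"
  proof -
    have "[k..<m + 2] = [k..<j] @ [j..<m + 2]"
      using upt_add_eq_append[of k j "m + 2 - j"] k by (simp add: j_def)
    also have "[j..<m + 2] = j # i # [Suc i..<m + 2]" using k ij by (simp add: upt_conv_Cons)
    finally show ?thesis by simp
  qed
  have i: "i \<in> {1..<n}" and j: "j \<in> {1..<n}" using k m ij by auto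
  have up: "set (rev [Suc i..<m + 2]) \<subseteq> {1..<n}" and lo: "set (rev [k..<j]) \<subseteq> {1..<n}"
    using k m ij by auto
  define U where "U = T_word (rev [Suc i..<m + 2])"
  define L where "L = T_word (rev [k..<j])"
  have c: "U \<in> carrier R" "L \<in> carrier R" "T i \<in> carrier R" "T j \<in> carrier R"
    using T_word_closed[OF up] T_word_closed[OF lo] T_closed[OF i] T_closed[OF j] by (simp_all only: U_def L_def)
  have D: "T_word (rev [k..<m + 2]) = U \<otimes> (T i \<otimes> (T j \<otimes> L))"
  proof -
    have "set ([i, j] @ rev [k..<j]) \<subseteq> {1..<n}" using lo i j by auto
    then show ?thesis
      unfolding split T_word_append[OF up \<open>set ([i, j] @ rev [k..<j]) \<subseteq> {1..<n}\<close>]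
      by (simp add: T_word_Cons U_def L_def)
  qed
  have Li: "L \<otimes> T i = T i \<otimes> L"
    unfolding L_def
  proof (rule T_word_commute[OF lo c(3)])
    fix l assume "l \<in> set (rev [k..<j])"
    then show "T l \<otimes> T i = T i \<otimes> T l" using TT_far[of l i] i k m ij by auto
  qed
  have Uj: "U \<otimes> T j = T j \<otimes> U"
    unfolding U_def
  proof (rule T_word_commute[OF up c(4)])
    fix l assume "l \<in> set (rev [Suc i..<m + 2])"
    then show "T l \<otimes> T j = T j \<otimes> T l" using TT_far[of l j] j k m ij by auto
  qed
  have br: "T i \<otimes> T j \<otimes> T i = T j \<otimes> T i \<otimes> T j"
    using ij by (intro braid i j) auto
  have "U \<otimes> (T i \<otimes> (T j \<otimes> L)) \<otimes> T i = U \<otimes> (T i \<otimes> (T j \<otimes> (L \<otimes> T i)))"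
    using c by (simp only: m_assoc m_closed)
  also have "\<dots> = U \<otimes> ((T i \<otimes> T j \<otimes> T i) \<otimes> L)"
    unfolding Li using c by (simp only: m_assoc m_closed)
  also have "\<dots> = (U \<otimes> T j) \<otimes> (T i \<otimes> (T j \<otimes> L))"
    unfolding br using c by (simp only: m_assoc m_closed)
  also have "\<dots> = T j \<otimes> (U \<otimes> (T i \<otimes> (T j \<otimes> L)))"
    unfolding Uj using c by (simp only: m_assoc m_closed)
  finally show ?thesis unfolding D j_def .
qed

text \<open>Let \<open>k\<close> be the end of the last descending run.  For \<open>i < k - 1\<close> or \<open>i > k\<close> the factor \<open>T\<^sub>i\<close> passes through the
run, becoming a generator to which the induction hypothesis applies.  For \<open>i = k - 1\<close> it extends the
run.  For \<open>i = k\<close> the run ends in \<open>T\<^sub>i\<close>, and the quadratic relation applies; the idempotent that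
appears is moved to the left of the word.\<close>

lemma T_word_nf_mult_T:
  assumes "m < n" "v \<in> nf_words m" "i \<in> {1..m}"
  shows "T_word v \<otimes> T i \<in> lspan (nf_set m)"
  using assms
proof (induction m arbitrary: v i)
  case (Suc m)
  have m: "Suc m < n" and m': "m < n" using Suc.prems by auto
  obtain v' k where v: "v = v' @ rev [k..<m + 2]" "v' \<in> nf_words m" "k \<in> {1..m + 2}"
    using Suc.prems(2) unfolding nf_words.simps by auto
  have i: "i \<in> {1..<n}" using Suc.prems by auto
  have v': "set v' \<subseteq> {1..<n}" by (rule nf_letters[OF m' v(2)])
  define D where "D = (\<lambda>k. T_word (rev [k..<m + 2]))"
  have Dset: "set (rev [l..<m + 2]) \<subseteq> {1..<n}" if "1 \<le> l" for l using that m by auto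
  have Dc: "D l \<in> carrier R" if "1 \<le> l" for l unfolding D_def by (rule T_word_closed[OF Dset[OF that]])
  have Tv: "T_word v = T_word v' \<otimes> D k"
    unfolding v(1) D_def by (rule T_word_append[OF v' Dset]) (use v(3) in simp)
  note c = T_word_closed[OF v'] Dc[of k] Dc[of "Suc k"] T_closed[OF i]
  have base: "T_word v' \<otimes> D l \<in> lspan (nf_set (Suc m))" if "l \<in> {1..m + 2}" for l
  proof -
    have "\<one> \<otimes> T_word v' \<in> lspan (nf_set m)"
      by (rule lspan_base[OF nf_set_carrier[OF m'] nf_setI[OF edge_monoid.one v(2)]])
    then show ?thesis
      using lspan_nf_Suc[OF m that, of "T_word v'"] c(1) by (simp add: D_def)
  qed
  have Drec: "D l = D (Suc l) \<otimes> T l" if "1 \<le> l" "l \<le> Suc m" for l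
  proof -
    have l: "l \<in> {1..<n}" using that m by auto
    have "rev [l..<m + 2] = rev [Suc l..<m + 2] @ [l]" using that by (simp add: upt_conv_Cons)
    then show ?thesis
      unfolding D_def using T_word_append[OF Dset[of "Suc l"], of "[l]"] l by (simp add: T_word_single)
  qed
  have left: "T_word v' \<otimes> (T j \<otimes> D k) \<in> lspan (nf_set (Suc m))" if "j \<in> {1..m}" for j
  proof -
    have "T j \<in> carrier R" using that m' by (intro T_closed) auto
    then have "T_word v' \<otimes> (T j \<otimes> D k) = T_word v' \<otimes> T j \<otimes> D k" using c v(3) by (simp add: m_assoc)
    then show ?thesis
      using lspan_nf_Suc[OF m v(3) Suc.IH[OF m' v(2) that]] by (simp add: D_def)
  qed
  consider "Suc i < k" | "k = Suc i" | "k = i" | "k < i" by linarith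
  then show ?case
  proof cases
    case 1
    have "D k \<otimes> T i = T i \<otimes> D k"
      unfolding D_def
    proof (rule T_word_commute[OF Dset c(4)])
      fix l assume "l \<in> set (rev [k..<m + 2])"
      then show "T l \<otimes> T i = T i \<otimes> T l" using TT_far[of l i] i 1 m by auto
    qed (use v(3) in simp)
    then have "T_word v \<otimes> T i = T_word v' \<otimes> (T i \<otimes> D k)"
      using c v(3) by (simp add: Tv m_assoc)
    then show ?thesis using left[of i] Suc.prems(3) 1 v(3) by simp
  next
    case 2
    have "T_word v \<otimes> T i = T_word v' \<otimes> D i"
      using c v(3) Drec[of i] 2 Suc.prems(3) by (simp add: Tv m_assoc)
    then show ?thesis using base[of i] Suc.prems(3) by simp
  next
    case 3
    have ii: "i \<in> points" "Suc i \<in> points" "i \<noteq> Suc i" using i by auto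
    have e: "E i = E_edge i (Suc i)" by (simp add: E_edge_less)
    have Ec: "E i \<in> carrier R" by (rule E_closed[OF i])
    have k1: "Suc k \<in> {1..m + 2}" using 3 Suc.prems(3) by auto
    define X where "X = T_word v' \<otimes> D (Suc k)"
    have Xc: "X \<in> carrier R" using c v(3) by (simp add: X_def)
    have X: "X \<in> lspan (nf_set (Suc m))" unfolding X_def by (rule base[OF k1])
    have XT: "X \<otimes> T i = T_word v"
      using c v(3) Drec[of i] 3 Suc.prems(3) by (simp add: Tv X_def m_assoc)
    have XT': "X \<otimes> T i \<in> lspan (nf_set (Suc m))"
      using base[OF v(3)] by (simp add: XT Tv)
    note S = nf_set_carrier[OF m]
    have "T_word v \<otimes> T i = X \<otimes> (T i \<otimes> T i)"
      using Xc c by (simp add: m_assoc flip: XT)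
    also have "\<dots> = X \<oplus> sm (u - 1) (X \<otimes> (E i \<otimes> (\<one> \<oplus> T i)))"
      unfolding quad[OF i] using Xc c Ec by (simp add: r_distr sm_mult_right)
    also have "E i \<otimes> (\<one> \<oplus> T i) = (\<one> \<oplus> T i) \<otimes> E i"
      using c Ec ET_comm[OF i] by (simp add: r_distr l_distr)
    also have "X \<otimes> ((\<one> \<oplus> T i) \<otimes> E i) = (X \<oplus> X \<otimes> T i) \<otimes> E_edge i (Suc i)"
      using Xc c Ec by (simp add: e[symmetric] r_distr l_distr m_assoc)
    finally show ?thesis
      using lspan_add[OF S X lspan_smult[OF S lspan_nf_edge[OF m ii lspan_add[OF S X XT']], of "u - 1"]] by simp
  next
    case 4
    have "D k \<otimes> T i = T (i - 1) \<otimes> D k"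
      unfolding D_def by (rule descending_shift[OF m]) (use 4 v(3) Suc.prems(3) in auto)
    then have "T_word v \<otimes> T i = T_word v' \<otimes> (T (i - 1) \<otimes> D k)"
      using c v(3) by (simp add: Tv m_assoc)
    moreover have "i - 1 \<in> {1..m}" using 4 v(3) Suc.prems(3) by auto
    ultimately show ?thesis using left[of "i - 1"] by simp
  qed
qed simp

text \<open>With closure under the \<open>E\<^sub>i\<close>, this shows that the normal forms span.  No comparison of different reduced
words for the same permutation is involved.\<close>

lemma lspan_nf_T:
  assumes m: "m < n" and i: "i \<in> {1..m}" and a: "a \<in> lspan (nf_set m)"
  shows "a \<otimes> T i \<in> lspan (nf_set m)"
proof -
  have i': "i \<in> {1..<n}" using i m by auto
  show ?thesis
  proof (rule lspan_mult_right[OF nf_set_carrier[OF m] nf_set_carrier[OF m] a T_closed[OF i']])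
    fix g assume "g \<in> nf_set m"
    then obtain p v where g: "p \<in> edge_monoid" "v \<in> nf_words m" "g = p \<otimes> T_word v" by (auto simp: nf_set_def)
    have "g \<otimes> T i = p \<otimes> (T_word v \<otimes> T i)"
      using edge_monoid_carrier[OF g(1)] T_word_closed[OF nf_letters[OF m g(2)]] T_closed[OF i']
      by (simp only: g(3) m_assoc)
    then show "g \<otimes> T i \<in> lspan (nf_set m)"
      using lspan_nf_left[OF m g(1) T_word_nf_mult_T[OF m g(2) i]] by simp
  qed
qed

end

section \<open>The algebra over the rational functions\<close>

lemma free_gen_laurent:
  "i \<in> {1..<n} \<Longrightarrow> fT i \<in> carrier (bt_free_algebra n)"
  "i \<in> {1..<n} \<Longrightarrow> fE i \<in> carrier (bt_free_algebra n)"
  unfolding free_gen_def bt_free_algebra_def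
  by (intro laurent.free_carrier_single laurent.one; simp)+

lemma free_const_laurent: "a \<in> laurent \<Longrightarrow> free_const a \<in> carrier (bt_free_algebra n)"
  unfolding free_const_def bt_free_algebra_def
  by (intro laurent.free_carrier_single) (simp_all add: zero_fword_def)

lemmas bt_free_algebra_simps = free_algebra_simps(2-)[where A = laurent and
    X = "LetT ` {1..<n} \<union> LetE ` {1..<n}" for n, folded bt_free_algebra_def]

interpretation FA: ring "bt_free_algebra n" for n
  unfolding bt_free_algebra_def by (rule laurent.ring_free_algebra)

lemma bt_free_algebra_minus:
  "p \<in> carrier (bt_free_algebra n) \<Longrightarrow> q \<in> carrier (bt_free_algebra n) \<Longrightarrow>
   p \<ominus>\<^bsub>bt_free_algebra n\<^esub> q = p - q"
  unfolding bt_free_algebra_def by (rule laurent.free_algebra_minus)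

lemma bt_free_algebra_closed:
  "p \<in> carrier (bt_free_algebra n) \<Longrightarrow> q \<in> carrier (bt_free_algebra n) \<Longrightarrow> p * q \<in> carrier (bt_free_algebra n)"
  "p \<in> carrier (bt_free_algebra n) \<Longrightarrow> q \<in> carrier (bt_free_algebra n) \<Longrightarrow> p + q \<in> carrier (bt_free_algebra n)"
  "p \<in> carrier (bt_free_algebra n) \<Longrightarrow> q \<in> carrier (bt_free_algebra n) \<Longrightarrow> p - q \<in> carrier (bt_free_algebra n)"
  "1 \<in> carrier (bt_free_algebra n)"
  "p \<in> carrier (bt_free_algebra n) \<Longrightarrow> p ^ k \<in> carrier (bt_free_algebra n)"
proof -
  show m: "p * q \<in> carrier (bt_free_algebra n)"
    if "p \<in> carrier (bt_free_algebra n)" "q \<in> carrier (bt_free_algebra n)" for p q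
    using FA.m_closed[OF that] by (simp add: bt_free_algebra_simps)
  show "p + q \<in> carrier (bt_free_algebra n)"
    if "p \<in> carrier (bt_free_algebra n)" "q \<in> carrier (bt_free_algebra n)" for p q
    using FA.a_closed[OF that] by (simp add: bt_free_algebra_simps)
  show "p - q \<in> carrier (bt_free_algebra n)"
    if "p \<in> carrier (bt_free_algebra n)" "q \<in> carrier (bt_free_algebra n)" for p q
    using FA.minus_closed[OF that] by (simp add: bt_free_algebra_minus that)
  show o: "1 \<in> carrier (bt_free_algebra n)"
    using FA.one_closed[of n] by (simp add: bt_free_algebra_simps)
  show "p ^ k \<in> carrier (bt_free_algebra n)" if "p \<in> carrier (bt_free_algebra n)" for p k
    by (induction k) (auto intro: m o that)
qed

lemma bt_relations_subset: "bt_relations n \<subseteq> carrier (bt_free_algebra n)"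
proof
  fix x assume "x \<in> bt_relations n"
  then show "x \<in> carrier (bt_free_algebra n)"
    unfolding bt_relations_def
    by (elim UnE CollectE exE conjE; hypsubst)
      (intro bt_free_algebra_closed free_gen_laurent free_const_laurent laurent_u; assumption)+
qed

lemma bt_ideal_ideal: "ideal (bt_ideal n) (bt_free_algebra n)"
  unfolding bt_ideal_def by (rule FA.genideal_ideal) (rule bt_relations_subset)

lemma bt_class_hom: "bt_class n \<in> ring_hom (bt_free_algebra n) (bt_laurent_algebra n)"
  unfolding bt_class_def[abs_def] bt_laurent_algebra_def by (rule ideal.rcos_ring_hom[OF bt_ideal_ideal])

interpretation LA: ring "bt_laurent_algebra n" for n
  unfolding bt_laurent_algebra_def by (rule ideal.quotient_is_ring[OF bt_ideal_ideal])

lemma bt_class_surj: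
  assumes "x \<in> carrier (bt_laurent_algebra n)"
  obtains p where "p \<in> carrier (bt_free_algebra n)" "x = bt_class n p"
  using assms unfolding bt_laurent_algebra_def bt_class_def
  by (auto simp: FactRing_def A_RCOSETS_def')

interpretation BT: base_change_setup "bt_laurent_algebra n" laurent "bt_laurent_smult n"
  rewrites BT_fold: "base_change (bt_laurent_algebra n) laurent (bt_laurent_smult n) = bt_algebra n"
    and "pure_tensor (bt_laurent_algebra n) laurent (bt_laurent_smult n) = bt_pure n"
  for n
proof -
  show "base_change_setup (bt_laurent_algebra n) laurent (bt_laurent_smult n)"
  proof (intro base_change_setup.intro base_change_setup_axioms.intro LA.ring_axioms)
    fix a x assume "a \<in> laurent" "x \<in> carrier (bt_laurent_algebra n)"
    then show "bt_laurent_smult n a x \<in> carrier (bt_laurent_algebra n)"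
      unfolding bt_laurent_smult_def
      by (intro LA.m_closed ring_hom_closed[OF bt_class_hom] free_const_laurent)
  qed
qed (simp_all add: bt_algebra_def bt_pure_def)

lemma bt_pure_one_comm:
  assumes "x \<in> carrier (bt_algebra n)"
  shows "bt_pure n \<one>\<^bsub>bt_laurent_algebra n\<^esub> k \<otimes>\<^bsub>bt_algebra n\<^esub> x
    = x \<otimes>\<^bsub>bt_algebra n\<^esub> bt_pure n \<one>\<^bsub>bt_laurent_algebra n\<^esub> k"
  using assms
  by (induction x rule: BT.BC_induct) (simp_all add: BT.pt_mult mult.commute BT.BC.l_distr BT.BC.r_distr)

interpretation BTA: kalgebra "bt_algebra n" "bt_smult n" for n
proof (intro kalgebra.intro kalgebra_axioms.intro BT.BC.ring_axioms)
  fix x y k l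
  assume x: "x \<in> carrier (bt_algebra n)" 
  show "bt_smult n k x \<in> carrier (bt_algebra n)" "bt_smult n 1 x = x"
    "bt_smult n (k + l) x = bt_smult n k x \<oplus>\<^bsub>bt_algebra n\<^esub> bt_smult n l x"
    "bt_smult n k (bt_smult n l x) = bt_smult n (k * l) x"
    using x by (simp_all add: bt_smult_def BT.pt_one BT.pt_add_right BT.BC.l_distr BT.pt_mult
        flip: BT.BC.m_assoc)
  assume y: "y \<in> carrier (bt_algebra n)"
  show "bt_smult n k (x \<oplus>\<^bsub>bt_algebra n\<^esub> y) = bt_smult n k x \<oplus>\<^bsub>bt_algebra n\<^esub> bt_smult n k y"
    "bt_smult n k x \<otimes>\<^bsub>bt_algebra n\<^esub> y = bt_smult n k (x \<otimes>\<^bsub>bt_algebra n\<^esub> y)"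
    using x y by (simp_all add: bt_smult_def BT.BC.r_distr BT.BC.m_assoc)
  show "x \<otimes>\<^bsub>bt_algebra n\<^esub> bt_smult n k y = bt_smult n k (x \<otimes>\<^bsub>bt_algebra n\<^esub> y)"
    using x y bt_pure_one_comm[OF x, of k]
    by (simp add: bt_smult_def flip: BT.BC.m_assoc)
qed

definition bt_elt :: "nat \<Rightarrow> bt_free \<Rightarrow> bt" where
  "bt_elt n p = bt_pure n (bt_class n p) 1"

lemma bt_elt_hom: "bt_elt n \<in> ring_hom (bt_free_algebra n) (bt_algebra n)"
proof (rule ring_hom_memI)
  note cl = ring_hom_closed[OF bt_class_hom, of _ n]
  fix p q assume p: "p \<in> carrier (bt_free_algebra n)"
  show "bt_elt n p \<in> carrier (bt_algebra n)"
    using p by (simp add: bt_elt_def cl)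
  assume q: "q \<in> carrier (bt_free_algebra n)"
  show "bt_elt n (p \<otimes>\<^bsub>bt_free_algebra n\<^esub> q) = bt_elt n p \<otimes>\<^bsub>bt_algebra n\<^esub> bt_elt n q"
    using p q by (simp add: bt_elt_def cl BT.pt_mult ring_hom_mult[OF bt_class_hom])
  show "bt_elt n (p \<oplus>\<^bsub>bt_free_algebra n\<^esub> q) = bt_elt n p \<oplus>\<^bsub>bt_algebra n\<^esub> bt_elt n q"
    using p q by (simp add: bt_elt_def cl BT.pt_add_left ring_hom_add[OF bt_class_hom])
qed (simp add: bt_elt_def ring_hom_one[OF bt_class_hom] BT.pt_one)

lemma bt_elt_closed: "p \<in> carrier (bt_free_algebra n) \<Longrightarrow> bt_elt n p \<in> carrier (bt_algebra n)"
  by (rule ring_hom_closed[OF bt_elt_hom])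

lemma bt_elt_simps:
  assumes "p \<in> carrier (bt_free_algebra n)" "q \<in> carrier (bt_free_algebra n)"
  shows "bt_elt n (p * q) = bt_elt n p \<otimes>\<^bsub>bt_algebra n\<^esub> bt_elt n q"
    "bt_elt n (p + q) = bt_elt n p \<oplus>\<^bsub>bt_algebra n\<^esub> bt_elt n q"
  using ring_hom_mult[OF bt_elt_hom assms] ring_hom_add[OF bt_elt_hom assms] by (simp_all add: bt_free_algebra_simps)

lemma bt_elt_one: "bt_elt n 1 = \<one>\<^bsub>bt_algebra n\<^esub>"
  using ring_hom_one[OF bt_elt_hom, of n] by (simp add: bt_free_algebra_simps)

lemma bt_pure_eq_smult:
  "x \<in> carrier (bt_laurent_algebra n) \<Longrightarrow> bt_pure n x k = bt_smult n k (bt_pure n x 1)"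
  by (simp add: bt_smult_def BT.pt_mult)

lemma bt_elt_const: "a \<in> laurent \<Longrightarrow> bt_elt n (free_const a) = bt_smult n a \<one>\<^bsub>bt_algebra n\<^esub>"
proof -
  assume a: "a \<in> laurent"
  have "bt_class n (free_const a) = bt_laurent_smult n a \<one>\<^bsub>bt_laurent_algebra n\<^esub>"
    using ring_hom_closed[OF bt_class_hom free_const_laurent[OF a]] by (simp add: bt_laurent_smult_def)
  then show ?thesis
    using a by (simp add: bt_elt_def BT.pt_sA) (simp add: bt_smult_def BT.pt_one[symmetric] BT.pt_mult)
qed

lemma bt_elt_TE: "bt_elt n (fT i) = bt_T n i" "bt_elt n (fE i) = bt_E n i"
  by (simp_all add: bt_elt_def bt_T_def bt_E_def)

text \<open>The algebra is spanned by the words in the generators: a pure tensor is a scalar multiple of the class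
of an element of the free algebra.\<close>

lemma bt_algebra_induct [consumes 1, case_names one T E add smult]:
  assumes x: "x \<in> carrier (bt_algebra n)"
    and one: "P \<one>\<^bsub>bt_algebra n\<^esub>"
    and T: "\<And>x i. x \<in> carrier (bt_algebra n) \<Longrightarrow> i \<in> {1..<n} \<Longrightarrow> P x \<Longrightarrow> P (x \<otimes>\<^bsub>bt_algebra n\<^esub> bt_T n i)"
    and E: "\<And>x i. x \<in> carrier (bt_algebra n) \<Longrightarrow> i \<in> {1..<n} \<Longrightarrow> P x \<Longrightarrow> P (x \<otimes>\<^bsub>bt_algebra n\<^esub> bt_E n i)"
    and add: "\<And>x y. x \<in> carrier (bt_algebra n) \<Longrightarrow> y \<in> carrier (bt_algebra n) \<Longrightarrow> P x \<Longrightarrow> P y \<Longrightarrow>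
      P (x \<oplus>\<^bsub>bt_algebra n\<^esub> y)"
    and sm: "\<And>x k. x \<in> carrier (bt_algebra n) \<Longrightarrow> P x \<Longrightarrow> P (bt_smult n k x)"
  shows "P x"
proof -
  have word: "Poly_Mapping.single (FWord l) 1 \<in> carrier (bt_free_algebra n) \<and>
      P (bt_elt n (Poly_Mapping.single (FWord l) 1))"
    if "set l \<subseteq> LetT ` {1..<n} \<union> LetE ` {1..<n}" for l
    using that
  proof (induction l rule: rev_induct)
    case Nil
    have "Poly_Mapping.single (FWord []) 1 = (1 :: bt_free)"
      by (simp flip: zero_fword_def)
    then show ?case using one bt_free_algebra_closed(4) by (simp add: bt_elt_one)
  next
    case (snoc g l)
    have eq: "Poly_Mapping.single (FWord (l @ [g])) 1 = Poly_Mapping.single (FWord l) 1 * (free_gen g :: bt_free)"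
      by (simp add: free_gen_def mult_single plus_fword_def)
    have g: "free_gen g \<in> carrier (bt_free_algebra n)"
      using snoc.prems free_gen_laurent by auto
    consider i where "g = LetT i" "i \<in> {1..<n}" | i where "g = LetE i" "i \<in> {1..<n}"
      using snoc.prems by auto
    then have "P (bt_elt n (Poly_Mapping.single (FWord l) 1) \<otimes>\<^bsub>bt_algebra n\<^esub> bt_elt n (free_gen g))"
      using snoc by cases (auto simp: bt_elt_TE bt_elt_closed intro: T E)
    then show ?case
      using snoc g by (auto simp: eq bt_elt_simps intro: bt_free_algebra_closed)
  qed
  have elt: "P (bt_elt n p)" if "p \<in> carrier (bt_free_algebra n)" for p
    using that unfolding bt_free_algebra_def
  proof (induction p rule: laurent.free_carrier_induct)
    case zero
    have "bt_elt n 0 = bt_smult n 0 \<one>\<^bsub>bt_algebra n\<^esub>"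
      using bt_elt_const[OF laurent.zero, of n] by (simp add: free_const_def)
    then show ?case using sm[OF _ one, of 0] by simp
  next
    case (single w a)
    have eq: "Poly_Mapping.single w a = free_const a * Poly_Mapping.single (FWord (letters w)) 1"
      by (simp add: free_const_def mult_single)
    show ?case
      using single word[of "letters w"] unfolding eq
      by (subst bt_elt_simps) (auto simp: free_const_laurent bt_elt_const BTA.sm_mult_left bt_elt_closed intro!: sm)
  next
    case (add p q)
    then show ?case
      unfolding bt_free_algebra_def[symmetric] using assms(5) by (simp add: bt_elt_simps bt_elt_closed)
  qed
  show ?thesis
    using x
  proof (induction x rule: BT.BC_induct)
    case (pure y k)
    then obtain p where p: "p \<in> carrier (bt_free_algebra n)" "y = bt_class n p"
      by (elim bt_class_surj)
    have "bt_pure n y k = bt_smult n k (bt_elt n p)"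
      using pure p by (subst bt_pure_eq_smult) (auto simp: bt_elt_def)
    then show ?case using sm elt p bt_elt_closed by simp
  qed (rule add)
qed

lemma bt_elt_relation:
  assumes "p - q \<in> bt_relations n" "p \<in> carrier (bt_free_algebra n)" "q \<in> carrier (bt_free_algebra n)"
  shows "bt_elt n p = bt_elt n q"
proof -
  have "p - q \<in> bt_ideal n"
    unfolding bt_ideal_def using assms(1) FA.genideal_self[OF bt_relations_subset] by blast
  then have "bt_class n p = bt_class n q"
    unfolding bt_class_def using FA.quotient_eq_iff_same_a_r_cos[OF bt_ideal_ideal assms(2,3)]
    by (simp add: bt_free_algebra_minus assms)
  then show ?thesis by (simp add: bt_elt_def)
qed

interpretation BTR: bt_rels "bt_algebra n" "bt_smult n" n "bt_T n" "bt_E n" for n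
proof (intro bt_rels.intro bt_rels_axioms.intro BTA.kalgebra_axioms)
  note closed = bt_free_algebra_closed free_gen_laurent free_const_laurent laurent_u
  note ev = bt_elt_simps closed bt_elt_TE
  fix i j
  assume i: "i \<in> {1..<n}"
  show "bt_T n i \<in> carrier (bt_algebra n)" "bt_E n i \<in> carrier (bt_algebra n)"
    using bt_elt_closed[OF free_gen_laurent(1)[OF i]] bt_elt_closed[OF free_gen_laurent(2)[OF i]]
    by (simp_all add: bt_elt_TE)
  have "fE i ^ 2 - fE i \<in> bt_relations n" unfolding bt_relations_def using i by blast
  from bt_elt_relation[OF this] i show "bt_E n i \<otimes>\<^bsub>bt_algebra n\<^esub> bt_E n i = bt_E n i"
    by (simp add: ev power2_eq_square)
  have "fE i * fT i - fT i * fE i \<in> bt_relations n" unfolding bt_relations_def using i by blast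
  from bt_elt_relation[OF this] i
  show "bt_E n i \<otimes>\<^bsub>bt_algebra n\<^esub> bt_T n i = bt_T n i \<otimes>\<^bsub>bt_algebra n\<^esub> bt_E n i"
    by (simp add: ev)
  have "fT i ^ 2 - (1 + free_const (u - 1) * fE i * (1 + fT i)) \<in> bt_relations n"
    unfolding bt_relations_def using i by blast
  from bt_elt_relation[OF this] i
  show "bt_T n i \<otimes>\<^bsub>bt_algebra n\<^esub> bt_T n i = \<one>\<^bsub>bt_algebra n\<^esub> \<oplus>\<^bsub>bt_algebra n\<^esub>
      bt_smult n (u - 1) (bt_E n i \<otimes>\<^bsub>bt_algebra n\<^esub> (\<one>\<^bsub>bt_algebra n\<^esub> \<oplus>\<^bsub>bt_algebra n\<^esub> bt_T n i))"
    by (simp add: ev power2_eq_square bt_elt_one bt_elt_const BTA.sm_mult_left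
      \<open>bt_E n i \<in> carrier (bt_algebra n)\<close> \<open>bt_T n i \<in> carrier (bt_algebra n)\<close>)
  assume j: "j \<in> {1..<n}"
  have "fE i * fE j - fE j * fE i \<in> bt_relations n" unfolding bt_relations_def using i j by blast
  from bt_elt_relation[OF this] i j
  show "bt_E n i \<otimes>\<^bsub>bt_algebra n\<^esub> bt_E n j = bt_E n j \<otimes>\<^bsub>bt_algebra n\<^esub> bt_E n i"
    by (simp add: ev)
  {
    assume far: "\<bar>int i - int j\<bar> > 1"
    have "fT i * fT j - fT j * fT i \<in> bt_relations n" unfolding bt_relations_def using i j far by blast
    from bt_elt_relation[OF this] i j
    show "bt_T n i \<otimes>\<^bsub>bt_algebra n\<^esub> bt_T n j = bt_T n j \<otimes>\<^bsub>bt_algebra n\<^esub> bt_T n i"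
      by (simp add: ev)
    have "fE i * fT j - fT j * fE i \<in> bt_relations n" unfolding bt_relations_def using i j far by blast
    from bt_elt_relation[OF this] i j
    show "bt_E n i \<otimes>\<^bsub>bt_algebra n\<^esub> bt_T n j = bt_T n j \<otimes>\<^bsub>bt_algebra n\<^esub> bt_E n i"
      by (simp add: ev)
  }
  assume adj: "\<bar>int i - int j\<bar> = 1"
  have "fT i * fT j * fT i - fT j * fT i * fT j \<in> bt_relations n" unfolding bt_relations_def using i j adj by blast
  from bt_elt_relation[OF this] i j
  show "bt_T n i \<otimes>\<^bsub>bt_algebra n\<^esub> bt_T n j \<otimes>\<^bsub>bt_algebra n\<^esub> bt_T n i
      = bt_T n j \<otimes>\<^bsub>bt_algebra n\<^esub> bt_T n i \<otimes>\<^bsub>bt_algebra n\<^esub> bt_T n j"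
    by (simp add: ev)
  have "fE j * fT i * fT j - fT i * fT j * fE i \<in> bt_relations n" unfolding bt_relations_def using i j adj by blast
  from bt_elt_relation[OF this] i j
  show "bt_E n j \<otimes>\<^bsub>bt_algebra n\<^esub> bt_T n i \<otimes>\<^bsub>bt_algebra n\<^esub> bt_T n j
      = bt_T n i \<otimes>\<^bsub>bt_algebra n\<^esub> bt_T n j \<otimes>\<^bsub>bt_algebra n\<^esub> bt_E n i"
    by (simp add: ev)
  have "fE i * fE j * fT j - fE i * fT j * fE i \<in> bt_relations n" unfolding bt_relations_def using i j adj by blast
  from bt_elt_relation[OF this] i j
  show "bt_E n i \<otimes>\<^bsub>bt_algebra n\<^esub> bt_E n j \<otimes>\<^bsub>bt_algebra n\<^esub> bt_T n j
      = bt_E n i \<otimes>\<^bsub>bt_algebra n\<^esub> bt_T n j \<otimes>\<^bsub>bt_algebra n\<^esub> bt_E n i"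
    by (simp add: ev)
  have "fE i * fT j * fE i - fT j * fE i * fE j \<in> bt_relations n" unfolding bt_relations_def using i j adj by blast
  from bt_elt_relation[OF this] i j
  show "bt_E n i \<otimes>\<^bsub>bt_algebra n\<^esub> bt_T n j \<otimes>\<^bsub>bt_algebra n\<^esub> bt_E n i
      = bt_T n j \<otimes>\<^bsub>bt_algebra n\<^esub> bt_E n i \<otimes>\<^bsub>bt_algebra n\<^esub> bt_E n j"
    by (simp add: ev)
qed

section \<open>The universal property\<close>

context bt_rels begin

text \<open>Evaluation on the free algebra kills the defining relations, so it factors through the algebra over the
Laurent polynomials; scaling its values extends it to formal pairs, and the bilinearity relations
are killed because the target is an algebra over the field.\<close>

lemma bt_universal:
  obtains h where "h \<in> ring_hom (bt_algebra n) R"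
    "\<And>k x. x \<in> carrier (bt_algebra n) \<Longrightarrow> h (bt_smult n k x) = sm k (h x)"
    "\<And>i. i \<in> {1..<n} \<Longrightarrow> h (bt_T n i) = T i" "\<And>i. i \<in> {1..<n} \<Longrightarrow> h (bt_E n i) = E i"
proof -
  have zero1: "free_val x = \<zero>" if "x \<in> bt_ideal n" for x
    by (rule hom_vanishes_on_genideal[OF FA.ring_axioms ring_axioms free_val_hom bt_relations_subset free_val_relation])
      (use that in \<open>simp_all add: bt_ideal_def\<close>)
  obtain g where g: "g \<in> ring_hom (bt_laurent_algebra n) R"
    "\<And>p. p \<in> carrier (bt_free_algebra n) \<Longrightarrow> g (bt_class n p) = free_val p"
    unfolding bt_laurent_algebra_def bt_class_def
    using quotient_lift[OF FA.ring_axioms ring_axioms bt_ideal_ideal free_val_hom zero1] by blast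
  note g_closed = ring_hom_closed[OF g(1)]
  define \<phi> where "\<phi> = (\<lambda>(x, k). sm k (if x \<in> carrier (bt_laurent_algebra n) then g x else \<zero>))"
  have \<phi>_closed: "range \<phi> \<subseteq> carrier R"
    by (auto simp: \<phi>_def g_closed)
  let ?P = "pairs_ring (bt_laurent_algebra n) :: ((bt_free set \<times> ratfun) \<Rightarrow>\<^sub>0 int) ring"
  define F where "F = (lin_ext of_int \<phi> :: ((bt_free set \<times> ratfun) \<Rightarrow>\<^sub>0 int) \<Rightarrow> 'a)"
  have F_closed: "F p \<in> carrier R" for p
    unfolding F_def by (rule lin_ext_closed) (rule \<phi>_closed)
  have F_add: "F (p + q) = F p \<oplus> F q" for p q
    unfolding F_def by (rule lin_ext_add) (auto simp: \<phi>_closed)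
  have F_single: "F (Poly_Mapping.single a c) = sm (of_int c) (\<phi> a)" for a c
    unfolding F_def by (rule lin_ext_single) (auto simp: \<phi>_closed)
  have F_zero: "F 0 = \<zero>" by (simp add: F_def)
  have F_diff: "F (p - q) = \<zero>" if "F p = F q" for p q
    using F_add[of "p - q" q] that F_closed add.r_cancel_one'[of "F q" "F (p - q)"] by simp
  have \<phi>_mult: "\<phi> (pair_mult (bt_laurent_algebra n) a b) = \<phi> a \<otimes> \<phi> b"
    if "a \<in> carrier (bt_laurent_algebra n) \<times> UNIV" "b \<in> carrier (bt_laurent_algebra n) \<times> UNIV" for a b
    using that by (auto simp: \<phi>_def ring_hom_mult[OF g(1)] g_closed sm_mult_left sm_mult_right sm_sm mult.commute)
  have F_mult: "F (conv (pair_mult (bt_laurent_algebra n)) p q) = F p \<otimes> F q"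
    if p: "Poly_Mapping.keys p \<subseteq> carrier (bt_laurent_algebra n) \<times> UNIV"
      and q: "Poly_Mapping.keys q \<subseteq> carrier (bt_laurent_algebra n) \<times> UNIV" for p q
    using p
  proof (induction p rule: poly_mapping_keys_induct)
    case (single a x)
    show ?case using q
    proof (induction q rule: poly_mapping_keys_induct)
      case (single b y)
      then show ?case using \<open>a \<in> _\<close> \<phi>_closed
        by (simp add: conv_single F_single \<phi>_mult image_subset_iff sm_mult_left sm_mult_right sm_sm mult.commute
            del: split_paired_All)
    qed (simp_all add: conv_add_right F_add F_closed r_distr F_zero)
  qed (simp_all add: conv_add_left F_add F_closed l_distr F_zero)
  have F_hom: "F \<in> ring_hom ?P R"
    by (rule ring_hom_memI)
      (auto simp: pairs_ring_simps F_closed F_mult F_add F_single \<phi>_def ring_hom_one[OF g(1)])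
  have zero2: "F x = \<zero>" if x: "x \<in> tensor_relations (bt_laurent_algebra n) laurent (bt_laurent_smult n)" for x
    using x unfolding tensor_relations_def
  proof (elim UnE CollectE exE conjE)
    fix a b k assume x: "x = Poly_Mapping.single (a \<oplus>\<^bsub>bt_laurent_algebra n\<^esub> b, k) 1
        - Poly_Mapping.single (a, k) 1 - Poly_Mapping.single (b, k) 1"
      and "a \<in> carrier (bt_laurent_algebra n)" "b \<in> carrier (bt_laurent_algebra n)"
    then show "F x = \<zero>" unfolding x diff_diff_eq
      by (intro F_diff) (simp add: F_single F_add \<phi>_def ring_hom_add[OF g(1)] g_closed sm_add_right)
  next
    fix a k l assume x: "x = Poly_Mapping.single (a, k + l) 1
        - Poly_Mapping.single (a, k) 1 - Poly_Mapping.single (a, l) 1"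
      and "a \<in> carrier (bt_laurent_algebra n)"
    then show "F x = \<zero>" unfolding x diff_diff_eq
      by (intro F_diff) (simp add: F_single F_add \<phi>_def g_closed sm_add_left)
  next
    fix c a k assume x: "x = Poly_Mapping.single (bt_laurent_smult n c a, k) 1 - Poly_Mapping.single (a, c * k) 1"
      and a: "c \<in> laurent" "a \<in> carrier (bt_laurent_algebra n)"
    have "g (bt_laurent_smult n c a) = sm c (g a)"
      using a ring_hom_closed[OF bt_class_hom free_const_laurent[OF a(1)]]
      by (simp add: bt_laurent_smult_def ring_hom_mult[OF g(1)] g(2) free_const_laurent free_val_const
          sm_mult_left g_closed)
    then show "F x = \<zero>" unfolding x using a BT.sA_closed[OF a]
      by (intro F_diff) (simp add: F_single F_add \<phi>_def g_closed sm_sm mult.commute)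
  qed
  have zero3: "F x = \<zero>" if "x \<in> tensor_ideal (bt_laurent_algebra n) laurent (bt_laurent_smult n)" for x
    by (rule hom_vanishes_on_genideal[OF BT.PP.ring_axioms ring_axioms F_hom BT.tensor_relations_subset zero2])
      (use that in \<open>simp_all add: tensor_ideal_def\<close>)
  obtain h where h: "h \<in> ring_hom (bt_algebra n) R"
    "\<And>p. p \<in> carrier ?P \<Longrightarrow> h (tensor_ideal (bt_laurent_algebra n) laurent (bt_laurent_smult n) +>\<^bsub>?P\<^esub> p) = F p"
    unfolding bt_algebra_def base_change_def
    using quotient_lift[OF BT.PP.ring_axioms ring_axioms BT.TI_ideal F_hom zero3] by blast
  have h_pure: "h (bt_pure n x k) = sm k (g x)" if "x \<in> carrier (bt_laurent_algebra n)" for x k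
    unfolding bt_pure_def pure_tensor_def
    using h(2)[OF BT.single_PP[OF that]] that by (simp add: F_single \<phi>_def g_closed)
  show thesis
  proof (rule that[OF h(1)])
    fix k x assume "x \<in> carrier (bt_algebra n)"
    then show "h (bt_smult n k x) = sm k (h x)"
      by (simp add: bt_smult_def ring_hom_mult[OF h(1)] h_pure ring_hom_one[OF g(1)] sm_mult_left
          ring_hom_closed[OF h(1)])
  next
    fix i assume i: "i \<in> {1..<n}"
    show "h (bt_T n i) = T i" "h (bt_E n i) = E i"
      using i ring_hom_closed[OF bt_class_hom free_gen_laurent(1)[OF i]]
        ring_hom_closed[OF bt_class_hom free_gen_laurent(2)[OF i]]
      by (simp_all add: bt_T_def bt_E_def h_pure g(2) free_gen_laurent free_val_gen)
  qed
qed

end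

section \<open>The antiautomorphism\<close>

definition opposite_ring :: "('a, 'b) ring_scheme \<Rightarrow> ('a, 'b) ring_scheme" where
  "opposite_ring R = R\<lparr>monoid.mult := \<lambda>x y. y \<otimes>\<^bsub>R\<^esub> x\<rparr>"

lemma opposite_ring_simps [simp]:
  "carrier (opposite_ring R) = carrier R"
  "x \<otimes>\<^bsub>opposite_ring R\<^esub> y = y \<otimes>\<^bsub>R\<^esub> x"
  "x \<oplus>\<^bsub>opposite_ring R\<^esub> y = x \<oplus>\<^bsub>R\<^esub> y"
  "\<one>\<^bsub>opposite_ring R\<^esub> = \<one>\<^bsub>R\<^esub>" "\<zero>\<^bsub>opposite_ring R\<^esub> = \<zero>\<^bsub>R\<^esub>"
  by (simp_all add: opposite_ring_def)

lemma (in ring) ring_opposite_ring: "ring (opposite_ring R)"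
proof (rule ring_carrierI)
  show "abelian_group (opposite_ring R)"
    by (rule abelian_groupI) (auto simp: a_ac intro: bexI[of _ "\<ominus> x" for x] l_neg)
  show "monoid (opposite_ring R)"
    by (rule monoidI) (auto simp: m_assoc)
qed (auto simp: l_distr r_distr)

lemma (in kalgebra) kalgebra_opposite_ring: "kalgebra (opposite_ring R) sm"
  by (intro kalgebra.intro kalgebra_axioms.intro ring_opposite_ring)
    (auto simp: sm_add_left sm_add_right sm_sm sm_mult_left sm_mult_right)

text \<open>Reversal of words maps the defining relations to defining relations.  It exchanges \<open>i\<close> and \<open>j\<close> in the
relation between one \<open>E\<close> and two \<open>T\<close>, and the two halves of the relation between two \<open>E\<close> and one \<open>T\<close>.\<close>

lemma (in bt_rels) bt_rels_opposite_ring: "bt_rels (opposite_ring R) sm n T E"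
proof (intro bt_rels.intro bt_rels_axioms.intro kalgebra_opposite_ring)
  fix i j assume ij: "i \<in> {1..<n}" "j \<in> {1..<n}"
  note rel = opposite_ring_simps T_closed E_closed ij m_assoc[symmetric]
  show "E i \<otimes>\<^bsub>opposite_ring R\<^esub> E j = E j \<otimes>\<^bsub>opposite_ring R\<^esub> E i"
    using EE_comm[OF ij] by (simp only: rel)
  {
    assume far: "\<bar>int i - int j\<bar> > 1"
    show "T i \<otimes>\<^bsub>opposite_ring R\<^esub> T j = T j \<otimes>\<^bsub>opposite_ring R\<^esub> T i"
      using TT_far[OF ij far] by (simp only: rel)
    show "E i \<otimes>\<^bsub>opposite_ring R\<^esub> T j = T j \<otimes>\<^bsub>opposite_ring R\<^esub> E i"
      using ET_far[OF ij far] by (simp only: rel)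
  }
  assume adj: "\<bar>int i - int j\<bar> = 1"
  then have adj': "\<bar>int j - int i\<bar> = 1" by simp
  show "T i \<otimes>\<^bsub>opposite_ring R\<^esub> T j \<otimes>\<^bsub>opposite_ring R\<^esub> T i
      = T j \<otimes>\<^bsub>opposite_ring R\<^esub> T i \<otimes>\<^bsub>opposite_ring R\<^esub> T j"
    using braid[OF ij adj] by (simp only: rel)
  show "E j \<otimes>\<^bsub>opposite_ring R\<^esub> T i \<otimes>\<^bsub>opposite_ring R\<^esub> T j
      = T i \<otimes>\<^bsub>opposite_ring R\<^esub> T j \<otimes>\<^bsub>opposite_ring R\<^esub> E i"
    using ETT[OF ij(2,1) adj'] by (simp only: rel)
  show "E i \<otimes>\<^bsub>opposite_ring R\<^esub> E j \<otimes>\<^bsub>opposite_ring R\<^esub> T j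
      = E i \<otimes>\<^bsub>opposite_ring R\<^esub> T j \<otimes>\<^bsub>opposite_ring R\<^esub> E i"
    using ETE[OF ij adj] EE_comm[OF ij] by (simp only: opposite_ring_simps m_assoc T_closed E_closed ij)
  show "E i \<otimes>\<^bsub>opposite_ring R\<^esub> T j \<otimes>\<^bsub>opposite_ring R\<^esub> E i
      = T j \<otimes>\<^bsub>opposite_ring R\<^esub> E i \<otimes>\<^bsub>opposite_ring R\<^esub> E j"
    using EET[OF ij adj] EE_comm[OF ij] by (simp only: rel)
next
  fix i assume i: "i \<in> {1..<n}"
  show "T i \<in> carrier (opposite_ring R)" "E i \<in> carrier (opposite_ring R)" using i by auto
  show "E i \<otimes>\<^bsub>opposite_ring R\<^esub> E i = E i" using E_idem[OF i] by simp
  show "E i \<otimes>\<^bsub>opposite_ring R\<^esub> T i = T i \<otimes>\<^bsub>opposite_ring R\<^esub> E i" using ET_comm[OF i] by simp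
  show "T i \<otimes>\<^bsub>opposite_ring R\<^esub> T i = \<one>\<^bsub>opposite_ring R\<^esub> \<oplus>\<^bsub>opposite_ring R\<^esub>
       sm (u - 1) (E i \<otimes>\<^bsub>opposite_ring R\<^esub> (\<one>\<^bsub>opposite_ring R\<^esub> \<oplus>\<^bsub>opposite_ring R\<^esub> T i))"
    using quad[OF i] ET_comm[OF i] i by (simp add: l_distr r_distr)
qed

text \<open>The properties by which the antiautomorphism is characterized, named so that existence and
uniqueness can be stated.\<close>

definition is_bt_star :: "nat \<Rightarrow> (bt \<Rightarrow> bt) \<Rightarrow> bool" where
  "is_bt_star n s \<longleftrightarrow> 
     s \<in> extensional (carrier (bt_algebra n)) \<and>
     bij_betw s (carrier (bt_algebra n)) (carrier (bt_algebra n)) \<and>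
     (\<forall>x \<in> carrier (bt_algebra n). \<forall>y \<in> carrier (bt_algebra n).
        s (x \<oplus>\<^bsub>bt_algebra n\<^esub> y) = s x \<oplus>\<^bsub>bt_algebra n\<^esub> s y) \<and>
     (\<forall>k. \<forall>x \<in> carrier (bt_algebra n). s (bt_smult n k x) = bt_smult n k (s x)) \<and>
     (\<forall>x \<in> carrier (bt_algebra n). \<forall>y \<in> carrier (bt_algebra n).
        s (x \<otimes>\<^bsub>bt_algebra n\<^esub> y) = s y \<otimes>\<^bsub>bt_algebra n\<^esub> s x) \<and>
     s \<one>\<^bsub>bt_algebra n\<^esub> = \<one>\<^bsub>bt_algebra n\<^esub> \<and>
     (\<forall>i \<in> {1..<n}. s (bt_T n i) = bt_T n i \<and> s (bt_E n i) = bt_E n i)"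

lemma is_bt_star_unique:
  assumes s: "is_bt_star n s" and t: "is_bt_star n t"
  shows "s = t"
proof (rule extensionalityI)
  show "s \<in> extensional (carrier (bt_algebra n))" "t \<in> extensional (carrier (bt_algebra n))"
    using s t by (simp_all add: is_bt_star_def)
  fix x assume "x \<in> carrier (bt_algebra n)"
  then show "s x = t x"
    by (induction x rule: bt_algebra_induct) (use s t in \<open>simp_all add: is_bt_star_def\<close>)
qed

lemma is_bt_star_bt_star: "is_bt_star n (bt_star n)"
proof -
  interpret O: bt_rels "opposite_ring (bt_algebra n)" "bt_smult n" n "bt_T n" "bt_E n"
    by (rule BTR.bt_rels_opposite_ring)
  obtain h where h: "h \<in> ring_hom (bt_algebra n) (opposite_ring (bt_algebra n))"
    "\<And>k x. x \<in> carrier (bt_algebra n) \<Longrightarrow> h (bt_smult n k x) = bt_smult n k (h x)"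
    "\<And>i. i \<in> {1..<n} \<Longrightarrow> h (bt_T n i) = bt_T n i" "\<And>i. i \<in> {1..<n} \<Longrightarrow> h (bt_E n i) = bt_E n i"
    using O.bt_universal by metis
  have closed: "h x \<in> carrier (bt_algebra n)" if "x \<in> carrier (bt_algebra n)" for x
    using ring_hom_closed[OF h(1) that] by simp
  have mult: "h (x \<otimes>\<^bsub>bt_algebra n\<^esub> y) = h y \<otimes>\<^bsub>bt_algebra n\<^esub> h x"
    if "x \<in> carrier (bt_algebra n)" "y \<in> carrier (bt_algebra n)" for x y
    using ring_hom_mult[OF h(1) that] by simp
  have add: "h (x \<oplus>\<^bsub>bt_algebra n\<^esub> y) = h x \<oplus>\<^bsub>bt_algebra n\<^esub> h y"
    if "x \<in> carrier (bt_algebra n)" "y \<in> carrier (bt_algebra n)" for x y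
    using ring_hom_add[OF h(1) that] by simp
  have one: "h \<one>\<^bsub>bt_algebra n\<^esub> = \<one>\<^bsub>bt_algebra n\<^esub>" using ring_hom_one[OF h(1)] by simp
  have inv: "h (h x) = x" if "x \<in> carrier (bt_algebra n)" for x
    using that
    by (induction x rule: bt_algebra_induct) (simp_all add: closed mult add one h)
  have "is_bt_star n (restrict h (carrier (bt_algebra n)))"
    unfolding is_bt_star_def
  proof (intro conjI ballI allI)
    show "bij_betw (restrict h (carrier (bt_algebra n))) (carrier (bt_algebra n)) (carrier (bt_algebra n))"
      by (rule bij_betwI[where g = h]) (auto simp: closed inv)
  qed (auto simp: closed mult add one h)
  then have "\<exists>!s. is_bt_star n s" using is_bt_star_unique by blast
  then show ?thesis
    unfolding bt_star_def is_bt_star_def[symmetric] by (rule theI')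
qed

lemma bt_star:
  assumes "x \<in> carrier (bt_algebra n)"
  shows bt_star_closed [simp]: "bt_star n x \<in> carrier (bt_algebra n)"
    and bt_star_add: "y \<in> carrier (bt_algebra n) \<Longrightarrow>
      bt_star n (x \<oplus>\<^bsub>bt_algebra n\<^esub> y) = bt_star n x \<oplus>\<^bsub>bt_algebra n\<^esub> bt_star n y"
    and bt_star_mult: "y \<in> carrier (bt_algebra n) \<Longrightarrow>
      bt_star n (x \<otimes>\<^bsub>bt_algebra n\<^esub> y) = bt_star n y \<otimes>\<^bsub>bt_algebra n\<^esub> bt_star n x"
    and bt_star_smult: "bt_star n (bt_smult n k x) = bt_smult n k (bt_star n x)"
  using is_bt_star_bt_star[of n] assms
  by (auto simp: is_bt_star_def bij_betw_def)

lemma bt_star_gen [simp]: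
  "bt_star n \<one>\<^bsub>bt_algebra n\<^esub> = \<one>\<^bsub>bt_algebra n\<^esub>"
  "i \<in> {1..<n} \<Longrightarrow> bt_star n (bt_T n i) = bt_T n i"
  "i \<in> {1..<n} \<Longrightarrow> bt_star n (bt_E n i) = bt_E n i"
  using is_bt_star_bt_star[of n] by (simp_all add: is_bt_star_def)

section \<open>Action on functions of coloured labelled words\<close>

text \<open>A word assigns a colour and a label to each position.  The action is dual to the one on the tensor
power of a space with basis indexed by pairs of a colour and a label.  As functions on words are used in
place of tensors, there may be infinitely many colours and labels, and positions outside
\<open>{1..n}\<close> do no harm.\<close>

type_synonym cword = "nat \<Rightarrow> nat \<times> nat"

definition op_ring :: "((cword \<Rightarrow> ratfun) \<Rightarrow> (cword \<Rightarrow> ratfun)) ring" where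
  "op_ring = \<lparr>carrier = {F. (\<forall>\<phi> \<psi>. F (\<lambda>f. \<phi> f + \<psi> f) = (\<lambda>f. F \<phi> f + F \<psi> f)) \<and>
                           (\<forall>k \<phi>. F (\<lambda>f. k * \<phi> f) = (\<lambda>f. k * F \<phi> f))},
    monoid.mult = (\<circ>), one = id, ring.zero = (\<lambda>\<phi> f. 0), add = (\<lambda>F G \<phi> f. F \<phi> f + G \<phi> f)\<rparr>"

definition op_smult :: "ratfun \<Rightarrow> ((cword \<Rightarrow> ratfun) \<Rightarrow> (cword \<Rightarrow> ratfun)) \<Rightarrow> ((cword \<Rightarrow> ratfun) \<Rightarrow> (cword \<Rightarrow> ratfun))" where
  "op_smult k F = (\<lambda>\<phi> f. k * F \<phi> f)"

lemma op_ring_simps: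
  "F \<in> carrier op_ring \<longleftrightarrow> (\<forall>\<phi> \<psi>. F (\<lambda>f. \<phi> f + \<psi> f) = (\<lambda>f. F \<phi> f + F \<psi> f)) \<and>
     (\<forall>k \<phi>. F (\<lambda>f. k * \<phi> f) = (\<lambda>f. k * F \<phi> f))"
  "F \<otimes>\<^bsub>op_ring\<^esub> G = F \<circ> G" "\<one>\<^bsub>op_ring\<^esub> = id" "\<zero>\<^bsub>op_ring\<^esub> = (\<lambda>\<phi> f. 0)"
  "F \<oplus>\<^bsub>op_ring\<^esub> G = (\<lambda>\<phi> f. F \<phi> f + G \<phi> f)"
  by (simp_all add: op_ring_def)

lemma ring_op_ring: "ring op_ring"
proof (rule ring_carrierI)
  show "abelian_group op_ring"
  proof (rule abelian_groupI)
    fix F assume "F \<in> carrier op_ring"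
    then show "\<exists>G\<in>carrier op_ring. G \<oplus>\<^bsub>op_ring\<^esub> F = \<zero>\<^bsub>op_ring\<^esub>"
      by (intro bexI[of _ "\<lambda>\<phi> f. - F \<phi> f"]) (auto simp: op_ring_simps)
  qed (auto simp: op_ring_simps algebra_simps)
  show "monoid op_ring"
    by (rule monoidI) (auto simp: op_ring_simps)
qed (auto simp: op_ring_simps)

interpretation OP: kalgebra op_ring op_smult
  by (intro kalgebra.intro kalgebra_axioms.intro ring_op_ring)
    (auto simp: op_ring_simps op_smult_def algebra_simps fun_eq_iff)

text \<open>For equal colours these are the coefficients of the action of a Hecke algebra on tensor space with
eigenvalues \<open>u\<close> and \<open>- 1\<close>; for different colours \<open>T\<^sub>i\<close> is the plain exchange of positions.  All
coefficients are polynomials in \<open>u\<close>, and at \<open>u = 1\<close> the exchange remains in every case.\<close>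

definition swap_coeff :: "nat \<times> nat \<Rightarrow> nat \<times> nat \<Rightarrow> ratfun" where
  "swap_coeff a b = (if fst a \<noteq> fst b \<or> snd a < snd b then 1 else if snd a = snd b then 0 else u)"

definition stay_coeff :: "nat \<times> nat \<Rightarrow> nat \<times> nat \<Rightarrow> ratfun" where
  "stay_coeff a b = (if fst a \<noteq> fst b \<or> snd a < snd b then 0 else if snd a = snd b then u else u - 1)"

definition op_T :: "nat \<Rightarrow> (cword \<Rightarrow> ratfun) \<Rightarrow> (cword \<Rightarrow> ratfun)" where
  "op_T i \<phi> f = swap_coeff (f i) (f (Suc i)) * \<phi> (f \<circ> transpose i (Suc i))
    + stay_coeff (f i) (f (Suc i)) * \<phi> f"

definition op_E :: "nat \<Rightarrow> (cword \<Rightarrow> ratfun) \<Rightarrow> (cword \<Rightarrow> ratfun)" where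
  "op_E i \<phi> f = (if fst (f i) = fst (f (Suc i)) then \<phi> f else 0)"

lemma comp_transpose_apply:
  "(f \<circ> transpose i (Suc i)) i = f (Suc i)" "(f \<circ> transpose i (Suc i)) (Suc i) = f i"
  "j \<noteq> i \<Longrightarrow> j \<noteq> Suc i \<Longrightarrow> (f \<circ> transpose i (Suc i)) j = f j"
  by auto

lemma comp_transpose_twice: "f \<circ> transpose i (Suc i) \<circ> transpose i (Suc i) = f"
  by (auto simp: fun_eq_iff)

lemma comp_transpose_far:
  assumes "\<bar>int i - int j\<bar> > 1"
  shows "f \<circ> transpose i (Suc i) \<circ> transpose j (Suc j) = f \<circ> transpose j (Suc j) \<circ> transpose i (Suc i)"
  using assms by (auto simp: fun_eq_iff transpose_def)

lemma comp_transpose_braid: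
  "f \<circ> transpose (Suc i) (Suc (Suc i)) \<circ> transpose i (Suc i) \<circ> transpose (Suc i) (Suc (Suc i))
    = f \<circ> transpose i (Suc i) \<circ> transpose (Suc i) (Suc (Suc i)) \<circ> transpose i (Suc i)"
  by (auto simp: fun_eq_iff transpose_def)

lemma stay_coeff_diff: "fst a \<noteq> fst b \<Longrightarrow> stay_coeff a b = 0"
  by (simp add: stay_coeff_def)

text \<open>The identities between coefficients to which the braid relation reduces: the values of the function at the
remaining rearrangements of the three positions cancel identically.\<close>

lemma braid_coeffs:
  "swap_coeff a b * (stay_coeff a c * stay_coeff b a + stay_coeff a b * stay_coeff b c)
    = stay_coeff b c * swap_coeff a b * stay_coeff a c"
  "swap_coeff b c * (stay_coeff a c * stay_coeff c b + stay_coeff b c * stay_coeff a b)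
    = stay_coeff a b * swap_coeff b c * stay_coeff a c"
  "swap_coeff a b * swap_coeff b a * stay_coeff a c + stay_coeff a b ^ 2 * stay_coeff b c
    = swap_coeff b c * swap_coeff c b * stay_coeff a c + stay_coeff b c ^ 2 * stay_coeff a b"
  by (auto simp: swap_coeff_def stay_coeff_def algebra_simps power2_eq_square)

lemma op_T_far:
  assumes "\<bar>int i - int j\<bar> > 1"
  shows "op_T i (op_T j \<phi>) = op_T j (op_T i \<phi>)"
proof
  fix f :: cword
  have *: "j \<noteq> i" "j \<noteq> Suc i" "Suc j \<noteq> i" "Suc j \<noteq> Suc i" "i \<noteq> j" "i \<noteq> Suc j" "Suc i \<noteq> j" "Suc i \<noteq> Suc j"
    using assms by auto
  show "op_T i (op_T j \<phi>) f = op_T j (op_T i \<phi>) f"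
    unfolding op_T_def comp_transpose_far[OF assms]
    by (simp only: comp_transpose_apply * not_False_eq_True) (simp add: algebra_simps)
qed

lemma op_ET_far:
  assumes "\<bar>int i - int j\<bar> > 1"
  shows "op_E i (op_T j \<phi>) = op_T j (op_E i \<phi>)"
proof
  fix f :: cword
  have *: "j \<noteq> i" "j \<noteq> Suc i" "Suc j \<noteq> i" "Suc j \<noteq> Suc i" "i \<noteq> j" "i \<noteq> Suc j" "Suc i \<noteq> j" "Suc i \<noteq> Suc j"
    using assms by auto
  show "op_E i (op_T j \<phi>) f = op_T j (op_E i \<phi>) f"
    unfolding op_T_def op_E_def
    by (simp only: comp_transpose_apply * not_False_eq_True) simp
qed

lemma op_braid: "op_T i (op_T (Suc i) (op_T i \<phi>)) = op_T (Suc i) (op_T i (op_T (Suc i) \<phi>))"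
proof
  fix f :: cword
  have *: "i \<noteq> Suc i" "Suc i \<noteq> i" "Suc (Suc i) \<noteq> i" "Suc (Suc i) \<noteq> Suc i" "i \<noteq> Suc (Suc i)"
    "Suc i \<noteq> Suc (Suc i)" by auto
  define a b c where abc: "a = f i" "b = f (Suc i)" "c = f (Suc (Suc i))"
  let ?f1 = "f \<circ> transpose i (Suc i)" and ?f2 = "f \<circ> transpose (Suc i) (Suc (Suc i))"
  have "op_T i (op_T (Suc i) (op_T i \<phi>)) f - op_T (Suc i) (op_T i (op_T (Suc i) \<phi>)) f
    = (swap_coeff a b * (stay_coeff a c * stay_coeff b a + stay_coeff a b * stay_coeff b c)
        - stay_coeff b c * swap_coeff a b * stay_coeff a c) * \<phi> ?f1
    - (swap_coeff b c * (stay_coeff a c * stay_coeff c b + stay_coeff b c * stay_coeff a b)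
        - stay_coeff a b * swap_coeff b c * stay_coeff a c) * \<phi> ?f2
    + ((swap_coeff a b * swap_coeff b a * stay_coeff a c + stay_coeff a b ^ 2 * stay_coeff b c)
        - (swap_coeff b c * swap_coeff c b * stay_coeff a c + stay_coeff b c ^ 2 * stay_coeff a b)) * \<phi> f"
    unfolding op_T_def abc
    by (simp only: comp_transpose_apply * not_False_eq_True comp_transpose_twice comp_transpose_braid)
      (simp add: algebra_simps power2_eq_square)
  also have "\<dots> = 0"
    by (simp only: diff_zero[of "0::ratfun"] add_0 mult_zero_left
        braid_coeffs[THEN eq_iff_diff_eq_0[THEN iffD1]])
  finally show "op_T i (op_T (Suc i) (op_T i \<phi>)) f = op_T (Suc i) (op_T i (op_T (Suc i) \<phi>)) f"
    by simp
qed

lemma op_ETT: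
  "op_E (Suc i) (op_T i (op_T (Suc i) \<phi>)) = op_T i (op_T (Suc i) (op_E i \<phi>))"
  "op_E i (op_T (Suc i) (op_T i \<phi>)) = op_T (Suc i) (op_T i (op_E (Suc i) \<phi>))"
proof -
  have *: "i \<noteq> Suc i" "Suc i \<noteq> i" "Suc (Suc i) \<noteq> i" "Suc (Suc i) \<noteq> Suc i" "i \<noteq> Suc (Suc i)"
    "Suc i \<noteq> Suc (Suc i)" by auto
  show "op_E (Suc i) (op_T i (op_T (Suc i) \<phi>)) = op_T i (op_T (Suc i) (op_E i \<phi>))"
    unfolding op_T_def op_E_def fun_eq_iff
    by (simp only: comp_transpose_apply * not_False_eq_True) (auto simp: stay_coeff_diff)
  show "op_E i (op_T (Suc i) (op_T i \<phi>)) = op_T (Suc i) (op_T i (op_E (Suc i) \<phi>))"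
    unfolding op_T_def op_E_def fun_eq_iff
    by (simp only: comp_transpose_apply * not_False_eq_True) (auto simp: stay_coeff_diff)
qed

lemma op_EET:
  "op_E i (op_E (Suc i) (op_T (Suc i) \<phi>)) = op_E i (op_T (Suc i) (op_E i \<phi>))"
  "op_E (Suc i) (op_E i (op_T i \<phi>)) = op_E (Suc i) (op_T i (op_E (Suc i) \<phi>))"
  "op_E i (op_T (Suc i) (op_E i \<phi>)) = op_T (Suc i) (op_E i (op_E (Suc i) \<phi>))"
  "op_E (Suc i) (op_T i (op_E (Suc i) \<phi>)) = op_T i (op_E (Suc i) (op_E i \<phi>))"
proof -
  have *: "i \<noteq> Suc i" "Suc i \<noteq> i" "Suc (Suc i) \<noteq> i" "Suc (Suc i) \<noteq> Suc i" "i \<noteq> Suc (Suc i)"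
    "Suc i \<noteq> Suc (Suc i)" by auto
  show "op_E i (op_E (Suc i) (op_T (Suc i) \<phi>)) = op_E i (op_T (Suc i) (op_E i \<phi>))"
    "op_E (Suc i) (op_E i (op_T i \<phi>)) = op_E (Suc i) (op_T i (op_E (Suc i) \<phi>))"
    "op_E i (op_T (Suc i) (op_E i \<phi>)) = op_T (Suc i) (op_E i (op_E (Suc i) \<phi>))"
    "op_E (Suc i) (op_T i (op_E (Suc i) \<phi>)) = op_T i (op_E (Suc i) (op_E i \<phi>))"
    unfolding op_T_def op_E_def fun_eq_iff
    by (simp only: comp_transpose_apply * not_False_eq_True, auto simp: stay_coeff_diff)+
qed

interpretation OPR: bt_rels op_ring op_smult n op_T op_E
proof (intro bt_rels.intro bt_rels_axioms.intro OP.kalgebra_axioms)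
  fix i j :: nat
  show "op_T i \<in> carrier op_ring" "op_E i \<in> carrier op_ring"
    by (auto simp: op_ring_simps op_T_def op_E_def fun_eq_iff algebra_simps)
  show "op_E i \<otimes>\<^bsub>op_ring\<^esub> op_E j = op_E j \<otimes>\<^bsub>op_ring\<^esub> op_E i"
    by (auto simp: op_ring_simps op_E_def fun_eq_iff)
  show "op_E i \<otimes>\<^bsub>op_ring\<^esub> op_E i = op_E i"
    by (auto simp: op_ring_simps op_E_def fun_eq_iff)
  show "op_E i \<otimes>\<^bsub>op_ring\<^esub> op_T i = op_T i \<otimes>\<^bsub>op_ring\<^esub> op_E i"
    by (auto simp: op_ring_simps op_E_def op_T_def fun_eq_iff stay_coeff_diff)
  show "op_T i \<otimes>\<^bsub>op_ring\<^esub> op_T i = \<one>\<^bsub>op_ring\<^esub> \<oplus>\<^bsub>op_ring\<^esub>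
       op_smult (u - 1) (op_E i \<otimes>\<^bsub>op_ring\<^esub> (\<one>\<^bsub>op_ring\<^esub> \<oplus>\<^bsub>op_ring\<^esub> op_T i))"
  proof (intro ext)
    fix \<phi> f
    show "(op_T i \<otimes>\<^bsub>op_ring\<^esub> op_T i) \<phi> f = (\<one>\<^bsub>op_ring\<^esub> \<oplus>\<^bsub>op_ring\<^esub>
       op_smult (u - 1) (op_E i \<otimes>\<^bsub>op_ring\<^esub> (\<one>\<^bsub>op_ring\<^esub> \<oplus>\<^bsub>op_ring\<^esub> op_T i))) \<phi> f"
      unfolding op_ring_simps op_smult_def comp_apply op_E_def op_T_def comp_transpose_apply
      by (auto simp: comp_transpose_twice swap_coeff_def stay_coeff_def algebra_simps)
  qed
  {
    assume far: "\<bar>int i - int j\<bar> > 1"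
    show "op_T i \<otimes>\<^bsub>op_ring\<^esub> op_T j = op_T j \<otimes>\<^bsub>op_ring\<^esub> op_T i"
      using op_T_far[OF far] by (auto simp: op_ring_simps fun_eq_iff)
    show "op_E i \<otimes>\<^bsub>op_ring\<^esub> op_T j = op_T j \<otimes>\<^bsub>op_ring\<^esub> op_E i"
      using op_ET_far[OF far] by (auto simp: op_ring_simps fun_eq_iff)
  }
  assume "\<bar>int i - int j\<bar> = 1"
  then have "j = Suc i \<or> i = Suc j" by auto
  then show "op_T i \<otimes>\<^bsub>op_ring\<^esub> op_T j \<otimes>\<^bsub>op_ring\<^esub> op_T i
      = op_T j \<otimes>\<^bsub>op_ring\<^esub> op_T i \<otimes>\<^bsub>op_ring\<^esub> op_T j"
    "op_E j \<otimes>\<^bsub>op_ring\<^esub> op_T i \<otimes>\<^bsub>op_ring\<^esub> op_T j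
      = op_T i \<otimes>\<^bsub>op_ring\<^esub> op_T j \<otimes>\<^bsub>op_ring\<^esub> op_E i"
    "op_E i \<otimes>\<^bsub>op_ring\<^esub> op_E j \<otimes>\<^bsub>op_ring\<^esub> op_T j
      = op_E i \<otimes>\<^bsub>op_ring\<^esub> op_T j \<otimes>\<^bsub>op_ring\<^esub> op_E i"
    "op_E i \<otimes>\<^bsub>op_ring\<^esub> op_T j \<otimes>\<^bsub>op_ring\<^esub> op_E i
      = op_T j \<otimes>\<^bsub>op_ring\<^esub> op_E i \<otimes>\<^bsub>op_ring\<^esub> op_E j"
    by (elim disjE; hypsubst; intro ext; simp only: op_ring_simps comp_apply op_braid op_ETT op_EET)+
qed

definition bt_act :: "nat \<Rightarrow> bt \<Rightarrow> (cword \<Rightarrow> ratfun) \<Rightarrow> (cword \<Rightarrow> ratfun)" where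
  "bt_act n = (SOME h. h \<in> ring_hom (bt_algebra n) op_ring \<and>
     (\<forall>k. \<forall>x \<in> carrier (bt_algebra n). h (bt_smult n k x) = op_smult k (h x)) \<and>
     (\<forall>i \<in> {1..<n}. h (bt_T n i) = op_T i \<and> h (bt_E n i) = op_E i))"

lemma bt_act_hom:
  "bt_act n \<in> ring_hom (bt_algebra n) op_ring \<and>
     (\<forall>k. \<forall>x \<in> carrier (bt_algebra n). bt_act n (bt_smult n k x) = op_smult k (bt_act n x)) \<and>
     (\<forall>i \<in> {1..<n}. bt_act n (bt_T n i) = op_T i \<and> bt_act n (bt_E n i) = op_E i)"
proof -
  have "\<exists>h. h \<in> ring_hom (bt_algebra n) op_ring \<and>
     (\<forall>k. \<forall>x \<in> carrier (bt_algebra n). h (bt_smult n k x) = op_smult k (h x)) \<and>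
     (\<forall>i \<in> {1..<n}. h (bt_T n i) = op_T i \<and> h (bt_E n i) = op_E i)"
    by (rule OPR.bt_universal[of n]) blast
  from someI_ex[OF this] show ?thesis unfolding bt_act_def .
qed

lemma bt_act_gen:
  "i \<in> {1..<n} \<Longrightarrow> bt_act n (bt_T n i) = op_T i" "i \<in> {1..<n} \<Longrightarrow> bt_act n (bt_E n i) = op_E i"
  "bt_act n \<one>\<^bsub>bt_algebra n\<^esub> = id"
  using bt_act_hom[of n] ring_hom_one[of "bt_act n" "bt_algebra n" op_ring] by (simp_all add: op_ring_simps)

lemma bt_act:
  assumes x: "x \<in> carrier (bt_algebra n)"
  shows bt_act_add: "y \<in> carrier (bt_algebra n) \<Longrightarrow>
      bt_act n (x \<oplus>\<^bsub>bt_algebra n\<^esub> y) \<phi> f = bt_act n x \<phi> f + bt_act n y \<phi> f"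
    and bt_act_mult: "y \<in> carrier (bt_algebra n) \<Longrightarrow>
      bt_act n (x \<otimes>\<^bsub>bt_algebra n\<^esub> y) \<phi> = bt_act n x (bt_act n y \<phi>)"
    and bt_act_smult: "bt_act n (bt_smult n k x) \<phi> f = k * bt_act n x \<phi> f"
proof -
  have h: "bt_act n \<in> ring_hom (bt_algebra n) op_ring"
    and s: "bt_act n (bt_smult n k x) = op_smult k (bt_act n x)"
    using bt_act_hom[of n] x by blast+
  show "bt_act n (bt_smult n k x) \<phi> f = k * bt_act n x \<phi> f"
    by (simp add: s op_smult_def)
  assume y: "y \<in> carrier (bt_algebra n)"
  show "bt_act n (x \<oplus>\<^bsub>bt_algebra n\<^esub> y) \<phi> f = bt_act n x \<phi> f + bt_act n y \<phi> f"
    unfolding ring_hom_add[OF h x y] by (simp add: op_ring_simps)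
  show "bt_act n (x \<otimes>\<^bsub>bt_algebra n\<^esub> y) \<phi> = bt_act n x (bt_act n y \<phi>)"
    unfolding ring_hom_mult[OF h x y] by (simp add: op_ring_simps)
qed

section \<open>Specialization of rational functions at one\<close>

text \<open>The rational function \<open>x\<close> is regular at \<open>u = 1\<close>, with the value \<open>c\<close> there.\<close>

definition specializes :: "ratfun \<Rightarrow> complex \<Rightarrow> bool" where
  "specializes x c \<longleftrightarrow> (\<exists>p q. poly q 1 \<noteq> 0 \<and> x = Fract p q \<and> c = poly p 1 / poly q 1)"

lemma specializesI: "poly q 1 \<noteq> 0 \<Longrightarrow> specializes (Fract p q) (poly p 1 / poly q 1)"
  by (auto simp: specializes_def)

lemma specializesE:
  assumes "specializes x c"
  obtains p q where "poly q 1 \<noteq> 0" "q \<noteq> 0" "x = Fract p q" "c = poly p 1 / poly q 1"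
  using assms by (force simp: specializes_def)

lemma specializes_unique:
  assumes "specializes x c" "specializes x d"
  shows "c = d"
  using assms
proof (elim specializesE)
  fix p q p' q'
  assume q: "poly q 1 \<noteq> 0" "q \<noteq> 0" "poly q' 1 \<noteq> 0" "q' \<noteq> 0"
    and x: "x = Fract p q" "x = Fract p' q'" and cd: "c = poly p 1 / poly q 1" "d = poly p' 1 / poly q' 1"
  have "p * q' = p' * q" using x q by (simp add: eq_fract)
  then have "poly p 1 * poly q' 1 = poly p' 1 * poly q 1"
    by (metis poly_mult)
  then show ?thesis unfolding cd using q by (simp only: frac_eq_eq not_False_eq_True)
qed

lemma specializes_add:
  assumes "specializes x c" "specializes y d"
  shows "specializes (x + y) (c + d)"
  using assms
proof (elim specializesE)
  fix p q p' q'
  assume q: "poly q 1 \<noteq> 0" "q \<noteq> 0" "poly q' 1 \<noteq> 0" "q' \<noteq> 0"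
    and x: "x = Fract p q" "y = Fract p' q'" and cd: "c = poly p 1 / poly q 1" "d = poly p' 1 / poly q' 1"
  show ?thesis
    unfolding x cd using q specializesI[of "q * q'" "p * q' + p' * q"] by (simp add: add_frac_eq)
qed

lemma specializes_mult:
  assumes "specializes x c" "specializes y d"
  shows "specializes (x * y) (c * d)"
  using assms
proof (elim specializesE)
  fix p q p' q'
  assume q: "poly q 1 \<noteq> 0" "q \<noteq> 0" "poly q' 1 \<noteq> 0" "q' \<noteq> 0"
    and x: "x = Fract p q" "y = Fract p' q'" and cd: "c = poly p 1 / poly q 1" "d = poly p' 1 / poly q' 1"
  show ?thesis
    unfolding x cd using q specializesI[of "q * q'" "p * p'"] by simp
qed

lemma specializes_poly: "specializes (Fract p 1) (poly p 1)"
  using specializesI[of 1 p] by simp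

lemma specializes_const [simp]: "specializes 0 0" "specializes 1 1" "specializes u 1" "specializes (u - 1) 0"
proof -
  show "specializes 0 0" "specializes 1 1"
    using specializes_poly[of 0] specializes_poly[of 1] by (simp_all add: fract_collapse)
  show u: "specializes u 1" using specializes_poly[of "[:0, 1:]"] by (simp add: u_def)
  have "specializes (- 1) (- 1)"
    using specializes_poly[of "-1"] by (simp add: fract_collapse flip: minus_fract)
  from specializes_add[OF u this] show "specializes (u - 1) 0" by simp
qed

lemma specializes_sum:
  assumes "\<And>i. i \<in> S \<Longrightarrow> specializes (f i) (g i)"
  shows "specializes (\<Sum>i\<in>S. f i) (\<Sum>i\<in>S. g i)"
  using assms by (induction S rule: infinite_finite_induct) (auto intro: specializes_add)

lemma poly_split_order:
  fixes p :: "complex poly"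
  assumes "p \<noteq> 0"
  obtains a p' where "p = [:-1, 1:] ^ a * p'" "poly p' 1 \<noteq> 0"
  using order_decomp[OF assms, of 1] by (auto simp: poly_eq_0_iff_dvd)

text \<open>Rational functions regular at \<open>1\<close> form a valuation ring.\<close>

lemma specializes_valuation:
  assumes "x \<noteq> 0"
  shows "(\<exists>c. specializes x c) \<or> specializes (inverse x) 0"
proof -
  obtain p q where x: "x = Fract p q" "q \<noteq> 0" "p \<noteq> 0"
    using assms by (cases x rule: Fract_cases_nonzero) auto
  obtain a p' where p: "p = [:-1, 1:] ^ a * p'" "poly p' 1 \<noteq> 0"
    using poly_split_order[OF x(3)] .
  obtain b q' where q: "q = [:-1, 1:] ^ b * q'" "poly q' 1 \<noteq> 0"
    using poly_split_order[OF x(2)] .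
  have nz: "p' \<noteq> 0" "q' \<noteq> 0" "[:-1, 1 :: complex:] ^ k \<noteq> 0" for k using p(2) q(2) by auto
  show ?thesis
  proof (cases "b \<le> a")
    case True
    then have "[:-1, 1 :: complex:] ^ a = [:-1, 1:] ^ (a - b) * [:-1, 1:] ^ b"
      by (simp flip: power_add)
    then have "x = Fract ([:-1, 1:] ^ (a - b) * p') q'"
      unfolding x(1) p(1) q(1) using nz by (subst eq_fract) (auto simp: mult_ac)
    then show ?thesis using specializesI[OF q(2)] by blast
  next
    case False
    then have "[:-1, 1 :: complex:] ^ b = [:-1, 1:] ^ (b - a) * [:-1, 1:] ^ a"
      by (simp flip: power_add)
    then have "inverse x = Fract ([:-1, 1:] ^ (b - a) * q') p'"
      unfolding x(1) p(1) q(1) inverse_fract using nz by (subst eq_fract) (auto simp: mult_ac)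
    then show ?thesis
      using specializesI[OF p(2), of "[:-1, 1:] ^ (b - a) * q'"] False
      by (simp add: power_0_left)
  qed
qed

text \<open>Division by the coefficient of least valuation at \<open>1\<close>.\<close>

lemma specializing_scale:
  fixes c :: "'i \<Rightarrow> ratfun"
  assumes "finite I" "\<exists>i\<in>I. c i \<noteq> 0"
  shows "\<exists>j\<in>I. c j \<noteq> 0 \<and> (\<forall>i\<in>I. \<exists>d. specializes (c i / c j) d)"
  using assms
proof (induction I rule: finite_induct)
  case (insert k I)
  show ?case
  proof (cases "\<exists>i\<in>I. c i \<noteq> 0")
    case False
    then have k: "c k \<noteq> 0" using insert.prems by auto
    moreover have "\<exists>d. specializes (c i / c k) d" if "i \<in> insert k I" for i
      using that False k by (cases "i = k") (auto intro: specializes_const)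
    ultimately show ?thesis by blast
  next
    case True
    then obtain j where j: "j \<in> I" "c j \<noteq> 0" "\<And>i. i \<in> I \<Longrightarrow> \<exists>d. specializes (c i / c j) d"
      using insert.IH by blast
    show ?thesis
    proof (cases "\<exists>d. specializes (c k / c j) d")
      case True
      then show ?thesis using j by blast
    next
      case False
      then have k: "c k \<noteq> 0" using specializes_const(1) by fastforce
      then have "specializes (c j / c k) 0"
        using specializes_valuation[of "c k / c j"] j False by simp
      then have "\<exists>d. specializes (c i / c k) d" if "i \<in> I" for i
        using j(3)[OF that] specializes_mult[of "c i / c j" _ "c j / c k" 0] j(2) by auto
      moreover have "specializes (c k / c k) 1" using k by simp
      ultimately show ?thesis using k by blast
    qed
  qed
qed simp

section \<open>Set partitions and colourings\<close>

definition monochrome :: "nat set set \<Rightarrow> (nat \<Rightarrow> nat) \<Rightarrow> bool" where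
  "monochrome A c \<longleftrightarrow> (\<forall>I\<in>A. \<forall>i\<in>I. \<forall>j\<in>I. c i = c j)"

definition same_block :: "nat set set \<Rightarrow> (nat \<times> nat) set" where
  "same_block A = {(i, j). \<exists>I\<in>A. i \<in> I \<and> j \<in> I}"

lemma monochrome_iff: "monochrome A c \<longleftrightarrow> (\<forall>(i, j) \<in> same_block A. c i = c j)"
  by (auto simp: monochrome_def same_block_def)

lemma partition_block_unique:
  assumes "partition_on S A" "I \<in> A" "J \<in> A" "x \<in> I" "x \<in> J"
  shows "I = J"
  using disjointD[OF partition_onD2[OF assms(1)] assms(2,3)] assms(4,5) by auto

lemma partition_block_ex: "partition_on S A \<Longrightarrow> x \<in> S \<Longrightarrow> \<exists>I\<in>A. x \<in> I"
  using partition_onD1 by fastforce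

lemma partition_block_subset: "partition_on S A \<Longrightarrow> I \<in> A \<Longrightarrow> x \<in> I \<Longrightarrow> x \<in> S"
  using partition_onD1 by fastforce

lemma partition_block_nonempty:
  assumes "partition_on S A" "I \<in> A"
  shows "\<exists>x. x \<in> I"
proof -
  have "I \<noteq> {}"
  proof
    assume "I = {}"
    then show False using partition_onD3[OF assms(1)] assms(2) by simp
  qed
  then show ?thesis by (simp add: ex_in_conv)
qed

lemma block_eq_same_block:
  assumes A: "partition_on S A" and I: "I \<in> A" "x \<in> I"
  shows "I = {y. (x, y) \<in> same_block A}"
proof (intro equalityI subsetI)
  fix y assume "y \<in> I"
  then show "y \<in> {y. (x, y) \<in> same_block A}" using I by (auto simp: same_block_def)
next
  fix y assume "y \<in> {y. (x, y) \<in> same_block A}"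
  then obtain J where J: "J \<in> A" "x \<in> J" "y \<in> J" by (auto simp: same_block_def)
  then show "y \<in> I" using partition_block_unique[OF A I(1) J(1) I(2) J(2)] by simp
qed

lemma same_block_subset:
  assumes A: "partition_on S A"
  shows "same_block A \<subseteq> S \<times> S"
proof
  fix p assume "p \<in> same_block A"
  then obtain I where "I \<in> A" "fst p \<in> I" "snd p \<in> I" by (auto simp: same_block_def)
  then show "p \<in> S \<times> S" using partition_block_subset[OF A] by (simp add: mem_Times_iff)
qed

lemma partition_subset_of_same_block:
  assumes A: "partition_on S A" and B: "partition_on S B" and eq: "same_block A = same_block B"
  shows "A \<subseteq> B"
proof
  fix I assume I: "I \<in> A"
  then obtain x where x: "x \<in> I" using partition_block_nonempty[OF A I] by blast
  obtain J where J: "J \<in> B" "x \<in> J"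
    using partition_block_ex[OF B partition_block_subset[OF A I x]] by blast
  then show "I \<in> B"
    using block_eq_same_block[OF A I x] block_eq_same_block[OF B J] eq by simp
qed

lemma partition_eq_of_same_block:
  assumes "partition_on S A" "partition_on S B" "same_block A = same_block B"
  shows "A = B"
  using partition_subset_of_same_block[OF assms] partition_subset_of_same_block[OF assms(2,1) assms(3)[symmetric]]
  by blast

definition same_colour :: "nat set \<Rightarrow> (nat \<Rightarrow> nat) \<Rightarrow> (nat \<times> nat) set" where
  "same_colour S c = {(i, j) \<in> S \<times> S. c i = c j}"

lemma monochrome_iff_subset: "partition_on S A \<Longrightarrow> monochrome A c \<longleftrightarrow> same_block A \<subseteq> same_colour S c"
  using same_block_subset[of S A] by (auto simp: monochrome_iff same_colour_def)

definition fibres :: "nat set \<Rightarrow> (nat \<Rightarrow> nat) \<Rightarrow> nat set set" where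
  "fibres S c = (\<lambda>x. {y \<in> S. c y = c x}) ` S"

lemma partition_fibres: "partition_on S (fibres S c)"
  unfolding partition_on_def disjoint_def fibres_def by auto

lemma same_block_fibres: "same_block (fibres S c) = same_colour S c"
  unfolding same_block_def fibres_def same_colour_def by auto

text \<open>Each point is coloured by the least element of its block.\<close>

lemma partition_colouring:
  assumes "finite S" "partition_on S B"
  obtains c where "same_colour S c = same_block B"
proof -
  define c where "c i = Min {j. (i, j) \<in> same_block B}" for i
  have "(i, j) \<in> same_block B \<longleftrightarrow> c i = c j" if ij: "i \<in> S" "j \<in> S" for i j
  proof -
    obtain I where I: "I \<in> B" "i \<in> I" using partition_block_ex[OF assms(2) ij(1)] by blast
    obtain J where J: "J \<in> B" "j \<in> J" using partition_block_ex[OF assms(2) ij(2)] by blast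
    have IJ: "{k. (i, k) \<in> same_block B} = I" "{k. (j, k) \<in> same_block B} = J"
      using block_eq_same_block[OF assms(2) I] block_eq_same_block[OF assms(2) J] by simp_all
    have fin: "finite I" "finite J"
      using partition_block_subset[OF assms(2) I(1)] partition_block_subset[OF assms(2) J(1)]
      by (auto intro: finite_subset[OF _ assms(1)])
    have "(i, j) \<in> same_block B \<longleftrightarrow> j \<in> I" using IJ(1) by blast
    also have "\<dots> \<longleftrightarrow> I = J"
      using partition_block_unique[OF assms(2) I(1) J(1)] J(2) by blast
    also have "\<dots> \<longleftrightarrow> c i = c j"
    proof
      assume "c i = c j"
      moreover have "c i \<in> I" "c j \<in> J" unfolding c_def IJ using fin I J by (auto intro!: Min_in)
      ultimately show "I = J" using partition_block_unique[OF assms(2) I(1) J(1), of "c i"] by simp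
    qed (simp add: c_def IJ)
    finally show ?thesis .
  qed
  then have "same_colour S c = same_block B"
    using same_block_subset[OF assms(2)] unfolding same_colour_def by auto
  then show thesis by (rule that)
qed

lemma finite_partitions: "finite S \<Longrightarrow> finite {A. partition_on S A}"
  by (rule finite_subset[of _ "Pow (Pow S)"]) (auto simp: partition_on_def)

text \<open>Triangularity: a colouring with kernel \<open>A\<close> is constant on the blocks of exactly the refinements of \<open>A\<close>, so the
sum for this colouring determines \<open>d\<^sub>A\<close> from the values at proper refinements, which have fewer pairs
of points in the same block.\<close>

lemma refinement_sums_zero:
  fixes d :: "nat set set \<Rightarrow> complex"
  assumes S: "finite S"
    and zero: "\<And>c. (\<Sum>A | partition_on S A \<and> monochrome A c. d A) = 0"
    and A: "partition_on S A"
  shows "d A = 0"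
  using A
proof (induction "card (same_block A)" arbitrary: A rule: less_induct)
  case less
  obtain c where c: "same_colour S c = same_block A" using partition_colouring[OF S less.prems] .
  have fin: "finite {B. partition_on S B \<and> monochrome B c}"
    using finite_partitions[OF S] by (rule rev_finite_subset) auto
  have Ain: "A \<in> {B. partition_on S B \<and> monochrome B c}"
    using less.prems monochrome_iff_subset[OF less.prems] c by simp
  have "d B = 0" if B: "partition_on S B" "monochrome B c" "B \<noteq> A" for B
  proof (rule less.hyps[OF _ B(1)])
    have "same_block B \<subseteq> same_block A" using monochrome_iff_subset[OF B(1)] B(2) c by simp
    moreover have "same_block B \<noteq> same_block A" using partition_eq_of_same_block[OF B(1) less.prems] B(3) by blast
    moreover have "finite (same_block A)"
      by (rule finite_subset[OF same_block_subset[OF less.prems]]) (simp add: S)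
    ultimately show "card (same_block B) < card (same_block A)" by (intro psubset_card_mono) auto
  qed
  then have "(\<Sum>B | partition_on S B \<and> monochrome B c. d B) = d A"
    using sum.remove[OF fin Ain, of d] by (simp add: sum.neutral)
  then show ?case using zero[of c] by simp
qed

section \<open>Counting colourings\<close>

definition lift_colouring :: "nat set \<Rightarrow> nat set set \<Rightarrow> (nat set \<Rightarrow> nat) \<Rightarrow> nat \<Rightarrow> nat" where
  "lift_colouring S B h = (\<lambda>i\<in>S. h {j. (i, j) \<in> same_block B})"

lemma lift_colouring_eq:
  assumes "partition_on S B" "I \<in> B" "i \<in> I"
  shows "lift_colouring S B h i = h I"
proof -
  have "i \<in> S" by (rule partition_block_subset[OF assms])
  then show ?thesis using block_eq_same_block[OF assms] by (simp add: lift_colouring_def)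
qed

lemma bij_lift_colouring:
  assumes B: "partition_on S B"
  shows "bij_betw (lift_colouring S B) (B \<rightarrow>\<^sub>E T) {c \<in> S \<rightarrow>\<^sub>E T. monochrome B c}"
proof (rule bij_betwI')
  have ne: "\<exists>i. i \<in> I" if "I \<in> B" for I using partition_block_nonempty[OF B that] .
  fix h h' assume h: "h \<in> B \<rightarrow>\<^sub>E T" "h' \<in> B \<rightarrow>\<^sub>E T"
  show "lift_colouring S B h = lift_colouring S B h' \<longleftrightarrow> h = h'"
  proof
    assume eq: "lift_colouring S B h = lift_colouring S B h'"
    show "h = h'"
    proof (rule PiE_ext[OF h])
      fix I assume I: "I \<in> B"
      then obtain i where "i \<in> I" using ne by blast
      then show "h I = h' I"
        using lift_colouring_eq[OF B I, of i h] lift_colouring_eq[OF B I, of i h'] eq by simp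
    qed
  qed simp
next
  fix h assume h: "h \<in> B \<rightarrow>\<^sub>E T"
  have "lift_colouring S B h i \<in> T" if i: "i \<in> S" for i
  proof -
    obtain I where I: "I \<in> B" "i \<in> I" using partition_block_ex[OF B i] by blast
    then show ?thesis using lift_colouring_eq[OF B I] h by auto
  qed
  moreover have "lift_colouring S B h \<in> extensional S" by (simp add: lift_colouring_def)
  moreover have "monochrome B (lift_colouring S B h)"
    unfolding monochrome_def by (auto simp: lift_colouring_eq[OF B])
  ultimately show "lift_colouring S B h \<in> {c \<in> S \<rightarrow>\<^sub>E T. monochrome B c}" by (auto simp: PiE_def)
next
  fix c assume c: "c \<in> {c \<in> S \<rightarrow>\<^sub>E T. monochrome B c}"
  define h where "h = (\<lambda>I\<in>B. c (SOME i. i \<in> I))"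
  have some: "(SOME i. i \<in> I) \<in> I" "(SOME i. i \<in> I) \<in> S" if "I \<in> B" for I
  proof -
    show "(SOME i. i \<in> I) \<in> I" by (rule someI_ex[OF partition_block_nonempty[OF B that]])
    then show "(SOME i. i \<in> I) \<in> S" by (rule partition_block_subset[OF B that])
  qed
  have "h \<in> B \<rightarrow>\<^sub>E T" using c some by (auto simp: h_def)
  moreover have "c = lift_colouring S B h"
  proof (rule extensionalityI[of _ S])
    show "c \<in> extensional S" using c by (auto simp: PiE_def)
    show "lift_colouring S B h \<in> extensional S" by (simp add: lift_colouring_def)
    fix i assume "i \<in> S"
    then obtain I where I: "I \<in> B" "i \<in> I" using partition_block_ex[OF B] by blast
    have "c i = c (SOME i. i \<in> I)" using c some(1)[OF I(1)] I unfolding monochrome_def by blast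
    then show "c i = lift_colouring S B h i" using lift_colouring_eq[OF B I] I by (simp add: h_def)
  qed
  ultimately show "\<exists>h \<in> B \<rightarrow>\<^sub>E T. c = lift_colouring S B h" by blast
qed

lemma card_respecting_colourings:
  assumes "finite S" "partition_on S B"
  shows "card {c \<in> S \<rightarrow>\<^sub>E {..<m}. monochrome B c} = m ^ card B"
proof -
  have "finite B" using finite_elements[OF assms] .
  then show ?thesis
    using bij_betw_same_card[OF bij_lift_colouring[OF assms(2), of "{..<m}"]] by (simp add: card_PiE)
qed

lemma same_colour_lift_colouring:
  assumes B: "partition_on S B"
  shows "same_colour S (lift_colouring S B h) = same_block B \<longleftrightarrow> inj_on h B"
proof
  assume eq: "same_colour S (lift_colouring S B h) = same_block B"
  show "inj_on h B"
  proof (rule inj_onI)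
    fix I J assume IJ: "I \<in> B" "J \<in> B" "h I = h J"
    obtain i where i: "i \<in> I" using partition_block_nonempty[OF B IJ(1)] by blast
    obtain j where j: "j \<in> J" using partition_block_nonempty[OF B IJ(2)] by blast
    note ij = i j
    have "i \<in> S" "j \<in> S" by (rule partition_block_subset[OF B IJ(1) i] partition_block_subset[OF B IJ(2) j])+
    then have "(i, j) \<in> same_block B"
      unfolding eq[symmetric] same_colour_def
      using lift_colouring_eq[OF B IJ(1) ij(1)] lift_colouring_eq[OF B IJ(2) ij(2)] IJ(3) by simp
    then have "j \<in> I" using block_eq_same_block[OF B IJ(1) ij(1)] by blast
    then show "I = J" using partition_block_unique[OF B IJ(1,2)] ij(2) by blast
  qed
next
  assume inj: "inj_on h B"
  have "(i, j) \<in> same_colour S (lift_colouring S B h) \<longleftrightarrow> (i, j) \<in> same_block B" for i j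
  proof (cases "i \<in> S \<and> j \<in> S")
    case True
    then obtain I J where I: "I \<in> B" "i \<in> I" and J: "J \<in> B" "j \<in> J"
      using partition_block_ex[OF B] by blast
    have "(i, j) \<in> same_colour S (lift_colouring S B h) \<longleftrightarrow> h I = h J"
      using True lift_colouring_eq[OF B I] lift_colouring_eq[OF B J] by (simp add: same_colour_def)
    also have "\<dots> \<longleftrightarrow> I = J" using inj I J by (auto dest: inj_onD)
    also have "\<dots> \<longleftrightarrow> j \<in> I" using partition_block_unique[OF B I(1) J(1)] J(2) by blast
    also have "\<dots> \<longleftrightarrow> (i, j) \<in> same_block B" using block_eq_same_block[OF B I] by blast
    finally show ?thesis .
  next
    case False
    then show ?thesis using same_block_subset[OF B] by (auto simp: same_colour_def)
  qed
  then show "same_colour S (lift_colouring S B h) = same_block B" by auto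
qed

text \<open>A colouring with kernel \<open>B\<close> is an injective assignment of colours to the blocks.\<close>

lemma card_exact_colourings:
  assumes S: "finite S" and B: "partition_on S B"
  shows "card {c \<in> S \<rightarrow>\<^sub>E {..<m}. same_colour S c = same_block B} = (\<Prod>j<card B. m - j)"
proof -
  have finB: "finite B" using finite_elements[OF S B] .
  let ?X = "{h \<in> B \<rightarrow>\<^sub>E {..<m}. inj_on h B}"
  have bij: "bij_betw (lift_colouring S B) (B \<rightarrow>\<^sub>E {..<m}) {c \<in> S \<rightarrow>\<^sub>E {..<m}. monochrome B c}"
    by (rule bij_lift_colouring[OF B])
  have "lift_colouring S B ` ?X = {c \<in> S \<rightarrow>\<^sub>E {..<m}. same_colour S c = same_block B}"
  proof (intro equalityI subsetI)
    fix c assume "c \<in> lift_colouring S B ` ?X"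
    then obtain h where h: "h \<in> B \<rightarrow>\<^sub>E {..<m}" "inj_on h B" "c = lift_colouring S B h" by blast
    have "lift_colouring S B h \<in> {c \<in> S \<rightarrow>\<^sub>E {..<m}. monochrome B c}"
      by (rule bij_betw_apply[OF bij h(1)])
    then show "c \<in> {c \<in> S \<rightarrow>\<^sub>E {..<m}. same_colour S c = same_block B}"
      using same_colour_lift_colouring[OF B, of h] h(2,3) by simp
  next
    fix c assume c: "c \<in> {c \<in> S \<rightarrow>\<^sub>E {..<m}. same_colour S c = same_block B}"
    then have "c \<in> {c \<in> S \<rightarrow>\<^sub>E {..<m}. monochrome B c}" using monochrome_iff_subset[OF B] by simp
    then have "c \<in> lift_colouring S B ` (B \<rightarrow>\<^sub>E {..<m})" unfolding bij_betw_imp_surj_on[OF bij] .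
    then obtain h where h: "h \<in> B \<rightarrow>\<^sub>E {..<m}" "c = lift_colouring S B h" by (elim imageE)
    then have "inj_on h B" using c same_colour_lift_colouring[OF B, of h] by simp
    then show "c \<in> lift_colouring S B ` ?X" using h by (intro image_eqI[of c _ h]) simp_all
  qed
  moreover have "inj_on (lift_colouring S B) ?X"
    by (rule inj_on_subset[OF bij_betw_imp_inj_on[OF bij]]) auto
  ultimately have "card {c \<in> S \<rightarrow>\<^sub>E {..<m}. same_colour S c = same_block B} = card ?X"
    using card_image[of "lift_colouring S B" ?X] by simp
  also have "\<dots> = prod ((-) m) {0..<card B}"
    using card_inj_on_subset_funcset[OF finB finite_lessThan subset_refl, of m] by simp
  finally show ?thesis by (simp add: atLeast0LessThan)
qed

text \<open>Both sides are polynomials in \<open>m\<close> that agree at all natural numbers.  The linear coefficient on the left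
collects the \<open>d C\<close> with \<open>k C = 1\<close>; on the right it is \<open>a\<close> times \<open>(- 1) (- 2) \<dots> (1 - K)\<close>.\<close>

lemma falling_factorial_linear_coefficient:
  fixes d :: "'c \<Rightarrow> complex" and k :: "'c \<Rightarrow> nat"
  assumes P: "finite P" and K: "K \<ge> 1"
    and eq: "\<And>m::nat. (\<Sum>C\<in>P. d C * of_nat m ^ k C) = a * of_nat (\<Prod>j<K. m - j)"
    and d: "\<And>C. C \<in> P \<Longrightarrow> k C = 1 \<Longrightarrow> d C = 0"
  shows "a = 0"
proof -
  obtain K' where K': "K = Suc K'" using K by (cases K) auto
  define p where "p = (\<Sum>C\<in>P. monom (d C) (k C))"
  define Q :: "complex poly" where "Q = (\<Prod>j<K'. [:- of_nat (Suc j), 1:])"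
  define q where "q = Polynomial.smult a ([:0, 1:] * Q)"
  \<comment> \<open>Truncated subtraction is harmless: for \<open>m < K\<close> the factor at \<open>j = m\<close> vanishes on both sides.\<close>
  have nat_prod: "of_nat (\<Prod>j<K. m - j) = (\<Prod>j<K. of_nat m - of_nat j :: complex)" for m
  proof (cases "m < K")
    case True
    have z1: "(\<Prod>j<K. m - j) = 0" using True by (intro prod_zero) auto
    have z2: "(\<Prod>j<K. of_nat m - of_nat j :: complex) = 0" using True by (intro prod_zero) auto
    show ?thesis by (simp only: z1 z2 of_nat_0)
  next
    case False
    then show ?thesis unfolding of_nat_prod by (intro prod.cong) (auto simp: of_nat_diff)
  qed
  have "poly (p - q) (of_nat m) = 0" for m
  proof -
    have "poly q (of_nat m) = a * (\<Prod>j<K. of_nat m - of_nat j)"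
      unfolding q_def Q_def K' prod.lessThan_Suc_shift by (simp add: poly_prod algebra_simps)
    moreover have "poly p (of_nat m) = (\<Sum>C\<in>P. d C * of_nat m ^ k C)"
      by (simp add: p_def poly_sum poly_monom)
    ultimately show ?thesis using eq[of m] nat_prod[of m] by simp
  qed
  then have "range of_nat \<subseteq> {x. poly (p - q) x = 0}" by auto
  moreover have "infinite (range of_nat :: complex set)"
    by (rule range_inj_infinite) (rule inj_of_nat)
  ultimately have "infinite {x. poly (p - q) x = 0}" using finite_subset by blast
  then have "p = q" using poly_roots_finite[of "p - q"] by auto
  moreover have "coeff p 1 = 0"
    unfolding p_def coeff_sum coeff_monom using d by (intro sum.neutral) auto
  moreover have "coeff q 1 = a * poly Q 0"
    by (simp add: q_def poly_0_coeff_0)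
  moreover have "poly Q 0 \<noteq> 0"
    by (simp add: Q_def poly_prod del: of_nat_Suc)
  ultimately show ?thesis by simp
qed

text \<open>The nondegeneracy of the form at \<open>u = 1\<close>, as a statement about partitions.  Choose \<open>B\<close> as the kernel of a
colouring \<open>b\<close> that is coarsest with \<open>F b \<noteq> 0\<close>.  Then the right hand side of the hypothesis is
supported on the colourings with kernel \<open>B\<close>, where it is \<open>F b\<close>.  Summing over all colourings
with \<open>m\<close> colours, for all \<open>m\<close>, and comparing the coefficients of \<open>m\<close> gives \<open>F b = 0\<close>.\<close>

lemma coarsest_colouring:
  fixes \<xi> :: "nat set set \<Rightarrow> complex"
  assumes S: "finite S" "S \<noteq> {}"
    and H: "\<And>B. partition_on S B \<Longrightarrow> \<exists>d. d {S} = 0 \<and>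
      (\<forall>c. (\<Sum>C | partition_on S C \<and> monochrome C c. d C) =
        (if monochrome B c then \<Sum>A | partition_on S A \<and> monochrome A c. \<xi> A else 0))"
    and A: "partition_on S A"
  shows "\<xi> A = 0"
proof (rule refinement_sums_zero[OF S(1) _ A])
  define F where "F c = (\<Sum>A | partition_on S A \<and> monochrome A c. \<xi> A)" for c
  have F_kernel: "F c = F c'" if "same_colour S c = same_colour S c'" for c c'
    unfolding F_def using that by (intro sum.cong) (auto simp: monochrome_iff_subset)
  have ker_fin: "finite (same_colour S c)" for c
    by (rule finite_subset[of _ "S \<times> S"]) (auto simp: same_colour_def S)
  have ker_bound: "card (same_colour S c) \<le> card (S \<times> S)" for c
    by (rule card_mono) (auto simp: same_colour_def S)
  have "F c = 0" for c
  proof (rule ccontr)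
    assume "F c \<noteq> 0"
    then have "\<exists>b. F b \<noteq> 0 \<and> (\<forall>c. F c \<noteq> 0 \<longrightarrow> card (same_colour S c) \<le> card (same_colour S b))"
      using ex_has_greatest_nat[of "\<lambda>c. F c \<noteq> 0" c "\<lambda>c. card (same_colour S c)" "Suc (card (S \<times> S))"] ker_bound
      by (simp add: le_imp_less_Suc)
    then obtain b where b: "F b \<noteq> 0" and max: "\<And>c. F c \<noteq> 0 \<Longrightarrow> card (same_colour S c) \<le> card (same_colour S b)"
      by blast
    define B where "B = fibres S b"
    have B: "partition_on S B" and sB: "same_block B = same_colour S b"
      unfolding B_def by (rule partition_fibres, rule same_block_fibres)
    obtain d where d: "d {S} = 0"
      "\<And>c. (\<Sum>C | partition_on S C \<and> monochrome C c. d C) = (if monochrome B c then F c else 0)"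
      using H[OF B] unfolding F_def by blast
    \<comment> \<open>The maximality of the kernel of \<open>b\<close> concentrates the sums on its own colourings.\<close>
    have rhs: "(if monochrome B c then F c else 0) = (if same_colour S c = same_block B then F b else 0)" for c
    proof (cases "same_colour S c = same_block B")
      case True
      then show ?thesis using F_kernel[of c b] monochrome_iff_subset[OF B] sB by simp
    next
      case False
      have "F c = 0" if "monochrome B c"
      proof (rule ccontr)
        assume "F c \<noteq> 0"
        then have "card (same_colour S c) \<le> card (same_colour S b)" by (rule max)
        moreover have "same_colour S b \<subseteq> same_colour S c" using that monochrome_iff_subset[OF B] sB by simp
        ultimately have "same_colour S b = same_colour S c" using card_seteq[OF ker_fin] by blast
        then show False using False sB by simp
      qed
      then show ?thesis using False by simp
    qed
    let ?P = "{C. partition_on S C}"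
    have finP: "finite ?P" by (rule finite_partitions[OF S(1)])
    have count: "(\<Sum>C\<in>?P. d C * of_nat m ^ card C) = F b * of_nat (\<Prod>j<card B. m - j)" for m
    proof -
      let ?X = "S \<rightarrow>\<^sub>E {..<m}"
      have finX: "finite ?X" using S(1) by (intro finite_PiE) auto
      have "(\<Sum>C\<in>?P. d C * of_nat m ^ card C) = (\<Sum>C\<in>?P. \<Sum>c\<in>?X. if monochrome C c then d C else 0)"
      proof (rule sum.cong[OF refl])
        fix C assume "C \<in> ?P"
        then have "card {c \<in> ?X. monochrome C c} = m ^ card C"
          using card_respecting_colourings[OF S(1)] by simp
        then show "d C * of_nat m ^ card C = (\<Sum>c\<in>?X. if monochrome C c then d C else 0)"
          using finX by (simp add: sum.inter_filter[symmetric] mult.commute)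
      qed
      also have "\<dots> = (\<Sum>c\<in>?X. \<Sum>C\<in>?P. if monochrome C c then d C else 0)"
        by (rule sum.swap)
      also have "\<dots> = (\<Sum>c\<in>?X. \<Sum>C | partition_on S C \<and> monochrome C c. d C)"
      proof (rule sum.cong[OF refl])
        fix c
        have "{C \<in> ?P. monochrome C c} = {C. partition_on S C \<and> monochrome C c}" by simp
        then show "(\<Sum>C\<in>?P. if monochrome C c then d C else 0) = (\<Sum>C | partition_on S C \<and> monochrome C c. d C)"
          using sum.inter_filter[OF finP, of d "\<lambda>C. monochrome C c"] by simp
      qed
      also have "\<dots> = (\<Sum>c\<in>?X. if same_colour S c = same_block B then F b else 0)"
        by (simp only: d(2) rhs)
      also have "\<dots> = (\<Sum>c\<in>{c \<in> ?X. same_colour S c = same_block B}. F b)"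
        by (rule sum.inter_filter[OF finX, symmetric])
      also have "\<dots> = F b * of_nat (\<Prod>j<card B. m - j)"
        by (simp only: sum_constant card_exact_colourings[OF S(1) B] mult.commute)
      finally show ?thesis .
    qed
    have "B \<noteq> {}" using S(2) B unfolding partition_on_def by auto
    then have "card B \<ge> 1" using finite_elements[OF S(1) B] by (simp add: Suc_le_eq card_gt_0_iff)
    have "F b = 0"
    proof (rule falling_factorial_linear_coefficient[OF finP \<open>card B \<ge> 1\<close> count])
      fix C assume C: "C \<in> ?P" "card C = 1"
      then obtain I where "C = {I}" by (auto simp: card_1_singleton_iff)
      then have "C = {S}" using C(1) unfolding partition_on_def by auto
      then show "d C = 0" using d(1) by simp
    qed
    then show False using b by simp
  qed
  then show "\<And>c. (\<Sum>A | partition_on S A \<and> monochrome A c. \<xi> A) = 0" by (simp add: F_def)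
qed

section \<open>Square linear systems\<close>

text \<open>Gaussian elimination: the unknown \<open>i0\<close> is eliminated by means of the equation \<open>j0\<close>.  The result is used
twice: to pass from an independent family of the right size to a spanning one, and from an injective
to a surjective map into the dual.\<close>

lemma injective_system:
  fixes M :: "'i \<Rightarrow> 'j \<Rightarrow> 'k::field"
  assumes "finite J" "finite I"
    and "\<And>y. (\<And>j. j \<in> J \<Longrightarrow> (\<Sum>i\<in>I. y i * M i j) = 0) \<Longrightarrow> (\<And>i. i \<in> I \<Longrightarrow> y i = 0)"
  shows "card I \<le> card J \<and> (card I = card J \<longrightarrow> (\<forall>x. \<exists>y. \<forall>j\<in>J. (\<Sum>i\<in>I. y i * M i j) = x j))"
  using assms
proof (induction J arbitrary: I M rule: finite_induct)
  case empty
  have "I = {}"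
  proof (rule ccontr)
    assume "I \<noteq> {}"
    then obtain i where "i \<in> I" by blast
    then show False using empty.prems(2)[of "\<lambda>_. 1" i] by simp
  qed
  then show ?case by simp
next
  case (insert j0 J)
  show ?case
  proof (cases "\<exists>i\<in>I. M i j0 \<noteq> 0")
    case False
    then have "(\<Sum>i\<in>I. y i * M i j0) = 0" for y by (intro sum.neutral) auto
    then have "card I \<le> card J"
      using insert.IH[OF insert.prems(1), of M] insert.prems(2) by blast
    then show ?thesis using insert.hyps by simp
  next
    case True
    then obtain i0 where i0: "i0 \<in> I" "M i0 j0 \<noteq> 0" by blast
    define I' where "I' = I - {i0}"
    define N where "N i j = M i j - M i j0 / M i0 j0 * M i0 j" for i j
    have fin': "finite I'" using insert.prems(1) by (simp add: I'_def)
    have cardI: "card I = Suc (card I')"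
      using i0 insert.prems(1) unfolding I'_def by (metis card.remove)
    have split: "(\<Sum>i\<in>I. (y(i0 := t)) i * M i j) = t * M i0 j + (\<Sum>i\<in>I'. y i * M i j)" for y t j
      using sum.remove[OF insert.prems(1) i0(1), of "\<lambda>i. (y(i0 := t)) i * M i j"]
      by (simp add: I'_def)
    have N: "(\<Sum>i\<in>I'. y i * N i j) = (\<Sum>i\<in>I'. y i * M i j) - (\<Sum>i\<in>I'. y i * M i j0) / M i0 j0 * M i0 j" for y j
      by (simp add: N_def algebra_simps sum_subtractf sum_distrib_left sum_divide_distrib)
    have IH: "card I' \<le> card J \<and> (card I' = card J \<longrightarrow> (\<forall>x. \<exists>y. \<forall>j\<in>J. (\<Sum>i\<in>I'. y i * N i j) = x j))"
    proof (rule insert.IH[OF fin'])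
      fix y i assume y: "\<And>j. j \<in> J \<Longrightarrow> (\<Sum>i\<in>I'. y i * N i j) = 0" and i: "i \<in> I'"
      define t where "t = - (\<Sum>i\<in>I'. y i * M i j0) / M i0 j0"
      have "(y(i0 := t)) i = 0"
      proof (rule insert.prems(2))
        fix j assume j: "j \<in> insert j0 J"
        show "(\<Sum>i\<in>I. (y(i0 := t)) i * M i j) = 0"
        proof (cases "j = j0")
          case True
          then show ?thesis unfolding split t_def using i0(2) by simp
        next
          case False
          then show ?thesis unfolding split t_def using y[of j] j N[of y j] by simp
        qed
      qed (use i in \<open>simp add: I'_def\<close>)
      then show "y i = 0" using i by (simp add: I'_def)
    qed
    have "\<exists>y. \<forall>j\<in>insert j0 J. (\<Sum>i\<in>I. y i * M i j) = x j" if "card I = card (insert j0 J)" for x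
    proof -
      have "card I' = card J" using that cardI insert.hyps by simp
      then have "\<forall>x. \<exists>y. \<forall>j\<in>J. (\<Sum>i\<in>I'. y i * N i j) = x j" using IH by blast
      from this[THEN spec[where x = "\<lambda>j. x j - x j0 / M i0 j0 * M i0 j"]]
      obtain y where y: "\<And>j. j \<in> J \<Longrightarrow> (\<Sum>i\<in>I'. y i * N i j) = x j - x j0 / M i0 j0 * M i0 j"
        by blast
      define t where "t = (x j0 - (\<Sum>i\<in>I'. y i * M i j0)) / M i0 j0"
      have "(\<Sum>i\<in>I. (y(i0 := t)) i * M i j) = x j" if j: "j \<in> insert j0 J" for j
      proof (cases "j = j0")
        case True
        then show ?thesis unfolding split t_def using i0(2) by simp
      next
        case False
        have "(\<Sum>i\<in>I'. y i * M i j) = x j - x j0 / M i0 j0 * M i0 j + (\<Sum>i\<in>I'. y i * M i j0) / M i0 j0 * M i0 j"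
          using y[of j] N[of y j] False j by (simp add: algebra_simps)
        then show ?thesis unfolding split t_def by (simp add: diff_divide_distrib algebra_simps)
      qed
      then show ?thesis by blast
    qed
    then show ?thesis using IH cardI insert.hyps by simp
  qed
qed

section \<open>The elements attached to partitions and permutations\<close>

lemma bt_E_part_eq: "bt_E_part n A = BTR.E_part n A"
proof -
  have pair: "bt_E_pair n = BTR.E_pair n"
    by (intro ext) (simp add: bt_E_pair_def BTR.E_pair_def)
  have block: "bt_E_block n = BTR.E_block n"
    by (intro ext) (simp only: bt_E_block_def BTR.E_block_def pair)
  show ?thesis by (simp only: bt_E_part_def BTR.E_part_def block)
qed

definition perm_word :: "nat \<Rightarrow> (nat \<Rightarrow> nat) \<Rightarrow> nat list" where
  "perm_word n w = (SOME is. reduced_expression n w is)"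

lemma reduced_perm_word:
  assumes "w permutes {1..n}"
  shows "reduced_expression n w (perm_word n w)"
proof -
  obtain v where v: "set v \<subseteq> {1..<n} \<and> word_perm v = w" using word_perm_surj[OF assms] by blast
  have "\<exists>is. (set is \<subseteq> {1..<n} \<and> word_perm is = w) \<and>
      (\<forall>js. set js \<subseteq> {1..<n} \<and> word_perm js = w \<longrightarrow> length is \<le> length js)"
    by (rule ex_has_least_nat) (rule v)
  then have "\<exists>is. reduced_expression n w is" unfolding reduced_expression_def by blast
  then show ?thesis unfolding perm_word_def by (rule someI_ex)
qed

lemma perm_word:
  assumes "w permutes {1..n}"
  shows "set (perm_word n w) \<subseteq> {1..<n}" "word_perm (perm_word n w) = w"
  using reduced_perm_word[OF assms] by (simp_all add: reduced_expression_def)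

lemma bt_T_perm_eq: "bt_T_perm n w = BTR.T_word n (perm_word n w)"
  by (simp only: bt_T_perm_def BTR.T_word_def perm_word_def)

text \<open>The empty word is the only shortest word for the identity, whatever the choice operator does.\<close>

lemma bt_T_perm_id: "bt_T_perm n id = \<one>\<^bsub>bt_algebra n\<^esub>"
proof -
  note least = reduced_perm_word[OF permutes_id, of n, unfolded reduced_expression_def, THEN conjunct2, THEN conjunct2]
  have "length (perm_word n id) \<le> length ([] :: nat list)"
    by (rule least[THEN spec, THEN mp]) simp
  then have "perm_word n id = []" by simp
  then show ?thesis unfolding bt_T_perm_eq by simp
qed

section \<open>Specialization of the action\<close>

text \<open>The action of \<open>x\<close> preserves the functions with values regular at \<open>u = 1\<close>, and induces \<open>\<Theta>\<close> on the functions of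
their values.\<close>

definition spec_act :: "nat \<Rightarrow> bt \<Rightarrow> ((cword \<Rightarrow> complex) \<Rightarrow> (cword \<Rightarrow> complex)) \<Rightarrow> bool" where
  "spec_act n x \<Theta> \<longleftrightarrow> (\<forall>\<phi> \<psi>. (\<forall>f. specializes (\<phi> f) (\<psi> f)) \<longrightarrow>
     (\<forall>f. specializes (bt_act n x \<phi> f) (\<Theta> \<psi> f)))"

text \<open>Every complex function is the specialization of itself, read as a function with constant values.\<close>

lemma spec_act_unique:
  assumes "spec_act n x \<Theta>" "spec_act n x \<Theta>'"
  shows "\<Theta> \<psi> f = \<Theta>' \<psi> f"
proof -
  define \<phi> where "\<phi> f = Fract [:\<psi> f:] 1" for f
  have "specializes (\<phi> f) (\<psi> f)" for f
    using specializes_poly[of "[:\<psi> f:]"] by (simp add: \<phi>_def)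
  then show ?thesis
    using assms specializes_unique unfolding spec_act_def by blast
qed

lemma spec_act_mult:
  assumes "spec_act n x \<Theta>" "spec_act n y \<Theta>'" "x \<in> carrier (bt_algebra n)" "y \<in> carrier (bt_algebra n)"
  shows "spec_act n (x \<otimes>\<^bsub>bt_algebra n\<^esub> y) (\<lambda>\<psi>. \<Theta> (\<Theta>' \<psi>))"
  unfolding spec_act_def bt_act_mult[OF assms(3,4)]
proof (intro allI impI)
  fix \<phi> :: "cword \<Rightarrow> ratfun" and \<psi> f assume "\<forall>f. specializes (\<phi> f) (\<psi> f)"
  then have "\<forall>f. specializes (bt_act n y \<phi> f) (\<Theta>' \<psi> f)" using assms(2) unfolding spec_act_def by blast
  then show "specializes (bt_act n x (bt_act n y \<phi>) f) (\<Theta> (\<Theta>' \<psi>) f)"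
    using assms(1) unfolding spec_act_def by blast
qed

lemma spec_act_smult:
  assumes "spec_act n x \<Theta>" "specializes k c" "x \<in> carrier (bt_algebra n)"
  shows "spec_act n (bt_smult n k x) (\<lambda>\<psi> f. c * \<Theta> \<psi> f)"
  using assms unfolding spec_act_def by (simp add: bt_act_smult specializes_mult)

lemma bt_act_zero: "bt_act n \<zero>\<^bsub>bt_algebra n\<^esub> \<phi> f = 0"
  using bt_act_smult[of "\<zero>\<^bsub>bt_algebra n\<^esub>" n 0 \<phi> f] by simp

lemma spec_act_zero: "spec_act n \<zero>\<^bsub>bt_algebra n\<^esub> (\<lambda>\<psi> f. 0)"
  by (simp add: spec_act_def bt_act_zero)

lemma bt_act_finsum:
  assumes "finite I" "g \<in> I \<rightarrow> carrier (bt_algebra n)"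
  shows "bt_act n (finsum (bt_algebra n) (\<lambda>i. bt_smult n (c i) (g i)) I) \<phi> f
    = (\<Sum>i\<in>I. c i * bt_act n (g i) \<phi> f)"
  using assms
proof (induction I rule: finite_induct)
  case empty
  then show ?case by (simp add: bt_act_zero)
next
  case (insert i I)
  have g: "g i \<in> carrier (bt_algebra n)" "(\<lambda>i. bt_smult n (c i) (g i)) \<in> I \<rightarrow> carrier (bt_algebra n)"
    using insert.prems by auto
  show ?case
    using insert g by (simp add: BT.BC.finsum_insert bt_act_add bt_act_smult BT.BC.finsum_closed)
qed

lemma spec_act_combination:
  assumes "finite I" "g \<in> I \<rightarrow> carrier (bt_algebra n)" "\<And>i. i \<in> I \<Longrightarrow> spec_act n (g i) (\<Theta> i)"
    "\<And>i. i \<in> I \<Longrightarrow> specializes (c i) (d i)"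
  shows "spec_act n (finsum (bt_algebra n) (\<lambda>i. bt_smult n (c i) (g i)) I) (\<lambda>\<psi> f. \<Sum>i\<in>I. d i * \<Theta> i \<psi> f)"
  unfolding spec_act_def bt_act_finsum[OF assms(1,2)]
proof (intro allI impI specializes_sum specializes_mult assms(4))
  fix \<phi> :: "cword \<Rightarrow> ratfun" and \<psi> f i assume "\<forall>f. specializes (\<phi> f) (\<psi> f)" "i \<in> I"
  then show "specializes (bt_act n (g i) \<phi> f) (\<Theta> i \<psi> f)" using assms(3) unfolding spec_act_def by blast
qed

text \<open>Permutation of positions followed by restriction to the words with property \<open>P\<close>; the operators of
all standard elements at \<open>u = 1\<close> have this form.\<close>

definition mono_op :: "(cword \<Rightarrow> bool) \<Rightarrow> (nat \<Rightarrow> nat) \<Rightarrow> (cword \<Rightarrow> complex) \<Rightarrow> (cword \<Rightarrow> complex)" where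
  "mono_op P w \<psi> f = (if P f then \<psi> (f \<circ> w) else 0)"

lemma mono_op_comp: "mono_op P w (mono_op P' w' \<psi>) = mono_op (\<lambda>f. P f \<and> P' (f \<circ> w)) (w \<circ> w') \<psi>"
  by (auto simp: mono_op_def fun_eq_iff comp_assoc)

abbreviation perm_inv :: "(nat \<Rightarrow> nat) \<Rightarrow> (nat \<Rightarrow> nat)" where
  "perm_inv w \<equiv> inv_into UNIV w"

text \<open>Both \<open>x\<close> and \<open>x\<^sup>*\<close> specialize, and to operators that are transposed to each other.  The two statements are
kept together because \<open>x\<^sup>*\<close> enters the form and both are proved by the same multiplicative
induction from the generators.\<close>

definition bispec :: "nat \<Rightarrow> bt \<Rightarrow> (cword \<Rightarrow> bool) \<Rightarrow> (nat \<Rightarrow> nat) \<Rightarrow> bool" where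
  "bispec n x P w \<longleftrightarrow> x \<in> carrier (bt_algebra n) \<and> bij w \<and> spec_act n x (mono_op P w) \<and>
     spec_act n (bt_star n x) (mono_op (\<lambda>f. P (f \<circ> perm_inv w)) (perm_inv w))"

lemma bispec_mult:
  assumes x: "bispec n x P w" and y: "bispec n y P' w'"
  shows "bispec n (x \<otimes>\<^bsub>bt_algebra n\<^esub> y) (\<lambda>f. P f \<and> P' (f \<circ> w)) (w \<circ> w')"
proof -
  have c: "x \<in> carrier (bt_algebra n)" "y \<in> carrier (bt_algebra n)" and b: "bij w" "bij w'"
    using x y by (simp_all add: bispec_def)
  have inv: "perm_inv (w \<circ> w') = perm_inv w' \<circ> perm_inv w" using b by (intro o_inv_distrib)
  have cancel: "f \<circ> (perm_inv w' \<circ> perm_inv w) \<circ> w = f \<circ> perm_inv w'" for f :: cword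
    using b by (simp add: fun_eq_iff bij_is_inj)
  have "spec_act n (x \<otimes>\<^bsub>bt_algebra n\<^esub> y) (mono_op (\<lambda>f. P f \<and> P' (f \<circ> w)) (w \<circ> w'))"
    using spec_act_mult[of n x "mono_op P w" y "mono_op P' w'"] x y c
    by (simp add: bispec_def mono_op_comp)
  moreover have "spec_act n (bt_star n (x \<otimes>\<^bsub>bt_algebra n\<^esub> y))
      (mono_op (\<lambda>f. P (f \<circ> perm_inv (w \<circ> w')) \<and> P' (f \<circ> perm_inv (w \<circ> w') \<circ> w)) (perm_inv (w \<circ> w')))"
    unfolding bt_star_mult[OF c] inv cancel
    using spec_act_mult[of n "bt_star n y" "mono_op (\<lambda>f. P' (f \<circ> perm_inv w')) (perm_inv w')" "bt_star n x"
      "mono_op (\<lambda>f. P (f \<circ> perm_inv w)) (perm_inv w)"] x y c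
    by (simp add: bispec_def mono_op_comp comp_assoc conj_commute)
  ultimately show ?thesis using c b by (simp add: bispec_def bij_comp)
qed

lemma bispec_one: "bispec n \<one>\<^bsub>bt_algebra n\<^esub> (\<lambda>f. True) id"
  by (simp add: bispec_def spec_act_def bt_act_gen mono_op_def)

lemma specializes_mult_zero: "specializes x 0 \<Longrightarrow> specializes y c \<Longrightarrow> specializes (x * y) 0"
  using specializes_mult[of x 0 y c] by simp

lemma specializes_op_E:
  assumes "\<And>f. specializes (\<phi> f) (\<psi> f)"
  shows "specializes (op_E i \<phi> f) (mono_op (\<lambda>f. fst (f i) = fst (f (Suc i))) id \<psi> f)"
  using assms by (simp add: op_E_def mono_op_def)

lemma specializes_op_T:
  assumes "\<And>f. specializes (\<phi> f) (\<psi> f)"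
  shows "specializes (op_T i \<phi> f) (mono_op (\<lambda>f. True) (transpose i (Suc i)) \<psi> f)"
proof -
  let ?g = "f \<circ> transpose i (Suc i)"
  consider "fst (f i) \<noteq> fst (f (Suc i)) \<or> snd (f i) < snd (f (Suc i))"
    | "f i = f (Suc i)" | "fst (f i) = fst (f (Suc i))" "snd (f i) > snd (f (Suc i))"
    by (metis linorder_neqE_nat prod_eqI)
  then show ?thesis
  proof cases
    case 1
    then show ?thesis using assms[of ?g] by (simp add: op_T_def mono_op_def swap_coeff_def stay_coeff_def)
  next
    case 2
    then have "?g = f" by (auto simp: fun_eq_iff transpose_def)
    then show ?thesis using 2 specializes_mult[OF specializes_const(3) assms[of f]]
      by (simp add: op_T_def mono_op_def swap_coeff_def stay_coeff_def)
  next
    case 3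
    then show ?thesis
      using specializes_add[OF specializes_mult[OF specializes_const(3) assms[of ?g]]
          specializes_mult[OF specializes_const(4) assms[of f]]]
      by (simp add: op_T_def mono_op_def swap_coeff_def stay_coeff_def)
  qed
qed

lemma perm_inv_transpose: "perm_inv (transpose a b) = transpose a b"
  by (rule inv_unique_comp) (auto simp: fun_eq_iff)

lemma bispec_T:
  assumes "i \<in> {1..<n}"
  shows "bispec n (bt_T n i) (\<lambda>f. True) (transpose i (Suc i))"
  using assms BTR.T_closed[OF assms] bt_star_gen(2)[OF assms] bt_act_gen(1)[OF assms] specializes_op_T
  unfolding bispec_def perm_inv_transpose spec_act_def by (simp only: bij_transpose) blast

lemma bispec_E:
  assumes "i \<in> {1..<n}"
  shows "bispec n (bt_E n i) (\<lambda>f. fst (f i) = fst (f (Suc i))) id"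
  using assms BTR.E_closed[OF assms] bt_star_gen(3)[OF assms] bt_act_gen(2)[OF assms] specializes_op_E
  unfolding bispec_def spec_act_def inv_id comp_id by (simp only: bij_id) blast

lemma specializes_inverse_u: "specializes (inverse u - 1) 0"
proof -
  have "inverse u = Fract 1 [:0, 1:]" by (simp add: u_def)
  then have "specializes (inverse u) 1" using specializesI[of "[:0, 1:]" 1] by simp
  moreover have "specializes (- 1) (- 1)"
    using specializes_poly[of "-1"] by (simp add: fract_collapse flip: minus_fract)
  ultimately show ?thesis using specializes_add by fastforce
qed

lemma bispec_T_inv:
  assumes i: "i \<in> {1..<n}"
  shows "bispec n (BTR.T_inv n i) (\<lambda>f. True) (transpose i (Suc i))"
proof -
  note c = BTR.T_closed[OF i] BTR.E_closed[OF i]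
  have star: "bt_star n (BTR.T_inv n i) = BTR.T_inv n i"
    unfolding BTR.T_inv_def using c i BTR.ET_comm[OF i]
    by (simp add: bt_star_add bt_star_smult bt_star_mult BT.BC.l_distr BT.BC.r_distr del: atLeastLessThan_iff)
  have "spec_act n (BTR.T_inv n i) (mono_op (\<lambda>f. True) (transpose i (Suc i)))"
    unfolding spec_act_def
  proof (intro allI impI)
    fix \<phi> :: "cword \<Rightarrow> ratfun" and \<psi> f assume s: "\<forall>f. specializes (\<phi> f) (\<psi> f)"
    have act: "bt_act n (BTR.T_inv n i) \<phi> f
        = op_T i \<phi> f + (inverse u - 1) * op_E i (\<lambda>f. \<phi> f + op_T i \<phi> f) f"
    proof -
      have "bt_act n (\<one>\<^bsub>bt_algebra n\<^esub> \<oplus>\<^bsub>bt_algebra n\<^esub> bt_T n i) \<phi> = (\<lambda>f. \<phi> f + op_T i \<phi> f)"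
        using c i by (intro ext) (simp add: bt_act_add bt_act_gen del: atLeastLessThan_iff)
      then show ?thesis
        unfolding BTR.T_inv_def using c i
        by (simp add: bt_act_add bt_act_smult bt_act_mult bt_act_gen del: atLeastLessThan_iff)
    qed
    have T: "specializes (op_T i \<phi> f) (mono_op (\<lambda>f. True) (transpose i (Suc i)) \<psi> f)" for f
      using s by (intro specializes_op_T) blast
    have "specializes ((inverse u - 1) * op_E i (\<lambda>f. \<phi> f + op_T i \<phi> f) f) 0"
      by (rule specializes_mult_zero[OF specializes_inverse_u])
        (rule specializes_op_E, rule specializes_add[OF _ T], use s in blast)
    from specializes_add[OF T[of f] this]
    show "specializes (bt_act n (BTR.T_inv n i) \<phi> f) (mono_op (\<lambda>f. True) (transpose i (Suc i)) \<psi> f)"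
      unfolding act by simp
  qed
  then show ?thesis
    unfolding bispec_def star perm_inv_transpose using BTR.T_inv_closed[OF i] by simp
qed

lemma bispec_E_pair:
  assumes "1 \<le> x" "x < y" "y \<le> n"
  shows "bispec n (BTR.E_pair n x y) (\<lambda>f. fst (f x) = fst (f y)) id"
  using assms
proof (induction "y - x" arbitrary: x rule: less_induct)
  case less
  have x: "x \<in> {1..<n}" using less.prems by simp
  show ?case
  proof (cases "y = Suc x")
    case True
    then show ?thesis using bispec_E[OF x] by simp
  next
    case False
    have IH: "bispec n (BTR.E_pair n (Suc x) y) (\<lambda>f. fst (f (Suc x)) = fst (f y)) id"
      using less.prems False by (intro less.hyps) auto
    have eq: "BTR.E_pair n x y = bt_T n x \<otimes>\<^bsub>bt_algebra n\<^esub> BTR.E_pair n (Suc x) y \<otimes>\<^bsub>bt_algebra n\<^esub> BTR.T_inv n x"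
      using BTR.E_pair_rec[of x y n] less.prems False by (simp add: BTR.conj_def)
    have id: "transpose x (Suc x) \<circ> id \<circ> transpose x (Suc x) = id" by simp
    have P: "(True \<and> fst ((f \<circ> transpose x (Suc x)) (Suc x)) = fst ((f \<circ> transpose x (Suc x)) y)) \<and> True
        \<longleftrightarrow> fst (f x) = fst (f y)" for f :: cword
      using less.prems False by (simp add: transpose_def)
    show ?thesis
      using bispec_mult[OF bispec_mult[OF bispec_T[OF x] IH] bispec_T_inv[OF x]] unfolding eq id P .
  qed
qed

lemma bispec_finprod:
  assumes "finite A" "f \<in> A \<rightarrow> BTR.edge_monoid n" "\<And>a. a \<in> A \<Longrightarrow> bispec n (f a) (P a) id"
  shows "bispec n (finprod (bt_algebra n) f A) (\<lambda>g. \<forall>a\<in>A. P a g) id"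
  using assms
proof (induction A rule: finite_induct)
  case empty
  then show ?case using bispec_one by (simp add: id_def)
next
  case (insert a A)
  have eq: "finprod (bt_algebra n) f (insert a A) = f a \<otimes>\<^bsub>bt_algebra n\<^esub> finprod (bt_algebra n) f A"
    using insert by (intro BTR.finprod_edge_insert) auto
  have "bispec n (finprod (bt_algebra n) f A) (\<lambda>g. \<forall>a\<in>A. P a g) id"
    by (rule insert.IH, use insert.prems(1) in blast, rule insert.prems(2), blast)
  from bispec_mult[OF insert.prems(2)[of a] this] show ?case
    by (simp only: eq comp_id ball_simps insertI1 simp_thms)
qed

lemma bispec_E_part:
  assumes A: "partition_on {1..n} A"
  shows "bispec n (bt_E_part n A) (\<lambda>f. monochrome A (fst \<circ> f)) id"
proof -
  have block: "bispec n (BTR.E_block n I) (\<lambda>f. \<forall>i\<in>I. \<forall>j\<in>I. fst (f i) = fst (f j)) id" if I: "I \<in> A" for I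
  proof -
    have sub: "I \<subseteq> {1..n}" by (rule BTR.partition_on_points(3)[OF A I])
    have "bispec n (BTR.E_block n I) (\<lambda>f. \<forall>(i, j)\<in>{(i, j) \<in> I \<times> I. i < j}. fst (f i) = fst (f j)) id"
      unfolding BTR.E_block_def
    proof (rule bispec_finprod[OF BTR.block_pairs[OF sub], of "\<lambda>(i, j) f. fst (f i) = fst (f j)", THEN
          back_subst[of "\<lambda>P. bispec n _ P id"]])
      fix a assume a: "a \<in> {(i, j) \<in> I \<times> I. i < j}"
      then obtain i j where ij: "a = (i, j)" "i \<in> I" "j \<in> I" "i < j" by auto
      then have "1 \<le> i" "j \<le> n" using sub by auto
      then show "bispec n (case a of (i, j) \<Rightarrow> BTR.E_pair n i j) (case a of (i, j) \<Rightarrow> \<lambda>f. fst (f i) = fst (f j)) id"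
        using bispec_E_pair[of i j n] ij by simp
    qed (auto simp: fun_eq_iff)
    moreover have "(\<forall>(i, j)\<in>{(i, j) \<in> I \<times> I. i < j}. fst (f i) = fst (f j)) \<longleftrightarrow>
        (\<forall>i\<in>I. \<forall>j\<in>I. fst (f i) = fst (f j))" for f :: cword
      by (auto, metis linorder_neqE_nat)
    ultimately show ?thesis by simp
  qed
  have "bispec n (BTR.E_part n A) (\<lambda>f. \<forall>I\<in>A. \<forall>i\<in>I. \<forall>j\<in>I. fst (f i) = fst (f j)) id"
    unfolding BTR.E_part_def by (rule bispec_finprod[OF BTR.partition_on_points(1,2)[OF A] block])
  then show ?thesis by (simp add: bt_E_part_eq monochrome_def)
qed

lemma bispec_T_word:
  assumes "set v \<subseteq> {1..<n}"
  shows "bispec n (BTR.T_word n v) (\<lambda>f. True) (word_perm v)"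
  using assms
proof (induction v)
  case Nil
  then show ?case using bispec_one by (simp add: id_def)
next
  case (Cons i v)
  then have i: "i \<in> {1..<n}" and IH: "bispec n (BTR.T_word n v) (\<lambda>f. True) (word_perm v)" by auto
  show ?case
    using bispec_mult[OF bispec_T[OF i] IH] by (simp only: BTR.T_word_Cons word_perm_simps simp_thms)
qed

section \<open>Linear independence\<close>

definition basis_index :: "nat \<Rightarrow> (nat set set \<times> (nat \<Rightarrow> nat)) set" where
  "basis_index n = {A. partition_on {1..n} A} \<times> {w. w permutes {1..n}}"

definition basis_elt :: "nat \<Rightarrow> nat set set \<times> (nat \<Rightarrow> nat) \<Rightarrow> bt" where
  "basis_elt n i = bt_E_part n (fst i) \<otimes>\<^bsub>bt_algebra n\<^esub> bt_T_perm n (snd i)"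

abbreviation index_op :: "nat set set \<times> (nat \<Rightarrow> nat) \<Rightarrow> (cword \<Rightarrow> complex) \<Rightarrow> (cword \<Rightarrow> complex)" where
  "index_op i \<equiv> mono_op (\<lambda>f. monochrome (fst i) (fst \<circ> f)) (snd i)"

lemma bispec_basis_elt:
  assumes "i \<in> basis_index n"
  shows "bispec n (basis_elt n i) (\<lambda>f. monochrome (fst i) (fst \<circ> f)) (snd i)"
proof -
  have A: "partition_on {1..n} (fst i)" and w: "snd i permutes {1..n}"
    using assms by (auto simp: basis_index_def)
  show ?thesis
    using bispec_mult[OF bispec_E_part[OF A] bispec_T_word[OF perm_word(1)[OF w]]]
    by (simp add: basis_elt_def bt_T_perm_eq perm_word(2)[OF w])
qed

lemma basis_elt_closed: "i \<in> basis_index n \<Longrightarrow> basis_elt n i \<in> carrier (bt_algebra n)"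
  using bispec_basis_elt by (simp add: bispec_def)

lemma finite_basis_index: "finite (basis_index n)"
  unfolding basis_index_def by (intro finite_cartesian_product finite_partitions finite_permutations) auto

text \<open>In the word \<open>f\<close> every position has its own label, so the function concentrated at \<open>f \<circ> w0\<close> detects the
permutation \<open>w0\<close> alone, while the colours \<open>c\<close> are still free.\<close>

lemma index_op_sum:
  fixes c :: "nat \<Rightarrow> nat"
  assumes w0: "w0 permutes {1..n}"
  defines "f \<equiv> \<lambda>i. (c i, i)"
  shows "(\<Sum>i\<in>basis_index n. d i * index_op i (\<lambda>h. if h = f \<circ> w0 then 1 else 0) f)
    = (\<Sum>A | partition_on {1..n} A \<and> monochrome A c. d (A, w0))"
proof -
  have f: "f \<circ> w = f \<circ> w0 \<longleftrightarrow> w = w0" for w by (auto simp: f_def fun_eq_iff)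
  have fc: "fst \<circ> f = c" by (auto simp: f_def)
  have finP: "finite {A. partition_on {1..n} A}" by (rule finite_partitions) simp
  have finW: "finite {w. w permutes {1..n}}" by (rule finite_permutations) simp
  have "(\<Sum>i\<in>basis_index n. d i * index_op i (\<lambda>h. if h = f \<circ> w0 then 1 else 0) f)
    = (\<Sum>A | partition_on {1..n} A. \<Sum>w | w permutes {1..n}. if w = w0 then (if monochrome A c then d (A, w) else 0) else 0)"
    unfolding basis_index_def sum.cartesian_product
    by (rule sum.cong) (auto simp: mono_op_def f fc)
  also have "\<dots> = (\<Sum>A | partition_on {1..n} A. if monochrome A c then d (A, w0) else 0)"
    using finW w0 by (simp add: sum.delta)
  also have "\<dots> = (\<Sum>A | partition_on {1..n} A \<and> monochrome A c. d (A, w0))"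
    using sum.inter_filter[OF finP, of "\<lambda>A. d (A, w0)" "\<lambda>A. monochrome A c"] by simp
  finally show ?thesis .
qed

lemma index_op_independent:
  fixes d :: "nat set set \<times> (nat \<Rightarrow> nat) \<Rightarrow> complex"
  assumes "\<And>\<psi> f. (\<Sum>i\<in>basis_index n. d i * index_op i \<psi> f) = 0" and i: "i \<in> basis_index n"
  shows "d i = 0"
proof -
  obtain A w where Aw: "i = (A, w)" "partition_on {1..n} A" "w permutes {1..n}"
    using i by (auto simp: basis_index_def)
  have "d (A, w) = 0"
    by (rule refinement_sums_zero[of "{1..n}" "\<lambda>A. d (A, w)"])
      (use index_op_sum[OF Aw(3), of d] assms(1) Aw(2) in auto)
  then show ?thesis by (simp add: Aw(1))
qed

abbreviation lin_comb :: "nat \<Rightarrow> (nat set set \<times> (nat \<Rightarrow> nat) \<Rightarrow> ratfun) \<Rightarrow> bt" where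
  "lin_comb n c \<equiv> finsum (bt_algebra n) (\<lambda>i. bt_smult n (c i) (basis_elt n i)) (basis_index n)"

lemma lin_comb_closed: "lin_comb n c \<in> carrier (bt_algebra n)"
  by (intro BT.BC.finsum_closed) (auto intro!: BTA.sm_closed basis_elt_closed)

lemma basis_Pi: "basis_elt n \<in> basis_index n \<rightarrow> carrier (bt_algebra n)"
  using basis_elt_closed by blast

lemma lin_comb_smult: "bt_smult n k (lin_comb n c) = lin_comb n (\<lambda>i. k * c i)"
proof -
  have "bt_smult n k (lin_comb n c)
      = finsum (bt_algebra n) (\<lambda>i. bt_smult n k (bt_smult n (c i) (basis_elt n i))) (basis_index n)"
    by (rule BTA.sm_finsum[OF finite_basis_index]) (auto intro!: BTA.sm_closed basis_elt_closed)
  also have "\<dots> = lin_comb n (\<lambda>i. k * c i)"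
    by (rule BT.BC.finsum_cong') (auto simp: BTA.sm_sm basis_elt_closed intro!: BTA.sm_closed)
  finally show ?thesis .
qed

lemma lin_comb_add: "lin_comb n c \<oplus>\<^bsub>bt_algebra n\<^esub> lin_comb n d = lin_comb n (\<lambda>i. c i + d i)"
proof -
  have "lin_comb n (\<lambda>i. c i + d i) = finsum (bt_algebra n)
      (\<lambda>i. bt_smult n (c i) (basis_elt n i) \<oplus>\<^bsub>bt_algebra n\<^esub> bt_smult n (d i) (basis_elt n i)) (basis_index n)"
    by (rule BT.BC.finsum_cong') (auto simp: BTA.sm_add_left basis_elt_closed intro!: BTA.sm_closed)
  also have "\<dots> = lin_comb n c \<oplus>\<^bsub>bt_algebra n\<^esub> lin_comb n d"
    by (rule BT.BC.finsum_addf) (auto intro!: BTA.sm_closed basis_elt_closed)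
  finally show ?thesis ..
qed

lemma spec_act_lin_comb:
  assumes "\<And>i. i \<in> basis_index n \<Longrightarrow> specializes (c i) (d i)"
  shows "spec_act n (lin_comb n c) (\<lambda>\<psi> f. \<Sum>i\<in>basis_index n. d i * index_op i \<psi> f)"
  using bispec_basis_elt assms
  by (intro spec_act_combination finite_basis_index basis_Pi) (auto simp: bispec_def)

text \<open>The coefficient of least valuation at \<open>1\<close> is scaled to \<open>1\<close>.\<close>

lemma scaled_coefficients:
  assumes "i \<in> basis_index n" "c i \<noteq> 0"
  obtains j d where "j \<in> basis_index n" "c j \<noteq> 0" "d j = 1"
    "\<And>i. i \<in> basis_index n \<Longrightarrow> specializes (inverse (c j) * c i) (d i)"
proof -
  obtain j where j: "j \<in> basis_index n" "c j \<noteq> 0" "\<forall>i\<in>basis_index n. \<exists>d. specializes (c i / c j) d"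
    using specializing_scale[OF finite_basis_index, of n c] assms by blast
  then obtain d where d: "\<And>i. i \<in> basis_index n \<Longrightarrow> specializes (c i / c j) (d i)" by metis
  have "d j = 1" using specializes_unique[OF d[OF j(1)], of 1] j(2) by simp
  then show thesis using that[of j d] j d by (simp add: field_simps)
qed

text \<open>The value at \<open>u = 1\<close> of a suitably scaled relation would be a relation between the specialized operators
in which one coefficient is \<open>1\<close>.\<close>

lemma basis_independent:
  assumes zero: "lin_comb n c = \<zero>\<^bsub>bt_algebra n\<^esub>" and i: "i \<in> basis_index n"
  shows "c i = 0"
proof (rule ccontr)
  assume "c i \<noteq> 0"
  then obtain j d where j: "j \<in> basis_index n" "d j = 1"
    "\<And>i. i \<in> basis_index n \<Longrightarrow> specializes (inverse (c j) * c i) (d i)"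
    using scaled_coefficients[OF i, of c] by metis
  have "spec_act n (bt_smult n (inverse (c j)) (lin_comb n c)) (\<lambda>\<psi> f. \<Sum>i\<in>basis_index n. d i * index_op i \<psi> f)"
    unfolding lin_comb_smult by (rule spec_act_lin_comb[OF j(3)])
  then have spec: "spec_act n \<zero>\<^bsub>bt_algebra n\<^esub> (\<lambda>\<psi> f. \<Sum>i\<in>basis_index n. d i * index_op i \<psi> f)"
    by (simp add: zero)
  have "d j = 0"
    by (rule index_op_independent[OF _ j(1)]) (rule spec_act_unique[OF spec spec_act_zero])
  then show False using j(2) by simp
qed

lemma lin_comb_inject:
  assumes "lin_comb n c = lin_comb n d" "i \<in> basis_index n"
  shows "c i = d i"
proof -
  have "lin_comb n (\<lambda>i. c i + (- 1) * d i) = lin_comb n d \<oplus>\<^bsub>bt_algebra n\<^esub> bt_smult n (- 1) (lin_comb n d)"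
    unfolding lin_comb_smult lin_comb_add[symmetric] assms(1) ..
  also have "\<dots> = \<zero>\<^bsub>bt_algebra n\<^esub>"
    using lin_comb_closed[of n d] by (simp add: BTA.sm_minus_one BT.BC.r_neg)
  finally have "c i + (- 1) * d i = 0" by (rule basis_independent[OF _ assms(2)])
  then show ?thesis by simp
qed

text \<open>Otherwise some coordinate has a pole at \<open>1\<close>.  Division by the coordinate with the highest pole turns the
action into one that specializes to \<open>0\<close>, while one coordinate becomes \<open>1\<close>; this contradicts the
independence of the specialized operators.\<close>

lemma specializing_coordinates:
  assumes spec: "spec_act n (lin_comb n c) \<Theta>"
  obtains e where "\<And>i. i \<in> basis_index n \<Longrightarrow> specializes (c i) (e i)"
    "\<And>\<psi> f. (\<Sum>i\<in>basis_index n. e i * index_op i \<psi> f) = \<Theta> \<psi> f"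
proof (cases "\<forall>i\<in>basis_index n. \<exists>e. specializes (c i) e")
  case True
  then obtain e where e: "\<And>i. i \<in> basis_index n \<Longrightarrow> specializes (c i) (e i)" by metis
  then show thesis using that[OF e] spec_act_unique[OF spec_act_lin_comb[OF e] spec] by blast
next
  case False
  then obtain i where i: "i \<in> basis_index n" "\<nexists>e. specializes (c i) e" by blast
  then have "c i \<noteq> 0" using specializes_const(1) by metis
  then obtain j d where j: "j \<in> basis_index n" "c j \<noteq> 0" "d j = 1"
    "\<And>i. i \<in> basis_index n \<Longrightarrow> specializes (inverse (c j) * c i) (d i)"
    using scaled_coefficients[OF i(1), of c] by metis
  have "\<nexists>e. specializes (c j) e"
  proof
    assume "\<exists>e. specializes (c j) e"
    then obtain e where "specializes (c j) e" ..
    from specializes_mult[OF this j(4)[OF i(1)]] have "specializes (c j * (inverse (c j) * c i)) (e * d i)" .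
    moreover have "c j * (inverse (c j) * c i) = c i" using j(2) by simp
    ultimately show False using i(2) by auto
  qed
  then have "specializes (inverse (c j)) 0" using specializes_valuation[OF j(2)] by blast
  from spec_act_smult[OF spec this lin_comb_closed]
  have 1: "spec_act n (lin_comb n (\<lambda>i. inverse (c j) * c i)) (\<lambda>\<psi> f. 0)"
    unfolding lin_comb_smult by simp
  have "d j = 0"
    by (rule index_op_independent[OF _ j(1)]) (rule spec_act_unique[OF spec_act_lin_comb[OF j(4)] 1])
  then show thesis using j(3) by simp
qed

section \<open>Spanning\<close>

definition nf_index :: "nat \<Rightarrow> (nat set set \<times> nat list) set" where
  "nf_index n = {A. partition_on {1..n} A} \<times> nf_words (n - 1)"

definition nf_elt :: "nat \<Rightarrow> nat set set \<times> nat list \<Rightarrow> bt" where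
  "nf_elt n j = bt_E_part n (fst j) \<otimes>\<^bsub>bt_algebra n\<^esub> BTR.T_word n (snd j)"

lemma nf_set_eq:
  shows "BTR.nf_set n (n - 1) = nf_elt n ` nf_index n"
proof (intro equalityI subsetI)
  fix g assume "g \<in> BTR.nf_set n (n - 1)"
  then obtain q v where g: "q \<in> BTR.edge_monoid n" "v \<in> nf_words (n - 1)"
    "g = q \<otimes>\<^bsub>bt_algebra n\<^esub> BTR.T_word n v"
    by (auto simp: BTR.nf_set_def)
  obtain A where A: "partition_on {1..n} A" "q = BTR.E_part n A"
    using BTR.edge_monoid_E_part[OF g(1)] by blast
  show "g \<in> nf_elt n ` nf_index n"
    unfolding g(3) A(2) bt_E_part_eq[symmetric]
    by (rule image_eqI[of _ _ "(A, v)"]) (simp add: nf_elt_def, use A(1) g(2) in \<open>simp add: nf_index_def\<close>)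
next
  fix g assume "g \<in> nf_elt n ` nf_index n"
  then obtain A v where g: "partition_on {1..n} A" "v \<in> nf_words (n - 1)" "g = nf_elt n (A, v)"
    by (auto simp: nf_index_def)
  show "g \<in> BTR.nf_set n (n - 1)"
    unfolding g(3) nf_elt_def fst_conv snd_conv bt_E_part_eq
    by (rule BTR.nf_setI[OF BTR.E_part_edge_monoid[OF g(1)] g(2)])
qed

lemma Nil_nf_words: "[] \<in> nf_words m"
proof (induction m)
  case (Suc m)
  show ?case using BTR.nf_words_SucI[OF Suc.IH, of "m + 2"] by (simp del: nf_words.simps)
qed simp

lemma nf_span:
  assumes n: "n \<ge> 1" and x: "x \<in> carrier (bt_algebra n)"
  shows "x \<in> BTA.lspan n (BTR.nf_set n (n - 1))"
proof -
  have m: "n - 1 < n" using n by simp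
  note G = BTR.nf_set_carrier[OF m]
  show ?thesis
    using x
  proof (induction x rule: bt_algebra_induct)
    case one
    have "[] \<in> nf_words (n - 1)" by (rule Nil_nf_words)
    then have "\<one>\<^bsub>bt_algebra n\<^esub> \<otimes>\<^bsub>bt_algebra n\<^esub> BTR.T_word n [] \<in> BTR.nf_set n (n - 1)"
      by (intro BTR.nf_setI BTR.edge_monoid.one)
    then show ?case using BTA.lspan_base[OF G] by simp
  next
    case (T x i)
    have "i \<in> {1..n - 1}" using T.hyps by auto
    then show ?case using BTR.lspan_nf_T[OF m _ T.IH] by blast
  next
    case (E x i)
    have i: "i \<in> {1..n}" "Suc i \<in> {1..n}" "i \<noteq> Suc i" using E.hyps by auto
    show ?case using BTR.lspan_nf_edge[OF m i E.IH] by (simp add: BTR.E_edge_less)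
  next
    case (add x y)
    show ?case by (rule BTA.lspan_add[OF G add.IH])
  next
    case (smult x k)
    show ?case by (rule BTA.lspan_smult[OF G smult.IH])
  qed
qed

lemma card_nf_index: "n \<ge> 1 \<Longrightarrow> card (nf_index n) \<le> card (basis_index n)"
  using card_nf_words[of "n - 1"] card_permutations[of "{1..n}" n]
  by (simp add: nf_index_def basis_index_def card_cartesian_product del: fact_Suc)

text \<open>The normal forms span and are at most as many as the standard elements, which are independent.  Thus the
matrix that expresses the latter by the former is square and injective, hence invertible.  For
this reason nothing needs to be known about the reduced words chosen for the \<open>T\<^sub>w\<close>.\<close>

lemma basis_span:
  assumes n: "n \<ge> 1" and x: "x \<in> carrier (bt_algebra n)"
  obtains c where "x = lin_comb n c"
proof -
  have m: "n - 1 < n" using n by simp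
  have finJ: "finite (nf_index n)"
    unfolding nf_index_def by (intro finite_cartesian_product finite_partitions finite_nf_words) simp
  have h: "nf_elt n \<in> nf_index n \<rightarrow> carrier (bt_algebra n)"
    using BTR.nf_set_carrier[OF m] unfolding nf_set_eq by blast
  let ?comb = "\<lambda>c. finsum (bt_algebra n) (\<lambda>j. bt_smult n (c j) (nf_elt n j)) (nf_index n)"
  have ex: "\<exists>c. y = ?comb c" if y: "y \<in> carrier (bt_algebra n)" for y
  proof (rule BTA.lspan_finsum[OF finJ h nf_span[OF n y, unfolded nf_set_eq]])
    fix c assume "y = ?comb c"
    then show ?thesis by (intro exI[of _ c])
  qed
  have "\<forall>i\<in>basis_index n. \<exists>c. basis_elt n i = ?comb c"
    by (intro ballI ex basis_elt_closed)
  from bchoice[OF this] obtain M where M': "\<forall>i\<in>basis_index n. basis_elt n i = ?comb (M i)" by blast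
  note M = M'[rule_format]
  have hc: "nf_elt n j \<in> carrier (bt_algebra n)" if "j \<in> nf_index n" for j using h that by blast
  have comb: "lin_comb n y = ?comb (\<lambda>j. \<Sum>i\<in>basis_index n. y i * M i j)" for y
  proof -
    have "lin_comb n y = finsum (bt_algebra n) (\<lambda>i. finsum (bt_algebra n)
        (\<lambda>j. bt_smult n (y i * M i j) (nf_elt n j)) (nf_index n)) (basis_index n)"
    proof (rule BT.BC.finsum_cong')
      fix i assume i: "i \<in> basis_index n"
      have "bt_smult n (y i) (?comb (M i))
          = finsum (bt_algebra n) (\<lambda>j. bt_smult n (y i) (bt_smult n (M i j) (nf_elt n j))) (nf_index n)"
        by (rule BTA.sm_finsum[OF finJ]) (auto intro!: BTA.sm_closed hc)
      also have "\<dots> = finsum (bt_algebra n) (\<lambda>j. bt_smult n (y i * M i j) (nf_elt n j)) (nf_index n)"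
        by (rule BT.BC.finsum_cong') (auto simp: BTA.sm_sm hc intro!: BTA.sm_closed)
      finally show "bt_smult n (y i) (basis_elt n i)
          = finsum (bt_algebra n) (\<lambda>j. bt_smult n (y i * M i j) (nf_elt n j)) (nf_index n)"
        unfolding M[OF i] .
    qed (auto intro!: BT.BC.finsum_closed BTA.sm_closed hc)
    also have "\<dots> = finsum (bt_algebra n) (\<lambda>j. finsum (bt_algebra n)
        (\<lambda>i. bt_smult n (y i * M i j) (nf_elt n j)) (basis_index n)) (nf_index n)"
      by (rule BTA.finsum_swap_sum[OF finite_basis_index finJ]) (auto intro!: BTA.sm_closed hc)
    also have "\<dots> = ?comb (\<lambda>j. \<Sum>i\<in>basis_index n. y i * M i j)"
      by (rule BT.BC.finsum_cong')
        (auto simp: BTA.finsum_sm_sum[OF finite_basis_index] hc intro!: BTA.sm_closed)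
    finally show ?thesis .
  qed
  have "card (basis_index n) \<le> card (nf_index n) \<and> (card (basis_index n) = card (nf_index n) \<longrightarrow>
      (\<forall>x. \<exists>y. \<forall>j\<in>nf_index n. (\<Sum>i\<in>basis_index n. y i * M i j) = x j))"
  proof (rule injective_system[OF finJ finite_basis_index])
    fix y i assume y: "\<And>j. j \<in> nf_index n \<Longrightarrow> (\<Sum>i\<in>basis_index n. y i * M i j) = 0" and i: "i \<in> basis_index n"
    have "?comb (\<lambda>j. \<Sum>i\<in>basis_index n. y i * M i j) = \<zero>\<^bsub>bt_algebra n\<^esub>"
      by (rule BT.BC.add.finprod_one_eqI) (simp add: y hc)
    then show "y i = 0" using basis_independent[OF _ i] comb by simp
  qed
  then have solve: "\<exists>y. \<forall>j\<in>nf_index n. (\<Sum>i\<in>basis_index n. y i * M i j) = c j" for c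
    using card_nf_index[OF n] by simp
  obtain c where c: "x = ?comb c" using ex[OF x] by blast
  obtain y where y: "\<And>j. j \<in> nf_index n \<Longrightarrow> (\<Sum>i\<in>basis_index n. y i * M i j) = c j" using solve by blast
  have "lin_comb n y = ?comb c"
    unfolding comb by (rule BT.BC.finsum_cong') (auto simp: y intro!: BTA.sm_closed hc)
  then have "x = lin_comb n y" using c by simp
  then show thesis by (rule that)
qed

section \<open>The functional and the bilinear form\<close>

text \<open>Independence of the indexed family also separates its members; the functional is defined by coordinates
on the set of standard elements, so this is needed to compute it from indexed coordinates.\<close>

lemma inj_basis_elt: "inj_on (basis_elt n) (basis_index n)"
proof (rule inj_onI, rule ccontr)
  fix i j assume i: "i \<in> basis_index n" and j: "j \<in> basis_index n"
    and eq: "basis_elt n i = basis_elt n j" and ne: "i \<noteq> j"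
  have unit: "lin_comb n (\<lambda>k. if k = l then 1 else 0) = basis_elt n l" if l: "l \<in> basis_index n" for l
  proof -
    have "lin_comb n (\<lambda>k. if k = l then 1 else 0)
        = finsum (bt_algebra n) (\<lambda>k. if l = k then basis_elt n k else \<zero>\<^bsub>bt_algebra n\<^esub>) (basis_index n)"
      by (rule BT.BC.finsum_cong') (auto simp: basis_elt_closed)
    also have "\<dots> = basis_elt n l"
      by (rule BT.BC.finsum_singleton[OF l finite_basis_index basis_Pi])
    finally show ?thesis .
  qed
  have "(if i = i then 1 else 0 :: ratfun) = (if i = j then 1 else 0)"
    by (rule lin_comb_inject[OF _ i]) (simp only: unit[OF i] unit[OF j] eq)
  then show False using ne by simp
qed

lemma bt_basis_eq: "bt_basis n = basis_elt n ` basis_index n"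
proof (intro equalityI subsetI)
  fix g assume "g \<in> bt_basis n"
  then obtain A w where "g = basis_elt n (A, w)" "(A, w) \<in> basis_index n"
    by (auto simp: bt_basis_def basis_elt_def basis_index_def)
  then show "g \<in> basis_elt n ` basis_index n" by (rule image_eqI)
next
  fix g assume "g \<in> basis_elt n ` basis_index n"
  then obtain A w where Aw: "partition_on {1..n} A" "w permutes {1..n}" "g = basis_elt n (A, w)"
    by (auto simp: basis_index_def)
  show "g \<in> bt_basis n"
    unfolding bt_basis_def Aw(3) basis_elt_def fst_conv snd_conv using Aw(1,2) by blast
qed

definition top_index :: "nat \<Rightarrow> nat set set \<times> (nat \<Rightarrow> nat)" where
  "top_index n = ({{1..n}}, id)"

lemma top_partition: "n \<ge> 1 \<Longrightarrow> partition_on {1..n} {{1..n :: nat}}"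
  by (rule partition_on_space) (simp add: not_less)

lemma top_index: "n \<ge> 1 \<Longrightarrow> top_index n \<in> basis_index n"
  unfolding top_index_def basis_index_def by (intro SigmaI CollectI top_partition permutes_id)

lemma basis_elt_top: "n \<ge> 1 \<Longrightarrow> basis_elt n (top_index n) = bt_E_part n {{1..n}}"
  using bispec_E_part[OF top_partition]
  by (simp add: basis_elt_def top_index_def bt_T_perm_id bispec_def)

lemma bt_eps_lin_comb:
  assumes n: "n \<ge> 1"
  shows "bt_eps n (lin_comb n c) = c (top_index n)"
proof -
  have comb: "finsum (bt_algebra n) (\<lambda>g. bt_smult n (d g) g) (bt_basis n) = lin_comb n (\<lambda>i. d (basis_elt n i))" for d
    unfolding bt_basis_eq
    by (rule BT.BC.finsum_reindex[OF _ inj_basis_elt]) (auto intro!: BTA.sm_closed basis_elt_closed)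
  show ?thesis
    unfolding bt_eps_def
  proof (rule the_equality)
    define d where "d g = c (inv_into (basis_index n) (basis_elt n) g)" for g
    have d: "d (basis_elt n i) = c i" if "i \<in> basis_index n" for i
      by (simp add: d_def inv_into_f_f[OF inj_basis_elt that])
    have "lin_comb n c = lin_comb n (\<lambda>i. d (basis_elt n i))"
      by (rule BT.BC.finsum_cong') (auto simp: d basis_elt_closed intro!: BTA.sm_closed)
    then show "\<exists>d. lin_comb n c = finsum (bt_algebra n) (\<lambda>g. bt_smult n (d g) g) (bt_basis n) \<and>
        c (top_index n) = d (bt_E_part n {{1..n}})"
      unfolding comb using d[OF top_index[OF n]] basis_elt_top[OF n] by (intro exI[of _ d] HOL.conjI) simp_all
  next
    fix a assume "\<exists>d. lin_comb n c = finsum (bt_algebra n) (\<lambda>g. bt_smult n (d g) g) (bt_basis n) \<and>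
        a = d (bt_E_part n {{1..n}})"
    then obtain d where d: "lin_comb n c = lin_comb n (\<lambda>i. d (basis_elt n i))" "a = d (bt_E_part n {{1..n}})"
      unfolding comb by blast
    show "a = c (top_index n)"
      using lin_comb_inject[OF d(1) top_index[OF n]] d(2) basis_elt_top[OF n] by simp
  qed
qed

lemma bt_eps_linear:
  assumes n: "n \<ge> 1" and x: "x \<in> carrier (bt_algebra n)"
  shows bt_eps_add: "y \<in> carrier (bt_algebra n) \<Longrightarrow> bt_eps n (x \<oplus>\<^bsub>bt_algebra n\<^esub> y) = bt_eps n x + bt_eps n y"
    and bt_eps_smult: "bt_eps n (bt_smult n k x) = k * bt_eps n x"
proof -
  obtain c where c: "x = lin_comb n c" using basis_span[OF n x] .
  show "bt_eps n (bt_smult n k x) = k * bt_eps n x"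
    unfolding c lin_comb_smult bt_eps_lin_comb[OF n] ..
  assume "y \<in> carrier (bt_algebra n)"
  then obtain d where d: "y = lin_comb n d" using basis_span[OF n] by blast
  show "bt_eps n (x \<oplus>\<^bsub>bt_algebra n\<^esub> y) = bt_eps n x + bt_eps n y"
    unfolding c d lin_comb_add bt_eps_lin_comb[OF n] ..
qed

lemma bt_form_linear:
  assumes n: "n \<ge> 1" and x: "x \<in> carrier (bt_algebra n)" and y: "y \<in> carrier (bt_algebra n)"
  shows bt_form_add_left: "z \<in> carrier (bt_algebra n) \<Longrightarrow>
      bt_form n (x \<oplus>\<^bsub>bt_algebra n\<^esub> z) y = bt_form n x y + bt_form n z y"
    and bt_form_add_right: "z \<in> carrier (bt_algebra n) \<Longrightarrow>
      bt_form n x (y \<oplus>\<^bsub>bt_algebra n\<^esub> z) = bt_form n x y + bt_form n x z"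
    and bt_form_smult_left: "bt_form n (bt_smult n k x) y = k * bt_form n x y"
    and bt_form_smult_right: "bt_form n x (bt_smult n k y) = k * bt_form n x y"
  using x y n unfolding bt_form_def
  by (simp_all add: bt_star_add bt_star_smult BT.BC.l_distr BT.BC.r_distr bt_eps_add bt_eps_smult
      BTA.sm_mult_left BTA.sm_mult_right)

lemma bt_form_zero:
  assumes n: "n \<ge> 1" and y: "y \<in> carrier (bt_algebra n)"
  shows "bt_form n \<zero>\<^bsub>bt_algebra n\<^esub> y = 0" "bt_form n y \<zero>\<^bsub>bt_algebra n\<^esub> = 0"
  using bt_form_smult_left[OF n _ y, of "\<zero>\<^bsub>bt_algebra n\<^esub>" 0]
    bt_form_smult_right[OF n y, of "\<zero>\<^bsub>bt_algebra n\<^esub>" 0] by simp_all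

lemma bt_form_sum:
  assumes n: "n \<ge> 1" and y: "y \<in> carrier (bt_algebra n)"
  shows bt_form_lin_comb_left: "bt_form n (lin_comb n c) y = (\<Sum>i\<in>basis_index n. c i * bt_form n (basis_elt n i) y)"
    and bt_form_lin_comb_right: "bt_form n y (lin_comb n c) = (\<Sum>i\<in>basis_index n. c i * bt_form n y (basis_elt n i))"
proof -
  have "bt_form n (finsum (bt_algebra n) (\<lambda>i. bt_smult n (c i) (basis_elt n i)) I) y
        = (\<Sum>i\<in>I. c i * bt_form n (basis_elt n i) y) \<and>
      bt_form n y (finsum (bt_algebra n) (\<lambda>i. bt_smult n (c i) (basis_elt n i)) I)
        = (\<Sum>i\<in>I. c i * bt_form n y (basis_elt n i))"
    if "finite I" "I \<subseteq> basis_index n" for I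
    using that
  proof (induction I rule: finite_induct)
    case empty
    then show ?case using bt_form_zero[OF n y] by simp
  next
    case (insert i I)
    have b: "basis_elt n i \<in> carrier (bt_algebra n)" using insert.prems basis_elt_closed by blast
    have g: "(\<lambda>i. bt_smult n (c i) (basis_elt n i)) \<in> I \<rightarrow> carrier (bt_algebra n)"
      using insert.prems basis_elt_closed by (auto intro!: BTA.sm_closed)
    have s: "finsum (bt_algebra n) (\<lambda>i. bt_smult n (c i) (basis_elt n i)) I \<in> carrier (bt_algebra n)"
      by (rule BT.BC.finsum_closed[OF g])
    have eq: "finsum (bt_algebra n) (\<lambda>i. bt_smult n (c i) (basis_elt n i)) (insert i I)
      = bt_smult n (c i) (basis_elt n i) \<oplus>\<^bsub>bt_algebra n\<^esub>
        finsum (bt_algebra n) (\<lambda>i. bt_smult n (c i) (basis_elt n i)) I"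
      by (rule BT.BC.finsum_insert[OF insert.hyps g BTA.sm_closed[OF b]])
    show ?case
      using insert b s y n unfolding eq
      by (simp add: bt_form_add_left bt_form_add_right bt_form_smult_left bt_form_smult_right)
  qed
  from this[OF finite_basis_index subset_refl]
  show "bt_form n (lin_comb n c) y = (\<Sum>i\<in>basis_index n. c i * bt_form n (basis_elt n i) y)"
    "bt_form n y (lin_comb n c) = (\<Sum>i\<in>basis_index n. c i * bt_form n y (basis_elt n i))" by simp_all
qed

section \<open>Nondegeneracy\<close>

lemma partition_on_permute:
  assumes w: "w permutes S" and C: "partition_on S C"
  shows "partition_on S ((`) ((`) w) C)"
  unfolding partition_on_def
proof (intro conjI)
  have "\<Union> ((`) ((`) w) C) = w ` \<Union> C" by blast
  then show "\<Union> ((`) ((`) w) C) = S"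
    using permutes_image[OF w] partition_onD1[OF C] by simp
  show "{} \<notin> (`) ((`) w) C" using partition_onD3[OF C] by auto
  show "disjoint ((`) ((`) w) C)"
  proof (rule disjointI)
    fix a b assume "a \<in> (`) ((`) w) C" "b \<in> (`) ((`) w) C" "a \<noteq> b"
    then obtain I J where IJ: "I \<in> C" "J \<in> C" "a = w ` I" "b = w ` J" "I \<noteq> J" by blast
    have "I \<inter> J = {}" by (rule disjointD[OF partition_onD2[OF C] IJ(1,2,5)])
    then show "a \<inter> b = {}"
      unfolding IJ(3,4) image_Int[OF permutes_inj[OF w], symmetric] by simp
  qed
qed

lemma monochrome_image: "monochrome ((`) ((`) w) C) c \<longleftrightarrow> monochrome C (c \<circ> w)"
  by (auto simp: monochrome_def)

text \<open>The blocks of \<open>C\<close> are monochromatic for \<open>c\<close> if and only if their preimages under \<open>z\<close> are so for \<open>c \<circ> z\<close>.\<close>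

lemma sum_permuted_partitions:
  assumes z: "z permutes S"
  shows "(\<Sum>C | partition_on S C \<and> monochrome C c. e ((`) ((`) (perm_inv z)) C))
    = (\<Sum>C | partition_on S C \<and> monochrome C (c \<circ> z). e C)"
proof (rule sum.reindex_bij_witness[where i = "(`) ((`) z)" and j = "(`) ((`) (perm_inv z))"])
  have z': "perm_inv z permutes S" by (rule permutes_inv[OF z])
  have zz: "z ` perm_inv z ` I = I" "perm_inv z ` z ` I = I" for I
    using permutes_inverses[OF z] by (simp_all add: image_image)
  fix C
  show "(`) ((`) z) ((`) ((`) (perm_inv z)) C) = C" "(`) ((`) (perm_inv z)) ((`) ((`) z) C) = C"
    by (simp_all only: image_image[of "(`) z" "(`) (perm_inv z)"] image_image[of "(`) (perm_inv z)" "(`) z"]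
        zz image_ident)
  have zc: "c \<circ> z \<circ> perm_inv z = c" using permutes_inverses[OF z] by (simp add: fun_eq_iff)
  show "(`) ((`) (perm_inv z)) C \<in> {C. partition_on S C \<and> monochrome C (c \<circ> z)}"
    if "C \<in> {C. partition_on S C \<and> monochrome C c}"
    using that partition_on_permute[OF z'] by (simp add: monochrome_image zc)
  show "(`) ((`) z) C \<in> {C. partition_on S C \<and> monochrome C c}"
    if "C \<in> {C. partition_on S C \<and> monochrome C (c \<circ> z)}"
    using that partition_on_permute[OF z] by (simp add: monochrome_image)
qed simp

lemma bt_star_lin_comb:
  "bt_star n (lin_comb n c)
    = finsum (bt_algebra n) (\<lambda>i. bt_smult n (c i) (bt_star n (basis_elt n i))) (basis_index n)"
proof -
  have zero: "bt_star n \<zero>\<^bsub>bt_algebra n\<^esub> = \<zero>\<^bsub>bt_algebra n\<^esub>"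
    using bt_star_smult[of "\<zero>\<^bsub>bt_algebra n\<^esub>" n 0] by simp
  have "bt_star n (finsum (bt_algebra n) (\<lambda>i. bt_smult n (c i) (basis_elt n i)) I)
      = finsum (bt_algebra n) (\<lambda>i. bt_smult n (c i) (bt_star n (basis_elt n i))) I"
    if "finite I" "I \<subseteq> basis_index n" for I
    using that
  proof (induction I rule: finite_induct)
    case empty
    then show ?case by (simp add: zero)
  next
    case (insert i I)
    have b: "basis_elt n j \<in> carrier (bt_algebra n)" if "j \<in> insert i I" for j
      using insert.prems basis_elt_closed that by blast
    have g: "(\<lambda>i. bt_smult n (c i) (basis_elt n i)) \<in> I \<rightarrow> carrier (bt_algebra n)"
      "(\<lambda>i. bt_smult n (c i) (bt_star n (basis_elt n i))) \<in> I \<rightarrow> carrier (bt_algebra n)"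
      using b by auto
    have bi: "basis_elt n i \<in> carrier (bt_algebra n)" by (rule b) simp
    show ?case
      unfolding BT.BC.finsum_insert[OF insert.hyps g(1) BTA.sm_closed[OF bi]]
        BT.BC.finsum_insert[OF insert.hyps g(2) BTA.sm_closed[OF bt_star_closed[OF bi]]]
      using insert bi BT.BC.finsum_closed[OF g(1)] by (simp add: bt_star_add bt_star_smult)
  qed
  then show ?thesis using finite_basis_index by blast
qed

text \<open>Let \<open>x\<close> be in the radical, scaled so that one of its coordinates becomes \<open>1\<close>, say the one with
permutation \<open>z\<close>, and the others are regular at \<open>u = 1\<close>.  For every \<open>B\<close> the element \<open>x\<^sup>* E\<^sub>B T\<^sub>z\<close>
has coordinates that are regular at \<open>1\<close>, the one at the one-block partition being \<open>0\<close>.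
Evaluation of its specialized action on functions concentrated at one word turns this into the
hypothesis of \<open>coarsest_colouring\<close>.\<close>

lemma bt_form_nondegenerate:
  assumes n: "n \<ge> 1" and x: "x \<in> carrier (bt_algebra n)"
    and zero: "\<And>y. y \<in> carrier (bt_algebra n) \<Longrightarrow> bt_form n x y = 0"
  shows "x = \<zero>\<^bsub>bt_algebra n\<^esub>"
proof -
  let ?S = "{1..n}"
  obtain \<xi> where \<xi>: "x = lin_comb n \<xi>" using basis_span[OF n x] .
  have "\<xi> i = 0" if i: "i \<in> basis_index n" for i
  proof (rule ccontr)
    assume "\<xi> i \<noteq> 0"
    then obtain j d where j: "j \<in> basis_index n" "d j = 1"
      "\<And>i. i \<in> basis_index n \<Longrightarrow> specializes (inverse (\<xi> j) * \<xi> i) (d i)"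
      using scaled_coefficients[OF i, of \<xi>] by metis
    define x' where "x' = lin_comb n (\<lambda>i. inverse (\<xi> j) * \<xi> i)"
    have x'_eq: "x' = bt_smult n (inverse (\<xi> j)) x" unfolding x'_def \<xi> lin_comb_smult ..
    have x'c: "x' \<in> carrier (bt_algebra n)" unfolding x'_def by (rule lin_comb_closed)
    obtain D z where Dz: "j = (D, z)" and D: "partition_on ?S D" and z: "z permutes ?S"
      using j(1) by (auto simp: basis_index_def)
    let ?inv_op = "\<lambda>i. mono_op (\<lambda>f. monochrome (fst i) (fst \<circ> (f \<circ> perm_inv (snd i)))) (perm_inv (snd i))"
    have spec_x': "spec_act n (bt_star n x') (\<lambda>\<psi> f. \<Sum>i\<in>basis_index n. d i * ?inv_op i \<psi> f)"
      unfolding x'_def bt_star_lin_comb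
    proof (rule spec_act_combination[OF finite_basis_index])
      fix i assume i: "i \<in> basis_index n"
      show "spec_act n (bt_star n (basis_elt n i)) (?inv_op i)"
        using bispec_basis_elt[OF i] by (simp add: bispec_def)
    qed (use j(3) basis_elt_closed in auto)
    have "\<exists>e'. e' {?S} = 0 \<and> (\<forall>c. (\<Sum>C | partition_on ?S C \<and> monochrome C c. e' C) =
        (if monochrome B c then \<Sum>A | partition_on ?S A \<and> monochrome A c. d (A, z) else 0))"
      if B: "partition_on ?S B" for B
    proof -
      have Bz: "(B, z) \<in> basis_index n" using B z by (simp add: basis_index_def)
      let ?y = "basis_elt n (B, z)"
      have yc: "?y \<in> carrier (bt_algebra n)" by (rule basis_elt_closed[OF Bz])
      have Xc: "bt_star n x' \<otimes>\<^bsub>bt_algebra n\<^esub> ?y \<in> carrier (bt_algebra n)" using x'c yc by simp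
      obtain c where c: "bt_star n x' \<otimes>\<^bsub>bt_algebra n\<^esub> ?y = lin_comb n c" using basis_span[OF n Xc] .
      have "bt_form n x' ?y = 0"
        unfolding x'_eq using bt_form_smult_left[OF n x yc] zero[OF yc] by simp
      then have c0: "c (top_index n) = 0" unfolding bt_form_def c bt_eps_lin_comb[OF n] .
      let ?\<Theta> = "\<lambda>\<psi> f. \<Sum>i\<in>basis_index n. d i * ?inv_op i (index_op (B, z) \<psi>) f"
      have "spec_act n ?y (index_op (B, z))"
        using bispec_basis_elt[OF Bz] by (simp add: bispec_def)
      from spec_act_mult[OF spec_x' this bt_star_closed[OF x'c] yc]
      have "spec_act n (lin_comb n c) ?\<Theta>" unfolding c .
      then obtain e where e: "\<And>i. i \<in> basis_index n \<Longrightarrow> specializes (c i) (e i)"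
        "\<And>\<psi> f. (\<Sum>i\<in>basis_index n. e i * index_op i \<psi> f) = ?\<Theta> \<psi> f"
        by (rule specializing_coordinates) blast
      have e0: "e ({?S}, id) = 0"
        using e(1)[OF top_index[OF n]] c0 specializes_unique[OF _ specializes_const(1)]
        by (simp add: top_index_def)
      \<comment> \<open>The identity component of \<open>x\<^sup>* E\<^sub>B T\<^sub>z\<close> at \<open>u = 1\<close>: the part of \<open>x\<close> with permutation \<open>w\<close> contributes to it
only if \<open>w = z\<close>.  The labels of \<open>f\<close> are the positions, so that \<open>f\<close> has no symmetries.\<close>
      have sums: "(\<Sum>C | partition_on ?S C \<and> monochrome C (a \<circ> z). e (C, id)) =
        (if monochrome B a then \<Sum>A | partition_on ?S A \<and> monochrome A a. d (A, z) else 0)" for a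
      proof -
        define f :: cword where "f = (\<lambda>i. ((a \<circ> z) i, i))"
        let ?\<psi> = "\<lambda>h. if h = f \<circ> id then 1 else 0 :: complex"
        have fst_f: "fst \<circ> (f \<circ> perm_inv z) = a"
          using permutes_inverses[OF z] by (auto simp: f_def fun_eq_iff)
        have inv_f: "f \<circ> perm_inv w \<circ> z = f \<circ> id \<longleftrightarrow> w = z" if w: "w permutes ?S" for w
        proof
          assume eq: "f \<circ> perm_inv w \<circ> z = f \<circ> id"
          have "perm_inv w (z i) = i" for i using fun_cong[OF eq, of i] by (simp add: f_def)
          then have "w (perm_inv w (z i)) = w i" for i by simp
          then show "w = z" using permutes_inverses[OF w] by (auto simp: fun_eq_iff)
        next
          assume wz: "w = z"
          show "f \<circ> perm_inv w \<circ> z = f \<circ> id"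
            unfolding wz using permutes_inverses[OF z] by (simp add: fun_eq_iff)
        qed
        have fc: "fst \<circ> (f \<circ> perm_inv z) \<circ> id = a" using fst_f by simp
        have summand: "d i * ?inv_op i (index_op (B, z) ?\<psi>) f = (if snd i = z then
            (if monochrome (fst i) a then (if monochrome B a then d (fst i, z) else 0) else 0) else 0)"
          if i: "i \<in> basis_index n" for i
        proof -
          have w: "snd i permutes ?S" using i by (auto simp: basis_index_def)
          show ?thesis
            using inv_f[OF w] fst_f by (cases i) (auto simp: mono_op_def)
        qed
        have finP: "finite {A. partition_on ?S A}" by (rule finite_partitions) simp
        have finW: "finite {w. w permutes ?S}" by (rule finite_permutations) simp
        have "(\<Sum>C | partition_on ?S C \<and> monochrome C (a \<circ> z). e (C, id)) = ?\<Theta> ?\<psi> f"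
          using index_op_sum[OF permutes_id[of ?S], of e "a \<circ> z"] e(2)[of ?\<psi> f] by (simp add: f_def)
        also have "\<dots> = (\<Sum>i\<in>basis_index n. if snd i = z then
            (if monochrome (fst i) a then (if monochrome B a then d (fst i, z) else 0) else 0) else 0)"
          by (rule sum.cong[OF refl summand])
        also have "\<dots> = (\<Sum>A | partition_on ?S A. \<Sum>w | w permutes ?S. if w = z then
            (if monochrome A a then (if monochrome B a then d (A, z) else 0) else 0) else 0)"
          unfolding basis_index_def sum.cartesian_product by (rule sum.cong) auto
        also have "\<dots> = (\<Sum>A | partition_on ?S A. if monochrome A a then (if monochrome B a then d (A, z) else 0) else 0)"
          using finW z by (simp add: sum.delta)
        also have "\<dots> = (\<Sum>A | partition_on ?S A \<and> monochrome A a. if monochrome B a then d (A, z) else 0)"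
          using sum.inter_filter[OF finP, of "\<lambda>A. if monochrome B a then d (A, z) else 0" "\<lambda>A. monochrome A a"] by simp
        also have "\<dots> = (if monochrome B a then \<Sum>A | partition_on ?S A \<and> monochrome A a. d (A, z) else 0)"
          by simp
        finally show ?thesis .
      qed
      \<comment> \<open>Conjugation by \<open>T\<^sub>z\<close> permutes the points; renaming them back gives conditions on the colouring itself.\<close>
      define e' where "e' C = e ((`) ((`) (perm_inv z)) C, id)" for C
      have "e' {?S} = 0"
        using e0 permutes_image[OF permutes_inv[OF z]] by (simp add: e'_def)
      moreover have "(\<Sum>C | partition_on ?S C \<and> monochrome C a. e' C) =
        (if monochrome B a then \<Sum>A | partition_on ?S A \<and> monochrome A a. d (A, z) else 0)" for a
        unfolding e'_def using sum_permuted_partitions[OF z, where c = a and e = "\<lambda>C. e (C, id)"] sums[of a] by simp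
      ultimately show ?thesis by blast
    qed
    then have "d (D, z) = 0"
      by (rule coarsest_colouring[of ?S "\<lambda>A. d (A, z)", rotated 2, OF _ D]) (use n in auto)
    then show False using j(2) Dz by simp
  qed
  then show ?thesis
    unfolding \<xi> by (intro BT.BC.add.finprod_one_eqI) (simp add: basis_elt_closed)
qed

section \<open>The isomorphism with the dual\<close>

lemma bt_phi_dual:
  assumes "n \<ge> 1" "x \<in> carrier (bt_algebra n)"
  shows "bt_phi n x \<in> bt_dual n"
  using assms by (simp add: bt_dual_def bt_phi_def bt_form_add_right bt_form_smult_right)

lemma dual_lin_comb:
  assumes f: "f \<in> bt_dual n"
  shows "f (lin_comb n c) = (\<Sum>i\<in>basis_index n. c i * f (basis_elt n i))"
proof -
  have add: "f (x \<oplus>\<^bsub>bt_algebra n\<^esub> y) = f x + f y"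
    and sm: "f (bt_smult n k x) = k * f x"
    if "x \<in> carrier (bt_algebra n)" "y \<in> carrier (bt_algebra n)" for x y k
    using f that by (auto simp: bt_dual_def)
  have zero: "f \<zero>\<^bsub>bt_algebra n\<^esub> = 0"
    using sm[of "\<zero>\<^bsub>bt_algebra n\<^esub>" "\<zero>\<^bsub>bt_algebra n\<^esub>" 0] by simp
  have "f (finsum (bt_algebra n) (\<lambda>i. bt_smult n (c i) (basis_elt n i)) I) = (\<Sum>i\<in>I. c i * f (basis_elt n i))"
    if "finite I" "I \<subseteq> basis_index n" for I
    using that
  proof (induction I rule: finite_induct)
    case empty
    then show ?case by (simp add: zero)
  next
    case (insert i I)
    have b: "basis_elt n i \<in> carrier (bt_algebra n)" using insert.prems basis_elt_closed by blast
    have g: "(\<lambda>i. bt_smult n (c i) (basis_elt n i)) \<in> I \<rightarrow> carrier (bt_algebra n)"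
      using insert.prems basis_elt_closed by (auto intro!: BTA.sm_closed)
    show ?case
      unfolding BT.BC.finsum_insert[OF insert.hyps g BTA.sm_closed[OF b]]
      using insert b BT.BC.finsum_closed[OF g] by (simp add: add sm)
  qed
  then show ?thesis using finite_basis_index by blast
qed

text \<open>The Gram matrix is square, and injective since the form has no radical.\<close>

lemma bt_phi_surj:
  assumes n: "n \<ge> 1" and f: "f \<in> bt_dual n"
  shows "\<exists>x \<in> carrier (bt_algebra n). bt_phi n x = f"
proof -
  define M where "M i j = bt_form n (basis_elt n i) (basis_elt n j)" for i j
  have "card (basis_index n) \<le> card (basis_index n) \<and> (card (basis_index n) = card (basis_index n) \<longrightarrow>
      (\<forall>x. \<exists>y. \<forall>j\<in>basis_index n. (\<Sum>i\<in>basis_index n. y i * M i j) = x j))"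
  proof (rule injective_system[OF finite_basis_index finite_basis_index])
    fix y i assume y: "\<And>j. j \<in> basis_index n \<Longrightarrow> (\<Sum>i\<in>basis_index n. y i * M i j) = 0" and i: "i \<in> basis_index n"
    have "lin_comb n y = \<zero>\<^bsub>bt_algebra n\<^esub>"
    proof (rule bt_form_nondegenerate[OF n lin_comb_closed])
      fix v assume "v \<in> carrier (bt_algebra n)"
      then obtain c where c: "v = lin_comb n c" using basis_span[OF n] by blast
      have "bt_form n (lin_comb n y) (basis_elt n j) = 0" if "j \<in> basis_index n" for j
        using bt_form_lin_comb_left[OF n basis_elt_closed[OF that]] y[OF that] by (simp add: M_def)
      then show "bt_form n (lin_comb n y) v = 0"
        unfolding c bt_form_lin_comb_right[OF n lin_comb_closed] by simp
    qed
    then show "y i = 0" by (rule basis_independent[OF _ i])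
  qed
  from this[THEN conjunct2, THEN mp, OF refl, THEN spec, of "\<lambda>j. f (basis_elt n j)"]
  obtain y where y: "\<And>j. j \<in> basis_index n \<Longrightarrow> (\<Sum>i\<in>basis_index n. y i * M i j) = f (basis_elt n j)"
    by blast
  have "bt_phi n (lin_comb n y) = f"
  proof (rule extensionalityI)
    show "bt_phi n (lin_comb n y) \<in> extensional (carrier (bt_algebra n))" "f \<in> extensional (carrier (bt_algebra n))"
      using f by (simp_all add: bt_phi_def bt_dual_def)
    fix v assume v: "v \<in> carrier (bt_algebra n)"
    then obtain c where c: "v = lin_comb n c" using basis_span[OF n] by blast
    have "bt_form n (lin_comb n y) (basis_elt n j) = f (basis_elt n j)" if "j \<in> basis_index n" for j
      using bt_form_lin_comb_left[OF n basis_elt_closed[OF that]] y[OF that] by (simp add: M_def)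
    then have "bt_form n (lin_comb n y) v = f v"
      unfolding c bt_form_lin_comb_right[OF n lin_comb_closed] dual_lin_comb[OF f] by (intro sum.cong) auto
    then show "bt_phi n (lin_comb n y) v = f v" using v by (simp add: bt_phi_def)
  qed
  then show ?thesis using lin_comb_closed by blast
qed

lemma bt_phi_inj:
  assumes n: "n \<ge> 1"
  shows "inj_on (bt_phi n) (carrier (bt_algebra n))"
proof (rule inj_onI)
  fix x y assume x: "x \<in> carrier (bt_algebra n)" and y: "y \<in> carrier (bt_algebra n)"
    and eq: "bt_phi n x = bt_phi n y"
  let ?d = "x \<oplus>\<^bsub>bt_algebra n\<^esub> bt_smult n (- 1) y"
  have "?d = \<zero>\<^bsub>bt_algebra n\<^esub>"
  proof (rule bt_form_nondegenerate[OF n])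
    fix v assume v: "v \<in> carrier (bt_algebra n)"
    have "bt_form n x v = bt_form n y v" using fun_cong[OF eq, of v] v by (simp add: bt_phi_def)
    then show "bt_form n ?d v = 0"
      using n x y v by (simp add: bt_form_add_left bt_form_smult_left)
  qed (use x y in simp)
  then have "x \<oplus>\<^bsub>bt_algebra n\<^esub> \<ominus>\<^bsub>bt_algebra n\<^esub> y = \<zero>\<^bsub>bt_algebra n\<^esub>"
    using y by (simp add: BTA.sm_minus_one)
  from BT.BC.minus_equality[OF this] show "x = y" using x y by simp
qed

lemma bt_dual_module_simps:
  "carrier (bt_dual_module n) = bt_dual n"
  "\<zero>\<^bsub>bt_dual_module n\<^esub> = (\<lambda>y \<in> carrier (bt_algebra n). 0)"
  "f \<oplus>\<^bsub>bt_dual_module n\<^esub> g = (\<lambda>y \<in> carrier (bt_algebra n). f y + g y)"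
  "x \<odot>\<^bsub>bt_dual_module n\<^esub> f = (\<lambda>y \<in> carrier (bt_algebra n). f (bt_star n x \<otimes>\<^bsub>bt_algebra n\<^esub> y))"
  by (simp_all add: bt_dual_module_def)

lemma bt_regular_module_simps:
  "carrier (bt_regular_module n) = carrier (bt_algebra n)"
  "\<zero>\<^bsub>bt_regular_module n\<^esub> = \<zero>\<^bsub>bt_algebra n\<^esub>"
  "x \<oplus>\<^bsub>bt_regular_module n\<^esub> y = x \<oplus>\<^bsub>bt_algebra n\<^esub> y"
  "x \<odot>\<^bsub>bt_regular_module n\<^esub> y = x \<otimes>\<^bsub>bt_algebra n\<^esub> y"
  by (simp_all add: bt_regular_module_def ring.defs)

lemma left_module_regular: "left_module (bt_algebra n) (bt_regular_module n)"
proof -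
  have "abelian_group (bt_regular_module n)"
  proof (rule abelian_groupI)
    fix x assume "x \<in> carrier (bt_regular_module n)"
    then show "\<exists>y\<in>carrier (bt_regular_module n). y \<oplus>\<^bsub>bt_regular_module n\<^esub> x = \<zero>\<^bsub>bt_regular_module n\<^esub>"
      by (intro bexI[of _ "\<ominus>\<^bsub>bt_algebra n\<^esub> x"]) (simp_all add: bt_regular_module_simps BT.BC.l_neg)
  qed (simp_all add: bt_regular_module_simps BT.BC.a_ac)
  then show ?thesis
    unfolding left_module_def
    by (simp add: bt_regular_module_simps BT.BC.ring_axioms BT.BC.l_distr BT.BC.r_distr BT.BC.m_assoc)
qed

lemma bt_dualI:
  assumes "f \<in> extensional (carrier (bt_algebra n))"
    "\<And>x y. x \<in> carrier (bt_algebra n) \<Longrightarrow> y \<in> carrier (bt_algebra n) \<Longrightarrow> f (x \<oplus>\<^bsub>bt_algebra n\<^esub> y) = f x + f y"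
    "\<And>k x. x \<in> carrier (bt_algebra n) \<Longrightarrow> f (bt_smult n k x) = k * f x"
  shows "f \<in> bt_dual n"
  using assms by (simp add: bt_dual_def)

lemma bt_dualD:
  assumes "f \<in> bt_dual n"
  shows "f \<in> extensional (carrier (bt_algebra n))"
    "x \<in> carrier (bt_algebra n) \<Longrightarrow> y \<in> carrier (bt_algebra n) \<Longrightarrow> f (x \<oplus>\<^bsub>bt_algebra n\<^esub> y) = f x + f y"
    "x \<in> carrier (bt_algebra n) \<Longrightarrow> f (bt_smult n k x) = k * f x"
  using assms by (simp_all add: bt_dual_def)

text \<open>The action \<open>(x f)(y) = f(x\<^sup>* y)\<close> is a left action because \<open>(a b)\<^sup>* = b\<^sup>* a\<^sup>*\<close>.\<close>

lemma left_module_dual: "left_module (bt_algebra n) (bt_dual_module n)"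
proof -
  have add: "(\<lambda>y \<in> carrier (bt_algebra n). f y + g y) \<in> bt_dual n" if "f \<in> bt_dual n" "g \<in> bt_dual n" for f g
    using bt_dualD[OF that(1)] bt_dualD[OF that(2)] by (intro bt_dualI) (simp_all add: algebra_simps)
  have uminus: "(\<lambda>y \<in> carrier (bt_algebra n). - f y) \<in> bt_dual n" if "f \<in> bt_dual n" for f
    using bt_dualD[OF that] by (intro bt_dualI) simp_all
  have smult: "(\<lambda>y \<in> carrier (bt_algebra n). f (bt_star n x \<otimes>\<^bsub>bt_algebra n\<^esub> y)) \<in> bt_dual n"
    if "f \<in> bt_dual n" "x \<in> carrier (bt_algebra n)" for f x
    using bt_dualD[OF that(1)] that(2)
    by (intro bt_dualI) (simp_all add: BT.BC.r_distr BTA.sm_mult_right)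
  have ext: "restrict f (carrier (bt_algebra n)) = f" if "f \<in> bt_dual n" for f
    using bt_dualD(1)[OF that] by (rule extensional_restrict)
  have "abelian_group (bt_dual_module n)"
  proof (rule abelian_groupI)
    show "\<zero>\<^bsub>bt_dual_module n\<^esub> \<in> carrier (bt_dual_module n)"
      unfolding bt_dual_module_simps by (intro bt_dualI) simp_all
    fix f assume f: "f \<in> carrier (bt_dual_module n)"
    then show "\<zero>\<^bsub>bt_dual_module n\<^esub> \<oplus>\<^bsub>bt_dual_module n\<^esub> f = f"
      using ext[of f] by (simp add: bt_dual_module_simps cong: restrict_cong)
    show "\<exists>g\<in>carrier (bt_dual_module n). g \<oplus>\<^bsub>bt_dual_module n\<^esub> f = \<zero>\<^bsub>bt_dual_module n\<^esub>"
      using f uminus[of f] unfolding bt_dual_module_simps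
      by (intro bexI[of _ "\<lambda>y \<in> carrier (bt_algebra n). - f y"]) (auto simp: restrict_def fun_eq_iff)
  next
    fix f g assume "f \<in> carrier (bt_dual_module n)" "g \<in> carrier (bt_dual_module n)"
    then show "f \<oplus>\<^bsub>bt_dual_module n\<^esub> g \<in> carrier (bt_dual_module n)"
      unfolding bt_dual_module_simps by (rule add)
  qed (auto simp: bt_dual_module_simps restrict_def fun_eq_iff add.assoc add.commute)
  then show ?thesis
    unfolding left_module_def bt_dual_module_simps
  proof (intro conjI ballI BT.BC.ring_axioms)
    fix a b f assume a: "a \<in> carrier (bt_algebra n)" and b: "b \<in> carrier (bt_algebra n)" and f: "f \<in> bt_dual n"
    show "(\<lambda>y\<in>carrier (bt_algebra n). f (bt_star n (a \<oplus>\<^bsub>bt_algebra n\<^esub> b) \<otimes>\<^bsub>bt_algebra n\<^esub> y))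
      = (\<lambda>y\<in>carrier (bt_algebra n). (\<lambda>y\<in>carrier (bt_algebra n). f (bt_star n a \<otimes>\<^bsub>bt_algebra n\<^esub> y)) y
          + (\<lambda>y\<in>carrier (bt_algebra n). f (bt_star n b \<otimes>\<^bsub>bt_algebra n\<^esub> y)) y)"
      using a b bt_dualD(2)[OF f] by (intro restrict_ext) (simp add: bt_star_add BT.BC.l_distr)
    show "(\<lambda>y\<in>carrier (bt_algebra n). f (bt_star n (a \<otimes>\<^bsub>bt_algebra n\<^esub> b) \<otimes>\<^bsub>bt_algebra n\<^esub> y))
      = (\<lambda>y\<in>carrier (bt_algebra n). (\<lambda>y\<in>carrier (bt_algebra n). f (bt_star n b \<otimes>\<^bsub>bt_algebra n\<^esub> y))
          (bt_star n a \<otimes>\<^bsub>bt_algebra n\<^esub> y))"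
      using a b by (intro restrict_ext) (simp add: bt_star_mult BT.BC.m_assoc)
  next
    fix a f g assume a: "a \<in> carrier (bt_algebra n)" and f: "f \<in> bt_dual n" and g: "g \<in> bt_dual n"
    show "(\<lambda>y\<in>carrier (bt_algebra n). (\<lambda>y\<in>carrier (bt_algebra n). f y + g y) (bt_star n a \<otimes>\<^bsub>bt_algebra n\<^esub> y))
      = (\<lambda>y\<in>carrier (bt_algebra n). (\<lambda>y\<in>carrier (bt_algebra n). f (bt_star n a \<otimes>\<^bsub>bt_algebra n\<^esub> y)) y
          + (\<lambda>y\<in>carrier (bt_algebra n). g (bt_star n a \<otimes>\<^bsub>bt_algebra n\<^esub> y)) y)"
      using a by (intro restrict_ext) simp
  next
    fix f assume f: "f \<in> bt_dual n"
    show "(\<lambda>y\<in>carrier (bt_algebra n). f (bt_star n \<one>\<^bsub>bt_algebra n\<^esub> \<otimes>\<^bsub>bt_algebra n\<^esub> y)) = f"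
      using ext[OF f] by (simp cong: restrict_cong)
  qed (use smult in auto)
qed

theorem theorem4:
  fixes n :: nat
  assumes "n \<ge> 1"
  shows "left_module_iso (bt_algebra n) (bt_regular_module n) (bt_dual_module n) (bt_phi n)"
  unfolding left_module_iso_def bt_regular_module_simps bt_dual_module_simps
proof (intro conjI ballI left_module_regular left_module_dual)
  show "bij_betw (bt_phi n) (carrier (bt_algebra n)) (bt_dual n)"
    unfolding bij_betw_def
  proof (intro conjI bt_phi_inj[OF assms] equalityI subsetI)
    fix f assume "f \<in> bt_phi n ` carrier (bt_algebra n)"
    then show "f \<in> bt_dual n" using bt_phi_dual[OF assms] by blast
  next
    fix f assume "f \<in> bt_dual n"
    then show "f \<in> bt_phi n ` carrier (bt_algebra n)" using bt_phi_surj[OF assms] by blast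
  qed
next
  fix x y assume "x \<in> carrier (bt_algebra n)" "y \<in> carrier (bt_algebra n)"
  then show "bt_phi n (x \<oplus>\<^bsub>bt_algebra n\<^esub> y)
      = (\<lambda>v\<in>carrier (bt_algebra n). bt_phi n x v + bt_phi n y v)"
    unfolding bt_phi_def using assms by (intro restrict_ext) (simp add: bt_form_add_left)
next
  fix a x assume "a \<in> carrier (bt_algebra n)" "x \<in> carrier (bt_algebra n)"
  then show "bt_phi n (a \<otimes>\<^bsub>bt_algebra n\<^esub> x)
      = (\<lambda>y\<in>carrier (bt_algebra n). bt_phi n x (bt_star n a \<otimes>\<^bsub>bt_algebra n\<^esub> y))"
    unfolding bt_phi_def bt_form_def
    by (intro restrict_ext) (simp add: bt_star_mult BT.BC.m_assoc)
qed

end
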